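(* Let $G$ and $H$ be two quantum isomorphic connected graphs. Then: (1) there exists a graph morphism $\alpha:\mathcal T(G)\to\mathcal T(H)$ such that $\alpha$ is an isomorphism between the block trees of $G$ and $H$ that preserves the colours (blocks are mapped to blocks and cut vertices to cut vertices), and such that for every block $b$ of $G$ we have $b\simeq_q\alpha(b)$; (2) there exists a graph morphism $\beta:\mathcal B(G)\to\mathcal B(H)$ such that $\beta$ is an isomorphism between the block graphs of $G$ and $H$, and such that for every block $b$ of $G$ we have $b\simeq_q\beta(b)$.
   Context: All graphs are finite and simple (no loops, no multiple edges); connected graphs are nonempty. $\mathrm{Adj}(G)$ is the adjacency matrix. A graph morphism is a map on vertices sending edges to edges. Quantum isomorphism: a magic unitary with coefficients in a (nonzero) unital $C^*$-algebra $X$ is a matrix $U=(u_{ij})_{i\in I,j\in J}$ with $I,J$ finite, $u_{ij}=u_{ij}^2=u_{ij}^*\in X$, and $\sum_{k\in I}u_{kj}=1=\sum_{k\in J}u_{ik}$ for all $i\in I,j\in J$. A quantum isomorphism from a graph $G$ to a graph $H$ with the same number of vertices is a magic unitary $U$ indexed by $V(H)\times V(G)$ with $U\,\mathrm{Adj}(G)=\mathrm{Adj}(H)\,U$. $G$ and $H$ are quantum isomorphic, written $G\simeq_q H$, if such a $U$ exists over some nonzero unital $C^*$-algebra. Blocks: if $G$ has at least two vertices, a cut vertex of $G$ is a vertex $v$ such that $G\setminus\{v\}$ has strictly more connected components than $G$; for a graph on one vertex, its only vertex is by convention a cut vertex. A graph is 2-connected if it is connected and for every vertex $v$ the graph $G\setminus\{v\}$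 is connected and nonempty (so $K_2$ is 2-connected and $K_1$ is not). A block of $G$ is a maximal 2-connected subgraph of $G$; a block is also identified with its vertex set, and $b\simeq_q b'$ for blocks means that the graphs induced on $b$ and $b'$ are quantum isomorphic. The block tree $\mathcal T(G)$ has vertex set the disjoint union of the set of blocks of $G$ and the set of cut vertices of $G$, with an edge between a cut vertex $c$ and a block $b$ iff $c\in b$; it is 2-coloured: blocks are white, cut vertices are black. The block graph $\mathcal B(G)$ has as vertices the blocks of $G$, two distinct blocks being adjacent iff they intersect. *)

theory Defs
  imports
    "HOL-Analysis.Abstract_Metric_Spaces"
    "HOL-Algebra.Module"
    "Graph_Theory.Digraph_Component"
begin

section \<open>Unital C*-algebras\<close>

text \<open>
  The algebras are carrier-based, as in HOL-Algebra: a type class would not allow a corner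
  \<open>pAp\<close> or a subalgebra of a given algebra to live on the same type. The fields \<open>carrier\<close>,
  \<open>mult\<close>, \<open>one\<close>, \<open>zero\<close>, \<open>add\<close>, \<open>smult\<close> are inherited; scalars are complex numbers.
\<close>

record 'x cstar = "(complex, 'x) module" +
  star :: "'x \<Rightarrow> 'x"
  nrm :: "'x \<Rightarrow> real"

locale unital_cstar_algebra = ring A for A :: "'x cstar" (structure) +
  assumes smult_closed: "x \<in> carrier A \<Longrightarrow> c \<odot> x \<in> carrier A"
    and smult_l_distr: "x \<in> carrier A \<Longrightarrow> (c + d) \<odot> x = (c \<odot> x) \<oplus> (d \<odot> x)"
    and smult_r_distr:
      "\<lbrakk>x \<in> carrier A; y \<in> carrier A\<rbrakk> \<Longrightarrow> c \<odot> (x \<oplus> y) = (c \<odot> x) \<oplus> (c \<odot> y)"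
    and smult_smult: "x \<in> carrier A \<Longrightarrow> (c * d) \<odot> x = c \<odot> (d \<odot> x)"
    and smult_one: "x \<in> carrier A \<Longrightarrow> 1 \<odot> x = x"
    and smult_mult_left:
      "\<lbrakk>x \<in> carrier A; y \<in> carrier A\<rbrakk> \<Longrightarrow> (c \<odot> x) \<otimes> y = c \<odot> (x \<otimes> y)"
    and smult_mult_right:
      "\<lbrakk>x \<in> carrier A; y \<in> carrier A\<rbrakk> \<Longrightarrow> x \<otimes> (c \<odot> y) = c \<odot> (x \<otimes> y)"
    and star_closed: "x \<in> carrier A \<Longrightarrow> star A x \<in> carrier A"
    and star_star: "x \<in> carrier A \<Longrightarrow> star A (star A x) = x"
    and star_add:
      "\<lbrakk>x \<in> carrier A; y \<in> carrier A\<rbrakk> \<Longrightarrow> star A (x \<oplus> y) = star A x \<oplus> star A y"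
    and star_smult: "x \<in> carrier A \<Longrightarrow> star A (c \<odot> x) = cnj c \<odot> star A x"
    and star_mult:
      "\<lbrakk>x \<in> carrier A; y \<in> carrier A\<rbrakk> \<Longrightarrow> star A (x \<otimes> y) = star A y \<otimes> star A x"
    and nrm_nonneg: "x \<in> carrier A \<Longrightarrow> nrm A x \<ge> 0"
    and nrm_eq_0_iff: "x \<in> carrier A \<Longrightarrow> nrm A x = 0 \<longleftrightarrow> x = \<zero>"
    and nrm_triangle:
      "\<lbrakk>x \<in> carrier A; y \<in> carrier A\<rbrakk> \<Longrightarrow> nrm A (x \<oplus> y) \<le> nrm A x + nrm A y"
    and nrm_smult: "x \<in> carrier A \<Longrightarrow> nrm A (c \<odot> x) = cmod c * nrm A x"
    and nrm_mult: "\<lbrakk>x \<in> carrier A; y \<in> carrier A\<rbrakk> \<Longrightarrow> nrm A (x \<otimes> y) \<le> nrm A x * nrm A y"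
    and cstar_identity: "x \<in> carrier A \<Longrightarrow> nrm A (star A x \<otimes> x) = (nrm A x)\<^sup>2"
    and complete: "Metric_space.mcomplete (carrier A) (\<lambda>x y. nrm A (x \<ominus> y))"


section \<open>Quantum isomorphism of graphs\<close>

definition magic_unitary :: "'x cstar \<Rightarrow> 'i set \<Rightarrow> 'j set \<Rightarrow> ('i \<Rightarrow> 'j \<Rightarrow> 'x) \<Rightarrow> bool" where
  "magic_unitary A I J U \<longleftrightarrow>
     finite I \<and> finite J \<and>
     (\<forall>i\<in>I. \<forall>j\<in>J. U i j \<in> carrier A \<and> U i j \<otimes>\<^bsub>A\<^esub> U i j = U i j \<and> star A (U i j) = U i j) \<and>
     (\<forall>j\<in>J. (\<Oplus>\<^bsub>A\<^esub>k\<in>I. U k j) = \<one>\<^bsub>A\<^esub>) \<and>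
     (\<forall>i\<in>I. (\<Oplus>\<^bsub>A\<^esub>k\<in>J. U i k) = \<one>\<^bsub>A\<^esub>)"

definition adj :: "('a, 'b) pre_digraph \<Rightarrow> 'a \<Rightarrow> 'a \<Rightarrow> complex" where
  "adj G u v = (if u \<rightarrow>\<^bsub>G\<^esub> v then 1 else 0)"

text \<open>The last conjunct is \<open>U Adj(G) = Adj(H) U\<close>, entry by entry.\<close>

definition quantum_isomorphism ::
  "'x cstar \<Rightarrow> ('a, 'b) pre_digraph \<Rightarrow> ('c, 'd) pre_digraph \<Rightarrow> ('c \<Rightarrow> 'a \<Rightarrow> 'x) \<Rightarrow> bool" where
  "quantum_isomorphism A G H U \<longleftrightarrow>
     card (verts G) = card (verts H) \<and>
     magic_unitary A (verts H) (verts G) U \<and>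
     (\<forall>i\<in>verts H. \<forall>j\<in>verts G.
        (\<Oplus>\<^bsub>A\<^esub>k\<in>verts G. adj G k j \<odot>\<^bsub>A\<^esub> U i k) = (\<Oplus>\<^bsub>A\<^esub>k\<in>verts H. adj H i k \<odot>\<^bsub>A\<^esub> U k j))"

text \<open>
  HOL cannot quantify over types inside a formula, so the type on which the C*-algebra is
  carried is a parameter; the algebra itself, including its carrier set, is quantified.
\<close>

definition quantum_isomorphic ::
  "'x itself \<Rightarrow> ('a, 'b) pre_digraph \<Rightarrow> ('c, 'd) pre_digraph \<Rightarrow> bool" where
  "quantum_isomorphic _ G H \<longleftrightarrow>
     (\<exists>(A :: 'x cstar) U. unital_cstar_algebra A \<and> \<one>\<^bsub>A\<^esub> \<noteq> \<zero>\<^bsub>A\<^esub> \<and> quantum_isomorphism A G H U)"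


section \<open>Blocks, block trees and block graphs\<close>

text \<open>
  Finite simple graphs are the symmetric digraphs of the locale \<open>graph\<close>. For them the strongly
  connected components \<open>sccs\<close> are the connected components, and \<open>connected\<close>
  includes nonemptiness.
\<close>

definition cut_vertices :: "('a, 'b) pre_digraph \<Rightarrow> 'a set" where
  "cut_vertices G = {v \<in> verts G.
     if card (verts G) = 1 then True
     else card (pre_digraph.sccs (pre_digraph.del_vert G v)) > card (pre_digraph.sccs G)}"

definition two_connected :: "('a, 'b) pre_digraph \<Rightarrow> bool" where
  "two_connected G \<longleftrightarrow>
     graph G \<and> Digraph_Component.connected G \<and>
     (\<forall>v\<in>verts G. Digraph_Component.connected (pre_digraph.del_vert G v))"

definition blocks :: "('a, 'b) pre_digraph \<Rightarrow> ('a, 'b) pre_digraph set" where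
  "blocks G = {B. pre_digraph.max_subgraph G two_connected B}"

text \<open>
  The disjoint union is a sum type: white vertices are of the form \<open>Inl b\<close>, black ones
  of the form \<open>Inr c\<close>.
\<close>

definition block_tree :: "('a, 'b) pre_digraph \<Rightarrow> (('a, 'b) pre_digraph + 'a) pair_pre_digraph" where
  "block_tree G =
     \<lparr>pverts = Inl ` blocks G \<union> Inr ` cut_vertices G,
      parcs = {(Inl b, Inr c) |b c. b \<in> blocks G \<and> c \<in> cut_vertices G \<and> c \<in> verts b} \<union>
              {(Inr c, Inl b) |b c. b \<in> blocks G \<and> c \<in> cut_vertices G \<and> c \<in> verts b}\<rparr>"

definition block_graph :: "('a, 'b) pre_digraph \<Rightarrow> ('a, 'b) pre_digraph pair_pre_digraph" where
  "block_graph G =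
     \<lparr>pverts = blocks G,
      parcs = {(b, b'). b \<in> blocks G \<and> b' \<in> blocks G \<and> b \<noteq> b' \<and> verts b \<inter> verts b' \<noteq> {}}\<rparr>"


section \<open>Graph morphisms and isomorphisms\<close>

definition graph_morphism ::
  "('a \<Rightarrow> 'c) \<Rightarrow> 'a pair_pre_digraph \<Rightarrow> 'c pair_pre_digraph \<Rightarrow> bool" where
  "graph_morphism f G H \<longleftrightarrow>
     f ` pverts G \<subseteq> pverts H \<and> (\<forall>u v. (u, v) \<in> parcs G \<longrightarrow> (f u, f v) \<in> parcs H)"

definition graph_isomorphism ::
  "('a \<Rightarrow> 'c) \<Rightarrow> 'a pair_pre_digraph \<Rightarrow> 'c pair_pre_digraph \<Rightarrow> bool" where
  "graph_isomorphism f G H \<longleftrightarrow>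
     graph_morphism f G H \<and> bij_betw f (pverts G) (pverts H) \<and>
     graph_morphism (the_inv_into (pverts G) f) H G"

end

theory Submission
  imports Defs
begin

text \<open>
  If \<open>u x a \<otimes> u y b \<noteq> 0\<close> then \<open>x, y\<close> and \<open>a, b\<close> are joined by equally many walks of each
  length. A first-passage decomposition expresses separation of two vertices by a third one
  through walk counts, so nonzero products of entries also preserve distances and the relation of
  lying in a common block. The centre of a connected graph lies within one block and is
  respected by the quantum isomorphism; it serves as a root. Descending from the root, the entries
  of \<open>u\<close> summed over the vertices hanging below a block vertex form magic unitaries again, and Hall's
  theorem applied to the support of a magic unitary yields matchings of branches with branches and
  of blocks with blocks. Each matched pair of blocks comes with a nonzero projection \<open>p\<close> that
  commutes with the entries between them and turns them into a magic unitary over \<open>pAp\<close>.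
\<close>

section \<open>Walks and separation in finite connected graphs\<close>

text \<open>The object constructed is a plain bijection of vertices that preserves the relation of
  lying in a common block. Blocks, their intersections and the cut vertices can be recovered from
  that relation, so one bijection yields both isomorphisms. It need not preserve adjacency, as
  quantum isomorphic blocks need not be isomorphic. The obstacle is that a magic unitary singles out
  no image for a vertex: images are chosen by matchings at each branching, and a choice must stay
  compatible with those made below it. The recursion therefore carries a nonzero projection
  \<open>q\<close> with \<open>q \<otimes> u r' r = q\<close>. Below \<open>q\<close> the root
  \<open>r\<close> has the definite image \<open>r'\<close>, and every nonzero entry below
  \<open>q\<close> is linked to that of the root, so separation by \<open>r\<close> can be compared
  with separation by \<open>r'\<close>. Orthogonality within rows and columns rests on the fact that
  projections with sum one annihilate each other. This is a statement about positivity; it is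
  derived from the norm axioms alone, without spectral theory, and the same notion of positivity
  supplies the counting behind Hall's condition.\<close>

definition conn_avoiding :: "('v \<times> 'v) set \<Rightarrow> 'v \<Rightarrow> 'v \<Rightarrow> 'v \<Rightarrow> bool" where
  "conn_avoiding R v a b \<longleftrightarrow> (a, b) \<in> (R \<inter> (- {v}) \<times> (- {v}))\<^sup>*"

text \<open>The entries of the \<open>n\<close>-th power of the adjacency matrix, kept as natural
  numbers so that positivity means existence of a walk.\<close>

primrec walks :: "'v set \<Rightarrow> ('v \<times> 'v) set \<Rightarrow> nat \<Rightarrow> 'v \<Rightarrow> 'v \<Rightarrow> nat" where
  "walks V R 0 a b = (if a = b then 1 else 0)"
| "walks V R (Suc n) a b = (\<Sum>c | c \<in> V \<and> (a, c) \<in> R. walks V R n c b)"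

primrec avoiding_walks :: "'v set \<Rightarrow> ('v \<times> 'v) set \<Rightarrow> 'v \<Rightarrow> nat \<Rightarrow> 'v \<Rightarrow> 'v \<Rightarrow> nat" where
  "avoiding_walks V R v 0 a b = (if a = b \<and> a \<noteq> v then 1 else 0)"
| "avoiding_walks V R v (Suc n) a b =
     (if a = v then 0 else \<Sum>c | c \<in> V \<and> (a, c) \<in> R. avoiding_walks V R v n c b)"

primrec first_passages :: "'v set \<Rightarrow> ('v \<times> 'v) set \<Rightarrow> nat \<Rightarrow> 'v \<Rightarrow> 'v \<Rightarrow> nat" where
  "first_passages V R 0 a v = (if a = v then 1 else 0)"
| "first_passages V R (Suc n) a v =
     (if a = v then 0 else \<Sum>c | c \<in> V \<and> (a, c) \<in> R. first_passages V R n c v)"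

text \<open>A walk either misses \<open>v\<close> or splits uniquely at its first visit to
  \<open>v\<close>. For \<open>a = v\<close> only the summand \<open>k = 0\<close> survives.\<close>

lemma walks_decomp:
  "walks V R n a b =
     avoiding_walks V R v n a b +
     (\<Sum>k\<le>n. first_passages V R k a v * walks V R (n - k) v b)"
proof (induction n arbitrary: a)
  case 0
  show ?case by auto
next
  case (Suc n)
  let ?F = "first_passages V R" and ?W = "walks V R" and ?N = "{c. c \<in> V \<and> (a, c) \<in> R}"
  have split: "(\<Sum>k\<le>Suc n. ?F k a v * ?W (Suc n - k) v b) =
      ?F 0 a v * ?W (Suc n) v b + (\<Sum>k\<le>n. ?F (Suc k) a v * ?W (n - k) v b)"
    by (subst sum.atMost_Suc_shift) simp
  show ?case
  proof (cases "a = v")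
    case True
    then show ?thesis unfolding split by simp
  next
    case False
    have "?W (Suc n) a b = (\<Sum>c\<in>?N. avoiding_walks V R v n c b) +
        (\<Sum>c\<in>?N. \<Sum>k\<le>n. ?F k c v * ?W (n - k) v b)"
      by (simp add: Suc.IH sum.distrib)
    also have "(\<Sum>c\<in>?N. \<Sum>k\<le>n. ?F k c v * ?W (n - k) v b) =
        (\<Sum>k\<le>n. ?F (Suc k) a v * ?W (n - k) v b)"
      using False by (subst sum.swap) (simp add: sum_distrib_right)
    finally show ?thesis
      using False unfolding split by simp
  qed
qed

lemma avoiding_walks_target: "avoiding_walks V R v n a v = 0"
  by (induction n arbitrary: a) auto

text \<open>The decomposition at the first passage, read at \<open>b = v\<close>, determines the
  first passage counts recursively from the walk counts, because \<open>walks 0 v v = 1\<close>.\<close>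

lemma first_passages_cong:
  assumes av: "\<And>n. walks V R n a v = walks V' R' n x t"
    and vv: "\<And>n. walks V R n v v = walks V' R' n t t"
  shows "first_passages V R n a v = first_passages V' R' n x t"
proof (induction n rule: less_induct)
  case (less n)
  have dec: "walks V R n a v = first_passages V R n a v +
      (\<Sum>k<n. first_passages V R k a v * walks V R (n - k) v v)" for V :: "'c set" and R n a v
    using walks_decomp[of V R n a v v]
    by (simp add: avoiding_walks_target flip: lessThan_Suc_atMost)
  have dec': "walks V R n a v = first_passages V R n a v +
      (\<Sum>k<n. first_passages V R k a v * walks V R (n - k) v v)" for V :: "'d set" and R n a v
    using walks_decomp[of V R n a v v]
    by (simp add: avoiding_walks_target flip: lessThan_Suc_atMost)
  have "(\<Sum>k<n. first_passages V R k a v * walks V R (n - k) v v) =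
      (\<Sum>k<n. first_passages V' R' k x t * walks V' R' (n - k) t t)"
    by (intro sum.cong refl) (simp add: less vv)
  then show ?case
    using dec[of V R n a v] dec'[of V' R' n x t] av[of n] by linarith
qed

text \<open>In the first-passage decomposition every term other than the avoiding walks is a
  function of walk counts among the three vertices.\<close>

lemma avoiding_walks_cong:
  assumes "\<And>n. walks V R n a v = walks V' R' n x t"
    and "\<And>n. walks V R n v v = walks V' R' n t t"
    and "\<And>n. walks V R n v b = walks V' R' n t y"
    and "\<And>n. walks V R n a b = walks V' R' n x y"
  shows "avoiding_walks V R v n a b = avoiding_walks V' R' t n x y"
  using walks_decomp[of V R n a b v] walks_decomp[of V' R' n x y t] assms
    first_passages_cong[of V R a v V' R' x t] by simp

lemma avoiding_walks_imp_conn: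
  "avoiding_walks V R v n a b > 0 \<Longrightarrow> conn_avoiding R v a b \<and> a \<noteq> v"
proof (induction n arbitrary: a)
  case 0
  then show ?case by (auto simp: conn_avoiding_def split: if_splits)
next
  case (Suc n)
  then have "a \<noteq> v" and "(\<Sum>c | c \<in> V \<and> (a, c) \<in> R. avoiding_walks V R v n c b) > 0"
    by (auto split: if_splits)
  then obtain c where c: "(a, c) \<in> R" "avoiding_walks V R v n c b > 0"
    by (metis (mono_tags, lifting) mem_Collect_eq not_gr_zero sum.neutral)
  with Suc.IH \<open>a \<noteq> v\<close> show ?case
    unfolding conn_avoiding_def by (auto intro: converse_rtrancl_into_rtrancl)
qed

lemma conn_imp_avoiding_walks:
  assumes "finite V" "R \<subseteq> V \<times> V" "b \<noteq> v" "conn_avoiding R v a b"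
  shows "\<exists>n. avoiding_walks V R v n a b > 0"
  using assms(4) unfolding conn_avoiding_def
proof (induction rule: converse_rtrancl_induct)
  case base
  have "avoiding_walks V R v 0 b b > 0" using assms(3) by simp
  then show ?case by blast
next
  case (step a c)
  then obtain n where n: "avoiding_walks V R v n c b > 0" by blast
  have "c \<in> {c. c \<in> V \<and> (a, c) \<in> R}" "finite {c. c \<in> V \<and> (a, c) \<in> R}"
    using step(1) assms(1,2) by auto
  then have "(\<Sum>c | c \<in> V \<and> (a, c) \<in> R. avoiding_walks V R v n c b) > 0"
    using n by (metis (no_types, lifting) not_gr_zero sum_eq_0_iff)
  with step(1) have "avoiding_walks V R v (Suc n) a b > 0" by auto
  then show ?case by blast
qed

section \<open>Blocks of a connected graph and the branches attached to them\<close>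

locale fin_conn_graph =
  fixes V :: "'v set" and R :: "('v \<times> 'v) set"
  assumes fin: "finite V" and edges: "R \<subseteq> V \<times> V" and symR: "sym R"
    and connected: "\<lbrakk>a \<in> V; b \<in> V\<rbrakk> \<Longrightarrow> (a, b) \<in> R\<^sup>*"
begin

abbreviation "conn \<equiv> conn_avoiding R"

text \<open>No third vertex separates the two. Adjacent vertices qualify, so a bridge yields a block
  with two vertices. The relation is reflexive and symmetric, but it can fail to be transitive
  across a cut vertex.\<close>

definition same_block :: "'v \<Rightarrow> 'v \<Rightarrow> bool" where
  "same_block a b \<longleftrightarrow> (\<forall>v\<in>V. v \<noteq> a \<and> v \<noteq> b \<longrightarrow> conn v a b)"

text \<open>Two distinct vertices lie in at most one common block; this recovers it from any such
  pair, see \<open>is_block_eq_block_of\<close>.\<close>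

definition block_of :: "'v \<Rightarrow> 'v \<Rightarrow> 'v set" where
  "block_of a b = {c \<in> V. same_block c a \<and> same_block c b}"

text \<open>The condition \<open>a \<noteq> b\<close> excludes single vertices, in accordance with
  \<open>K_1\<close> not being 2-connected.\<close>

definition is_block :: "'v set \<Rightarrow> bool" where
  "is_block B \<longleftrightarrow> (\<exists>a\<in>V. \<exists>b\<in>V. a \<noteq> b \<and> same_block a b \<and> B = block_of a b)"

text \<open>\<open>anchored B k a\<close>: \<open>a\<close> is the vertex of \<open>B\<close> through which \<open>k\<close> is attached to \<open>B\<close>.\<close>

definition anchored :: "'v set \<Rightarrow> 'v \<Rightarrow> 'v \<Rightarrow> bool" where
  "anchored B k a \<longleftrightarrow> a \<in> B \<and> (k = a \<or> (\<exists>c\<in>B. c \<noteq> a \<and> \<not> conn a k c))"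

lemma conn_refl [simp]: "conn v a a"
  by (simp add: conn_avoiding_def)

lemma conn_trans: "conn v a b \<Longrightarrow> conn v b c \<Longrightarrow> conn v a c"
  by (simp add: conn_avoiding_def)

lemma conn_sym: "conn v a b \<Longrightarrow> conn v b a"
  unfolding conn_avoiding_def
  by (rule symD[OF sym_rtrancl]) (use symR in \<open>auto simp: sym_def\<close>)

lemma conn_edge: "(a, b) \<in> R \<Longrightarrow> a \<noteq> v \<Longrightarrow> b \<noteq> v \<Longrightarrow> conn v a b"
  unfolding conn_avoiding_def by auto

text \<open>Reflexivity of the closure relates \<open>v\<close> to itself even though
  \<open>v\<close> is removed; this is the only pair that involves \<open>v\<close>.\<close>

lemma conn_not_fst: "conn v v b \<Longrightarrow> b = v"
  unfolding conn_avoiding_def by (auto elim: converse_rtranclE)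

lemma conn_neq: "conn v a b \<Longrightarrow> a \<noteq> v \<Longrightarrow> b \<noteq> v"
  using conn_not_fst[of v a] conn_sym[of v a b] by metis

text \<open>The bridge from separation to walk counts. The condition \<open>b \<noteq> v\<close>
  excludes the degenerate reflexive pair.\<close>

lemma conn_iff_avoiding_walks:
  "b \<noteq> v \<Longrightarrow> conn v a b \<longleftrightarrow> (\<exists>n. avoiding_walks V R v n a b > 0)"
  using conn_imp_avoiding_walks[OF fin edges] avoiding_walks_imp_conn by metis

text \<open>A path from \<open>k\<close> to \<open>c\<close> that avoids \<open>a\<close> either
  misses \<open>v\<close>, or its part from \<open>v\<close> onwards still avoids
  \<open>a\<close>.\<close>

lemma conn_or_through:
  assumes "conn a k c" "c \<noteq> v"
  shows "conn v k c \<or> conn a v c"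
  using assms(1) unfolding conn_avoiding_def
proof (induction rule: converse_rtrancl_induct)
  case (step k k')
  show ?case
  proof (cases "k = v")
    case True
    then show ?thesis using step by (auto intro: converse_rtrancl_into_rtrancl)
  next
    case False
    have "k' \<noteq> v" if "conn v k' c" using that assms(2) conn_not_fst by blast
    then show ?thesis using step False
      by (auto simp: conn_avoiding_def intro: converse_rtrancl_into_rtrancl)
  qed
qed auto

text \<open>Cut a walk from \<open>k\<close> to \<open>c\<close> at its last visit to
  \<open>{k, v}\<close>: the rest starts at one of the two and never meets the other.\<close>

lemma conn_one_avoids_other:
  assumes "k \<in> V" "c \<in> V" "c \<noteq> k" "c \<noteq> v" "k \<noteq> v"
  shows "conn v k c \<or> conn k v c"
proof -
  let ?S = "R \<inter> (- {v, k}) \<times> (- {v, k})"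
  have "(m, c) \<in> ?S\<^sup>* \<or> conn v k c \<or> conn k v c" if "(m, c) \<in> R\<^sup>*" for m
    using that
  proof (induction rule: converse_rtrancl_induct)
    case (step m m')
    show ?case
    proof (cases "(m', c) \<in> ?S\<^sup>*")
      case True
      then have m': "v \<noteq> m'" "m' \<noteq> v" "m' \<noteq> k"
        using assms(3,4) by (auto elim: converse_rtranclE)
      have "?S\<^sup>* \<subseteq> (R \<inter> (- {v}) \<times> (- {v}))\<^sup>*" "?S\<^sup>* \<subseteq> (R \<inter> (- {k}) \<times> (- {k}))\<^sup>*"
        by (intro rtrancl_mono; auto)+
      then have c: "conn v m' c" "conn k m' c"
        using True unfolding conn_avoiding_def by auto
      consider "m = k" | "m = v" | "m \<noteq> k" "m \<noteq> v" by blast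
      then show ?thesis
      proof cases
        case 1
        then have "conn v k m'" using conn_edge[OF step(1), of v] m' assms(5) by simp
        then show ?thesis using c conn_trans by blast
      next
        case 2
        then have "conn k v m'" using conn_edge[OF step(1), of k] m' assms(5) by simp
        then show ?thesis using c conn_trans by blast
      next
        case 3
        then have "(m, m') \<in> ?S" using step(1) m' by auto
        then show ?thesis using True by (meson converse_rtrancl_into_rtrancl)
      qed
    qed (use step in blast)
  qed auto
  moreover have "(k, c) \<notin> ?S\<^sup>*" using assms(3) by (auto elim: converse_rtranclE)
  ultimately show ?thesis using connected assms(1,2) by blast
qed

lemma same_block_refl [simp]: "same_block a a"
  by (simp add: same_block_def)

lemma same_block_sym: "same_block a b \<Longrightarrow> same_block b a"
  unfolding same_block_def using conn_sym by blast

lemma same_block_edge: "(a, b) \<in> R \<Longrightarrow> same_block a b"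
  unfolding same_block_def using conn_edge by auto

lemma same_block_conn: "same_block a b \<Longrightarrow> v \<in> V \<Longrightarrow> v \<noteq> a \<Longrightarrow> v \<noteq> b \<Longrightarrow> conn v a b"
  unfolding same_block_def by blast

text \<open>The vertex just before the first visit to \<open>v\<close> on a walk from
  \<open>k\<close>. Hence each component left after removing \<open>v\<close> contains a neighbour
  of \<open>v\<close>.\<close>

lemma exists_neighbour_towards:
  assumes "v \<in> V" "k \<in> V" "k \<noteq> v"
  obtains k' where "k' \<in> V" "k' \<noteq> v" "(v, k') \<in> R" "conn v k k'"
proof -
  have "\<exists>k'. k' \<noteq> v \<and> (v, k') \<in> R \<and> conn v m k'" if "(m, v) \<in> R\<^sup>*" "m \<noteq> v" for m
    using that
  proof (induction rule: converse_rtrancl_induct)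
    case (step m m')
    show ?case
    proof (cases "m' = v")
      case True
      then show ?thesis using step symR by (metis conn_refl symD)
    next
      case False
      then show ?thesis using step conn_trans conn_edge by blast
    qed
  qed simp
  then obtain k' where "k' \<noteq> v" "(v, k') \<in> R" "conn v k k'"
    using connected assms by blast
  then show ?thesis using that edges by blast
qed

text \<open>A vertex \<open>v\<close> cannot equal both vertices that define \<open>B\<close>, and
  \<open>a\<close> and \<open>b\<close> remain joined through one that is left.\<close>

lemma is_block_pairwise:
  assumes "is_block B" "a \<in> B" "b \<in> B"
  shows "same_block a b"
proof -
  obtain k l where kl: "k \<in> V" "l \<in> V" "k \<noteq> l" "same_block k l" "B = block_of k l"
    using assms(1) by (auto simp: is_block_def)
  show ?thesis
    unfolding same_block_def
  proof (intro ballI impI)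
    fix v assume v: "v \<in> V" "v \<noteq> a \<and> v \<noteq> b"
    have "conn v a m \<and> conn v b m" if "m \<in> {k, l}" "m \<noteq> v" for m
      using that assms(2,3) kl(5) v same_block_conn by (auto simp: block_of_def)
    then have "conn v a k \<and> conn v b k \<or> conn v a l \<and> conn v b l"
      using kl(3) by (metis insertCI)
    then show "conn v a b" using conn_sym conn_trans by blast
  qed
qed

lemma is_block_subset: "is_block B \<Longrightarrow> B \<subseteq> V"
  by (auto simp: is_block_def block_of_def)

lemma is_block_two:
  assumes "is_block B"
  obtains a b where "a \<in> B" "b \<in> B" "a \<noteq> b"
proof -
  obtain a b where "a \<in> V" "b \<in> V" "a \<noteq> b" "same_block a b" "B = block_of a b"
    using assms by (auto simp: is_block_def)
  then show ?thesis using that[of a b] same_block_sym by (auto simp: block_of_def)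
qed

lemma is_block_other:
  assumes "is_block B"
  obtains c where "c \<in> B" "c \<noteq> a"
proof -
  obtain b c where "b \<in> B" "c \<in> B" "b \<noteq> c" using is_block_two[OF assms] .
  then show ?thesis using that[of b] that[of c] by (cases "b = a") auto
qed

lemma is_block_maximal:
  assumes "is_block B" "k \<in> V" "\<And>c. c \<in> B \<Longrightarrow> same_block k c"
  shows "k \<in> B"
proof -
  obtain a b where ab: "a \<in> V" "b \<in> V" "same_block a b" "B = block_of a b"
    using assms(1) by (auto simp: is_block_def)
  then have "a \<in> B" "b \<in> B" using same_block_sym[of a b] by (auto simp: block_of_def)
  then show ?thesis using assms(2,3) ab(4) by (simp add: block_of_def)
qed

text \<open>One inclusion is pairwise inseparability in \<open>B\<close>, the other is maximality of
  \<open>B\<close> against the block of \<open>a\<close> and \<open>b\<close>. Distinct blocks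
  therefore share at most one vertex.\<close>

lemma is_block_eq_block_of:
  assumes "is_block B" "a \<in> B" "b \<in> B" "a \<noteq> b"
  shows "B = block_of a b"
proof
  show "B \<subseteq> block_of a b"
    using assms is_block_pairwise[OF assms(1)] is_block_subset[OF assms(1)] by (auto simp: block_of_def)
  have ab: "is_block (block_of a b)"
    using assms is_block_pairwise is_block_subset unfolding is_block_def by blast
  show "block_of a b \<subseteq> B"
  proof
    fix k assume k: "k \<in> block_of a b"
    have "same_block k c" if "c \<in> B" for c
      using is_block_pairwise[OF ab k] that \<open>B \<subseteq> block_of a b\<close> by blast
    then show "k \<in> B"
      using is_block_maximal[OF assms(1)] k is_block_subset[OF ab] by blast
  qed
qed

lemma is_block_block_of:
  "\<lbrakk>a \<in> V; b \<in> V; a \<noteq> b; same_block a b\<rbrakk> \<Longrightarrow> is_block (block_of a b)"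
  unfolding is_block_def by blast

lemma block_of_mem: "\<lbrakk>a \<in> V; b \<in> V; same_block a b\<rbrakk> \<Longrightarrow> a \<in> block_of a b \<and> b \<in> block_of a b"
  by (auto simp: block_of_def intro: same_block_sym)

lemma anchoredI: "\<lbrakk>a \<in> B; c \<in> B; c \<noteq> a; \<not> conn a k c\<rbrakk> \<Longrightarrow> anchored B k a"
  unfolding anchored_def by blast

lemma anchored_mem: "anchored B k a \<Longrightarrow> a \<in> B"
  unfolding anchored_def by blast

lemma anchored_self: "a \<in> B \<Longrightarrow> anchored B a a"
  unfolding anchored_def by blast

lemma block_conn:
  "\<lbrakk>is_block B; b \<in> B; c \<in> B; v \<in> V; v \<noteq> b; v \<noteq> c\<rbrakk> \<Longrightarrow> conn v b c"
  using is_block_pairwise same_block_conn by blast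

text \<open>One witness of separation is enough, because the remaining vertices of \<open>B\<close>
  stay joined to each other when \<open>a\<close> is removed.\<close>

lemma anchored_separates:
  assumes "is_block B" "anchored B k a" "k \<noteq> a" "c \<in> B" "c \<noteq> a"
  shows "\<not> conn a k c"
proof
  assume "conn a k c"
  obtain d where d: "d \<in> B" "d \<noteq> a" "\<not> conn a k d" "a \<in> B"
    using assms by (auto simp: anchored_def)
  have "conn a c d" using block_conn d assms is_block_subset by blast
  then show False using \<open>conn a k c\<close> d conn_trans by blast
qed

text \<open>Two anchors would each separate \<open>k\<close> from the other one, which
  \<open>conn_one_avoids_other\<close> forbids.\<close>

lemma anchored_unique:
  assumes B: "is_block B" and "k \<in> V" and a: "anchored B k a" and a': "anchored B k a'"
  shows "a = a'"
proof (rule ccontr)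
  assume ne: "a \<noteq> a'"
  have mem: "a \<in> B" "a' \<in> B" "a \<in> V" "a' \<in> V"
    using a a' anchored_mem B is_block_subset by blast+
  have *: False if "anchored B k d" "d \<noteq> k" "k \<in> B" for d
    using anchored_separates[OF B that(1) _ that(3)] that by force
  show False
  proof (cases "k = a \<or> k = a'")
    case True
    then show ?thesis using * a a' ne mem by metis
  next
    case False
    then have "\<not> conn a k a'" "\<not> conn a' k a"
      using anchored_separates B a a' mem ne by metis+
    then show False
      using conn_one_avoids_other[of a k a'] conn_sym mem ne False \<open>k \<in> V\<close> by blast
  qed
qed

text \<open>The measure for the search in \<open>anchored_exists\<close>: moving from
  \<open>k\<close> to a separator \<open>v\<close> shrinks the component of \<open>c\<close>, since
  at least \<open>v\<close> itself drops out.\<close>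

lemma separator_decreases:
  assumes "v \<in> V" "k \<in> V" "c \<in> V" "v \<noteq> k" "v \<noteq> c" "k \<noteq> c" "\<not> conn v k c"
  shows "{m \<in> V. m \<noteq> v \<and> conn v m c} \<subset> {m \<in> V. m \<noteq> k \<and> conn k m c}"
proof -
  have "conn k m c" "m \<noteq> k" if "m \<in> V" "m \<noteq> v" "conn v m c" for m
    using that assms conn_or_through[of v m c k] by blast+
  moreover have "conn k v c" using conn_one_avoids_other[of k c v] assms by auto
  ultimately show ?thesis using assms by auto
qed

text \<open>Move from \<open>k\<close> towards \<open>B\<close> along separators. Outside
  \<open>B\<close>, maximality yields a \<open>v\<close> separating \<open>k\<close> from some
  vertex of \<open>B\<close>; either \<open>v\<close> lies in \<open>B\<close> and is the anchor, or
  the anchor of \<open>v\<close> also serves \<open>k\<close>.\<close>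

lemma anchored_exists:
  assumes B: "is_block B" and "k \<in> V"
  shows "\<exists>a. anchored B k a"
proof -
  obtain c0 where c0: "c0 \<in> B" by (rule is_block_two[OF B])
  show ?thesis using \<open>k \<in> V\<close>
  proof (induction "card {m \<in> V. m \<noteq> k \<and> conn k m c0}" arbitrary: k rule: less_induct)
    case less
    show ?case
    proof (cases "k \<in> B")
      case True
      then show ?thesis using anchored_self by blast
    next
      case False
      then obtain c where c: "c \<in> B" "\<not> same_block k c"
        using is_block_maximal[OF B less.prems] by blast
      then obtain v where v: "v \<in> V" "v \<noteq> k" "v \<noteq> c" "\<not> conn v k c"
        unfolding same_block_def by blast
      show ?thesis
      proof (cases "v \<in> B")
        case True
        then show ?thesis using anchoredI c v by blast
      next
        case vB: False
        \<comment> \<open>Since \<open>B\<close> stays connected when a vertex outside it is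
          removed, \<open>v\<close> separates \<open>k\<close> from all of \<open>B\<close>.\<close>
        have sep: "\<not> conn v k d" if "d \<in> B" for d
          using block_conn[OF B that c(1) v(1)] that c(1) vB v(4) conn_trans by blast
        have "{m \<in> V. m \<noteq> v \<and> conn v m c0} \<subset> {m \<in> V. m \<noteq> k \<and> conn k m c0}"
          using separator_decreases[of v k c0] sep[OF c0] v less.prems c0 vB False
            is_block_subset[OF B] by blast
        then have "card {m \<in> V. m \<noteq> v \<and> conn v m c0} < card {m \<in> V. m \<noteq> k \<and> conn k m c0}"
          using fin by (intro psubset_card_mono) auto
        then obtain a where a: "anchored B v a" using less.hyps v(1) by blast
        obtain d where d: "d \<in> B" "d \<noteq> a" by (rule is_block_other[OF B])
        have "v \<noteq> a" using a vB anchored_mem by blast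
        then have "\<not> conn a v d" using anchored_separates[OF B a] d by blast
        then have "\<not> conn a k d" using conn_or_through[of a k d v] sep[OF d(1)] d vB by blast
        then show ?thesis using anchoredI a anchored_mem d by blast
      qed
    qed
  qed
qed

text \<open>The gate of \<open>k\<close> in \<open>B\<close>: every walk from \<open>k\<close> to
  \<open>B\<close> enters \<open>B\<close> there. The fibres of this retraction are the branches
  hanging at the vertices of \<open>B\<close>.\<close>

definition anchor :: "'v set \<Rightarrow> 'v \<Rightarrow> 'v" where
  "anchor B k = (THE a. anchored B k a)"

lemma anchor_iff:
  assumes "is_block B" "k \<in> V"
  shows "anchored B k a \<longleftrightarrow> anchor B k = a"
proof -
  obtain b where b: "anchored B k b" using anchored_exists[OF assms] by blast
  then have "anchor B k = b"
    unfolding anchor_def by (rule the_equality) (rule anchored_unique[OF assms _ b])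
  with b show ?thesis using anchored_unique[OF assms b, of a] by (cases "b = a") auto
qed

lemma anchor_mem: "is_block B \<Longrightarrow> k \<in> V \<Longrightarrow> anchor B k \<in> B"
proof -
  assume "is_block B" "k \<in> V"
  then have "anchored B k (anchor B k)" using anchor_iff[of B k "anchor B k"] by simp
  then show ?thesis by (rule anchored_mem)
qed

lemma anchor_self: "is_block B \<Longrightarrow> a \<in> B \<Longrightarrow> anchor B a = a"
proof -
  assume B: "is_block B" "a \<in> B"
  then have "anchored B a a" "a \<in> V" using anchored_self is_block_subset by auto
  then show ?thesis using anchor_iff[OF B(1), of a a] by simp
qed

lemma anchor_separates:
  assumes "is_block B" "k \<in> V" "k \<noteq> anchor B k" "c \<in> B" "c \<noteq> anchor B k"
  shows "\<not> conn (anchor B k) k c"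
proof -
  have "anchored B k (anchor B k)" using anchor_iff[OF assms(1,2), of "anchor B k"] by simp
  then show ?thesis using anchored_separates[OF assms(1) _ assms(3-5)] by simp
qed

lemma anchor_conn:
  assumes "is_block B" "k \<in> V" "l \<in> V" "k \<noteq> anchor B k" "conn (anchor B k) k l"
  shows "anchor B l = anchor B k"
proof -
  obtain c where c: "c \<in> B" "c \<noteq> anchor B k" by (rule is_block_other[OF assms(1)])
  then have "\<not> conn (anchor B k) l c"
    using anchor_separates[OF assms(1,2,4)] assms(5) conn_trans by blast
  then have "anchored B l (anchor B k)" using anchoredI[OF anchor_mem[OF assms(1,2)] c] by simp
  then show ?thesis using anchor_iff[OF assms(1,3)] by simp
qed

text \<open>If \<open>k\<close> were not its own anchor, that anchor would separate it from
  \<open>l\<close>, which hangs elsewhere. So \<open>same_block\<close> relates vertices of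
  different branches only inside \<open>B\<close>.\<close>

lemma same_block_across_anchors:
  assumes B: "is_block B" and "k \<in> V" "l \<in> V" "same_block k l" "anchor B k \<noteq> anchor B l"
  shows "k = anchor B k \<and> l = anchor B l"
proof -
  have *: "k = anchor B k" if "k \<in> V" "l \<in> V" "same_block k l" "anchor B k \<noteq> anchor B l" for k l
  proof (rule ccontr)
    assume k: "k \<noteq> anchor B k"
    have "l \<noteq> anchor B k" using that(4) anchor_self[OF B anchor_mem[OF B that(1)]] by auto
    moreover have "anchor B k \<in> V" using anchor_mem[OF B that(1)] is_block_subset[OF B] by auto
    ultimately have "conn (anchor B k) k l"
      using same_block_conn[OF that(3)] k by auto
    then show False using anchor_conn[OF B that(1,2) k] that(4) by simp
  qed
  show ?thesis
    using *[OF assms(2-5)] *[OF assms(3,2) same_block_sym[OF assms(4)] assms(5)[symmetric]] by simp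
qed

text \<open>Project the path to \<open>B\<close> by \<open>anchor B\<close>. An edge within a branch
  collapses; an edge between branches already joins two vertices of \<open>B\<close>.\<close>

lemma block_path_inside:
  assumes B: "is_block B" and "k \<in> B" "l \<in> B" "conn v k l" "k \<noteq> v"
  shows "(k, l) \<in> (R \<inter> (B - {v}) \<times> (B - {v}))\<^sup>*"
proof -
  have "(k, anchor B m) \<in> (R \<inter> (B - {v}) \<times> (B - {v}))\<^sup>* \<and> m \<in> V \<and> anchor B m \<noteq> v"
    if "(k, m) \<in> (R \<inter> (- {v}) \<times> (- {v}))\<^sup>*" for m
    using that
  proof (induction rule: rtrancl_induct)
    case base
    then show ?case using anchor_self[OF B] is_block_subset[OF B] assms by auto
  next
    case (step m m')
    then have m': "m' \<in> V" "m' \<noteq> v" "m \<noteq> v" "(m, m') \<in> R" using edges by auto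
    \<comment> \<open>The projected path avoids \<open>v\<close> too: a vertex other than
      \<open>v\<close> that is anchored at \<open>v\<close> would be separated from \<open>k\<close>
      by \<open>v\<close>.\<close>
    have "anchor B m' \<noteq> v"
    proof
      assume v: "anchor B m' = v"
      have "conn v k m'"
        using rtrancl.rtrancl_into_rtrancl[OF step(1,2)] unfolding conn_avoiding_def .
      then show False
        using anchor_separates[OF B m'(1) _ assms(2)] v m'(2) assms(5) conn_sym by auto
    qed
    moreover have "anchor B m = anchor B m' \<or> (m = anchor B m \<and> m' = anchor B m')"
      using same_block_across_anchors[OF B] step m' same_block_edge by blast
    ultimately show ?case
    proof (elim disjE)
      assume "m = anchor B m \<and> m' = anchor B m'"
      then have "(anchor B m, anchor B m') \<in> R" using m'(4) by simp
      moreover have "anchor B m \<in> B" "anchor B m' \<in> B"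
        using anchor_mem[OF B] step(3) m'(1) by blast+
      ultimately have "(anchor B m, anchor B m') \<in> R \<inter> (B - {v}) \<times> (B - {v})"
        using step(3) \<open>anchor B m' \<noteq> v\<close> by blast
      then show ?thesis using step(3) m' \<open>anchor B m' \<noteq> v\<close>
        by (blast intro: rtrancl.rtrancl_into_rtrancl)
    qed (use step m' in simp)
  qed
  from this[of l] show ?thesis
    using assms anchor_self[OF B] unfolding conn_avoiding_def by simp
qed

end

section \<open>Projections in a unital C*-algebra\<close>

context unital_cstar_algebra
begin

declare smult_closed [simp, intro] star_closed [simp, intro]

definition proj :: "'x \<Rightarrow> bool" where
  "proj p \<longleftrightarrow> p \<in> carrier A \<and> p \<otimes> p = p \<and> star A p = p"

lemma proj_closed [simp, intro]: "proj p \<Longrightarrow> p \<in> carrier A"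
  by (simp add: proj_def)

lemma smult_zero_scalar: "x \<in> carrier A \<Longrightarrow> 0 \<odot> x = \<zero>"
  using smult_l_distr[of x 0 0] add.l_cancel_one[of "0 \<odot> x" "0 \<odot> x"] by simp

lemma smult_zero [simp]: "c \<odot> \<zero> = \<zero>"
  using smult_r_distr[of \<zero> \<zero> c] add.l_cancel_one[of "c \<odot> \<zero>" "c \<odot> \<zero>"] by simp

lemma minus_smult: "x \<in> carrier A \<Longrightarrow> (- c) \<odot> x = \<ominus> (c \<odot> x)"
  using smult_l_distr[of x "- c" c] smult_zero_scalar[of x]
  by (simp add: minus_equality)

lemma smult_minus: "x \<in> carrier A \<Longrightarrow> c \<odot> (\<ominus> x) = \<ominus> (c \<odot> x)"
  using smult_r_distr[of "\<ominus> x" x c] by (simp add: l_neg minus_equality)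

lemma smult_eq_zero:
  assumes "x \<in> carrier A" "c \<odot> x = \<zero>" "c \<noteq> 0"
  shows "x = \<zero>"
proof -
  have "x = (inverse c * c) \<odot> x" using assms by (simp add: smult_one)
  also have "\<dots> = \<zero>" using assms by (simp only: smult_smult smult_zero)
  finally show ?thesis .
qed

lemma star_zero [simp]: "star A \<zero> = \<zero>"
  using star_add[of \<zero> \<zero>] add.l_cancel_one[of "star A \<zero>" "star A \<zero>"] by simp

lemma star_minus: "x \<in> carrier A \<Longrightarrow> star A (\<ominus> x) = \<ominus> star A x"
  using star_add[of "\<ominus> x" x] by (simp add: l_neg minus_equality)

lemma star_one [simp]: "star A \<one> = \<one>"
  by (metis one_closed r_one l_one star_closed star_mult star_star)

lemma proj_one: "proj \<one>"
  by (simp add: proj_def)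

lemma proj_compl:
  assumes "proj p"
  shows "proj (\<one> \<ominus> p)"
proof -
  have c: "p \<in> carrier A" "p \<otimes> p = p" "star A p = p" using assms by (auto simp: proj_def)
  have "(\<one> \<ominus> p) \<otimes> (\<one> \<ominus> p) = \<one> \<ominus> p \<ominus> p \<otimes> \<one> \<oplus> p \<otimes> p" using c(1) by algebra
  also have "\<dots> = \<one> \<ominus> p \<ominus> p \<oplus> p" using c by simp
  also have "\<dots> = \<one> \<ominus> p" using c(1) by algebra
  finally show ?thesis using c by (simp add: proj_def a_minus_def star_add star_minus)
qed

lemma nrm_zero [simp]: "nrm A \<zero> = 0"
  using nrm_eq_0_iff by simp

lemma nrm_minus [simp]: "x \<in> carrier A \<Longrightarrow> nrm A (\<ominus> x) = nrm A x"
  using nrm_smult[of x "-1"] minus_smult[of x 1] by (simp add: smult_one)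

text \<open>By the C*-identity the norm of \<open>p\<close> equals its own square.\<close>

lemma nrm_proj_le: 
  assumes "proj p"
  shows "nrm A p \<le> 1"
proof -
  have "nrm A p = (nrm A p)\<^sup>2" using cstar_identity[of p] assms by (simp add: proj_def)
  then have "nrm A p * (1 - nrm A p) = 0" by (simp add: power2_eq_square algebra_simps)
  then show ?thesis by auto
qed

lemma finsum_smult:
  assumes "f \<in> I \<rightarrow> carrier A"
  shows "(\<Oplus>i\<in>I. c \<odot> f i) = c \<odot> (\<Oplus>i\<in>I. f i)"
  using assms
proof (induction I rule: infinite_finite_induct)
  case (insert i I)
  then show ?case by (simp add: Pi_def smult_r_distr)
qed auto

lemma finsum_smult_scalar:
  assumes "finite I" "x \<in> carrier A"
  shows "(\<Oplus>i\<in>I. c i \<odot> x) = (\<Sum>i\<in>I. c i) \<odot> x"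
  using assms(1)
proof induction
  case empty
  then show ?case using assms(2) by (simp add: smult_zero_scalar)
next
  case (insert i I)
  then show ?case using assms(2) by (simp add: Pi_def smult_l_distr)
qed

lemma finsum_swap:
  assumes "finite I" "finite J" "\<And>i j. i \<in> I \<Longrightarrow> j \<in> J \<Longrightarrow> f i j \<in> carrier A"
  shows "(\<Oplus>i\<in>I. \<Oplus>j\<in>J. f i j) = (\<Oplus>j\<in>J. \<Oplus>i\<in>I. f i j)"
  using assms(1,3)
proof (induction I)
  case empty
  then show ?case by simp
next
  case (insert i I)
  have "(\<Oplus>j\<in>J. f i j) \<oplus> (\<Oplus>j\<in>J. \<Oplus>i\<in>I. f i j) = (\<Oplus>j\<in>J. f i j \<oplus> (\<Oplus>i\<in>I. f i j))"
    using insert.prems by (intro finsum_addf[symmetric]) auto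
  also have "\<dots> = (\<Oplus>j\<in>J. \<Oplus>i\<in>insert i I. f i j)"
    using insert by (intro finsum_cong') (auto simp: Pi_def)
  finally show ?case
    using insert by (subst finsum_insert) (auto intro!: finsum_closed)
qed

lemma finsum_only:
  assumes "finite I" "i \<in> I" "f \<in> I \<rightarrow> carrier A" "\<And>j. j \<in> I \<Longrightarrow> j \<noteq> i \<Longrightarrow> f j = \<zero>"
  shows "(\<Oplus>j\<in>I. f j) = f i"
proof -
  have "(\<Oplus>j\<in>I. f j) = (\<Oplus>j\<in>insert i (I - {i}). f j)" using assms(2) by (simp add: insert_absorb)
  also have "\<dots> = f i \<oplus> (\<Oplus>j\<in>I - {i}. f j)"
    using assms by (subst finsum_insert) (auto simp: Pi_def)
  also have "(\<Oplus>j\<in>I - {i}. f j) = (\<Oplus>j\<in>I - {i}. \<zero>)"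
    using assms by (intro finsum_cong') auto
  finally show ?thesis using assms by (simp add: Pi_def)
qed

lemma finsum_restrict:
  assumes "finite I" "J \<subseteq> I" "f \<in> I \<rightarrow> carrier A" "\<And>j. j \<in> I - J \<Longrightarrow> f j = \<zero>"
  shows "(\<Oplus>j\<in>I. f j) = (\<Oplus>j\<in>J. f j)"
  by (rule add.finprod_mono_neutral_cong_right) (use assms in auto)

lemma finsum_split:
  assumes "finite I" "f \<in> I \<rightarrow> carrier A" "J \<subseteq> I"
  shows "(\<Oplus>j\<in>I. f j) = (\<Oplus>j\<in>J. f j) \<oplus> (\<Oplus>j\<in>I - J. f j)"
proof -
  have "I = J \<union> (I - J)" using assms(3) by auto
  then have "(\<Oplus>j\<in>I. f j) = (\<Oplus>j\<in>J \<union> (I - J). f j)" by simp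
  also have "\<dots> = (\<Oplus>j\<in>J. f j) \<oplus> (\<Oplus>j\<in>I - J. f j)"
    using assms by (intro finsum_Un_disjoint) (auto intro: finite_subset)
  finally show ?thesis .
qed

lemma star_finsum:
  assumes "f \<in> I \<rightarrow> carrier A"
  shows "star A (\<Oplus>i\<in>I. f i) = (\<Oplus>i\<in>I. star A (f i))"
  using assms by (induction I rule: infinite_finite_induct) (auto simp: Pi_def star_add)

lemma finsum_fibres:
  assumes "finite I" "g \<in> I \<rightarrow> carrier A"
  shows "(\<Oplus>s\<in>f ` I. \<Oplus>i\<in>{i \<in> I. f i = s}. g i) = (\<Oplus>i\<in>I. g i)"
proof -
  have "(\<Oplus>i\<in>(\<Union>s\<in>f ` I. {i \<in> I. f i = s}). g i) = (\<Oplus>s\<in>f ` I. \<Oplus>i\<in>{i \<in> I. f i = s}. g i)"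
    using assms by (intro add.finprod_UN_disjoint) (auto simp: pairwise_def disjnt_def)
  moreover have "(\<Union>s\<in>f ` I. {i \<in> I. f i = s}) = I" by auto
  ultimately show ?thesis by simp
qed

lemma nrm_finsum_le:
  assumes "finite I" "f \<in> I \<rightarrow> carrier A" "\<And>i. i \<in> I \<Longrightarrow> nrm A (f i) \<le> 1"
  shows "nrm A (\<Oplus>i\<in>I. f i) \<le> card I"
  using assms
proof (induction I)
  case (insert i I)
  have "nrm A (f i \<oplus> (\<Oplus>i\<in>I. f i)) \<le> nrm A (f i) + nrm A (\<Oplus>i\<in>I. f i)"
    using insert.prems by (intro nrm_triangle) auto
  then show ?case using insert by (simp add: Pi_def) (smt (verit))
qed simp

text \<open>
  A projection \<open>e\<close> is an extreme point of the set of contractions in \<open>eAe\<close>. The bound on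
  \<open>e \<plusminus> h\<close> gives one on \<open>e + h\<^sup>2\<close>, hence on \<open>e \<plusminus> ih\<close> by the C*-identity, and so
  on \<open>e + zh\<close> for all small complex \<open>z\<close>. Averaging \<open>(e + \<omega>zh)\<^sup>n\<close> over roots of unity
  isolates the linear coefficient \<open>nzh\<close>, which is therefore bounded in \<open>n\<close>.
\<close>

context
  fixes e h
  assumes e: "proj e" and h: "h \<in> carrier A" "star A h = h" "e \<otimes> h = h" "h \<otimes> e = h"
begin

private lemma e_simps: "e \<in> carrier A" "e \<otimes> e = e" "star A e = e"
  using e by (auto simp: proj_def)

private lemma mult_pencil:
  "(e \<oplus> c \<odot> h) \<otimes> (e \<oplus> d \<odot> h) = e \<oplus> (c + d) \<odot> h \<oplus> (c * d) \<odot> (h \<otimes> h)"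
proof -
  have "(e \<oplus> c \<odot> h) \<otimes> (e \<oplus> d \<odot> h) =
      e \<otimes> e \<oplus> e \<otimes> (d \<odot> h) \<oplus> ((c \<odot> h) \<otimes> e \<oplus> (c \<odot> h) \<otimes> (d \<odot> h))"
    using e_simps(1) h(1) by (simp add: l_distr r_distr a_ac)
  also have "\<dots> = e \<oplus> d \<odot> h \<oplus> (c \<odot> h \<oplus> (c * d) \<odot> (h \<otimes> h))"
    using e_simps h by (simp add: smult_mult_left smult_mult_right smult_smult mult.commute[of c d])
  also have "\<dots> = e \<oplus> (c + d) \<odot> h \<oplus> (c * d) \<odot> (h \<otimes> h)"
    using e_simps(1) h(1) by (simp add: smult_l_distr a_ac)
  finally show ?thesis .
qed

private lemma nrm_pencil:
  assumes "nrm A (e \<oplus> h) \<le> 1" "nrm A (e \<ominus> h) \<le> 1" "\<bar>Re z\<bar> + \<bar>Im z\<bar> \<le> 1"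
  shows "nrm A (e \<oplus> z \<odot> h) \<le> 1"
proof -
  note [simp] = e_simps(1) h(1)
  define pen where "pen c = e \<oplus> c \<odot> h" for c
  have pen_closed [simp]: "pen c \<in> carrier A" for c by (simp add: pen_def)
  have real: "nrm A (pen s) \<le> 1" if "s = 1 \<or> s = - 1" for s
    using assms(1,2) that by (auto simp: pen_def smult_one minus_smult a_minus_def)
  \<comment> \<open>The mean of the squares of \<open>e \<oplus> h\<close> and
    \<open>e \<ominus> h\<close>: the linear terms cancel.\<close>
  have sq: "nrm A (e \<oplus> h \<otimes> h) \<le> 1"
  proof -
    have "(1/2) \<odot> (pen 1 \<otimes> pen 1 \<oplus> pen (- 1) \<otimes> pen (- 1)) =
        (1/2) \<odot> (e \<oplus> 2 \<odot> h \<oplus> h \<otimes> h) \<oplus> (1/2) \<odot> (e \<oplus> (- 2) \<odot> h \<oplus> h \<otimes> h)"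
      unfolding pen_def mult_pencil by (simp add: smult_one smult_r_distr)
    also have "\<dots> = ((1/2) \<odot> e \<oplus> (1/2) \<odot> e) \<oplus> (1 \<odot> h \<oplus> (- 1) \<odot> h) \<oplus>
        ((1/2) \<odot> (h \<otimes> h) \<oplus> (1/2) \<odot> (h \<otimes> h))"
      using smult_smult[OF h(1), of "1/2" 2] smult_smult[OF h(1), of "1/2" "- 2"]
      by (simp add: smult_r_distr a_ac)
    also have "\<dots> = e \<oplus> h \<otimes> h"
      by (simp only: smult_l_distr[symmetric] e_simps(1) h(1) m_closed)
        (simp add: smult_one smult_zero_scalar)
    finally have "nrm A (e \<oplus> h \<otimes> h) = (1/2) * nrm A (pen 1 \<otimes> pen 1 \<oplus> pen (- 1) \<otimes> pen (- 1))"
      using nrm_smult[of "pen 1 \<otimes> pen 1 \<oplus> pen (- 1) \<otimes> pen (- 1)" "1/2"] by simp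
    also have "\<dots> \<le> (1/2) * (nrm A (pen 1) * nrm A (pen 1) + nrm A (pen (-1)) * nrm A (pen (-1)))"
      using nrm_triangle[of "pen 1 \<otimes> pen 1" "pen (- 1) \<otimes> pen (- 1)"]
        nrm_mult[of "pen 1" "pen 1"] nrm_mult[of "pen (-1)" "pen (-1)"] by simp
    also have "\<dots> \<le> 1"
      using mult_mono[OF real real, of 1 1] mult_mono[OF real real, of "-1" "-1"]
      by (simp add: nrm_nonneg)
    finally show ?thesis .
  qed
  \<comment> \<open>Here \<open>cnj c + c = 0\<close> and \<open>cnj c * c = 1\<close>, so the
    C*-identity turns the square of the norm into that of
    \<open>e \<oplus> h \<otimes> h\<close>.\<close>
  have imag: "nrm A (pen c) \<le> 1" if "c = \<i> \<or> c = - \<i>" for c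
  proof -
    have "star A (pen c) \<otimes> pen c = e \<oplus> h \<otimes> h"
      using that e_simps h
      by (auto simp: pen_def star_add star_smult mult_pencil smult_zero_scalar smult_one)
    then have "(nrm A (pen c))\<^sup>2 \<le> 1\<^sup>2" using cstar_identity[of "pen c"] sq by simp
    then show ?thesis by (rule power2_le_imp_le) simp
  qed
  \<comment> \<open>A convex combination: weight \<open>a\<close> on a sign, weight \<open>b\<close>
    on one of the two imaginary units, and the remaining weight \<open>r\<close> on the pencil at
    \<open>0\<close>, which is \<open>e\<close>.\<close>
  define a b where "a = abs (Re z)" and "b = abs (Im z)"
  define u v where "u = complex_of_real (if Re z \<ge> 0 then 1 else - 1)"
    and "v = (if Im z \<ge> 0 then \<i> else - \<i>)"
  define r where "r = 1 - a - b"
  have ab: "a \<ge> 0" "b \<ge> 0" "r \<ge> 0" using assms(3) by (auto simp: a_def b_def r_def)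
  have uv: "nrm A (pen u) \<le> 1" "nrm A (pen v) \<le> 1"
    unfolding u_def v_def by (auto intro: real imag)
  have z: "of_real a * u + of_real b * v = z"
    by (simp add: a_def b_def u_def v_def complex_eq_iff)
  have "of_real a + (of_real b + of_real r) = (1 :: complex)" by (simp add: r_def)
  then have "of_real a \<odot> e \<oplus> (of_real b \<odot> e \<oplus> of_real r \<odot> e) = e"
    by (simp only: smult_l_distr[symmetric] e_simps(1)) (simp add: smult_one)
  moreover have "of_real a \<odot> (u \<odot> h) \<oplus> of_real b \<odot> (v \<odot> h) = z \<odot> h"
    unfolding z[symmetric] by (simp add: smult_l_distr smult_smult)
  moreover have "of_real a \<odot> pen u \<oplus> (of_real b \<odot> pen v \<oplus> of_real r \<odot> e) =
      (of_real a \<odot> e \<oplus> (of_real b \<odot> e \<oplus> of_real r \<odot> e)) \<oplus>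
      (of_real a \<odot> (u \<odot> h) \<oplus> of_real b \<odot> (v \<odot> h))"
    unfolding pen_def by (simp add: smult_r_distr a_ac)
  ultimately have "pen z = of_real a \<odot> pen u \<oplus> (of_real b \<odot> pen v \<oplus> of_real r \<odot> e)"
    by (simp add: pen_def)
  then have "nrm A (pen z) \<le>
      nrm A (of_real a \<odot> pen u) + (nrm A (of_real b \<odot> pen v) + nrm A (of_real r \<odot> e))"
    using nrm_triangle[of "of_real a \<odot> pen u" "of_real b \<odot> pen v \<oplus> of_real r \<odot> e"]
      nrm_triangle[of "of_real b \<odot> pen v" "of_real r \<odot> e"] by simp
  also have "\<dots> = a * nrm A (pen u) + (b * nrm A (pen v) + r * nrm A e)"
    using ab by (simp add: nrm_smult)
  also have "\<dots> \<le> a * 1 + (b * 1 + r * 1)"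
    using uv nrm_proj_le[OF e] ab by (intro add_mono mult_left_mono) auto
  finally show ?thesis by (simp add: pen_def r_def)
qed

text \<open>Powers inside the corner \<open>eAe\<close>, hence starting at \<open>e\<close> rather
  than at \<open>\<one>\<close>.\<close>

primrec pencil_power :: "complex \<Rightarrow> nat \<Rightarrow> 'x" where
  "pencil_power z 0 = e"
| "pencil_power z (Suc n) = pencil_power z n \<otimes> (e \<oplus> z \<odot> h)"

private lemma pencil_power_closed [simp]: "pencil_power z n \<in> carrier A"
  by (induction n) (use e_simps h in auto)

private lemma pencil_power_e: "pencil_power z n \<otimes> e = pencil_power z n"
proof (induction n)
  case (Suc n)
  have "(e \<oplus> z \<odot> h) \<otimes> e = e \<oplus> z \<odot> h"
    using e_simps h by (simp add: l_distr smult_mult_left)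
  then show ?case using e_simps h by (simp add: m_assoc)
qed (use e_simps in simp)

private lemma nrm_pencil_power:
  assumes "nrm A (e \<oplus> z \<odot> h) \<le> 1"
  shows "nrm A (pencil_power z n) \<le> 1"
proof (induction n)
  case 0
  then show ?case using nrm_proj_le[OF e] by simp
next
  case (Suc n)
  have "nrm A (pencil_power z (Suc n)) \<le> nrm A (pencil_power z n) * nrm A (e \<oplus> z \<odot> h)"
    using e_simps h by (simp add: nrm_mult)
  also have "\<dots> \<le> 1 * 1" using Suc assms e_simps h by (intro mult_mono) (auto simp: nrm_nonneg)
  finally show ?case by simp
qed

text \<open>A discrete Fourier coefficient: \<open>S n k\<close> is \<open>N\<close> times the part
  of the \<open>n\<close>-th power in which \<open>h\<close> occurs \<open>k\<close> times modulo
  \<open>N\<close>, and for \<open>n < N\<close> nothing wraps around. The recursion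
  \<open>rec\<close> stands in for the binomial expansion.\<close>

private lemma root_of_unity_average:
  fixes N :: nat and c :: complex
  assumes N: "N \<ge> 2"
  defines "w \<equiv> \<lambda>j::nat. cis (2 * pi * j / N)"
  defines "S \<equiv> \<lambda>n k. \<Oplus>j\<in>{..<N}. cnj (w j) ^ k \<odot> pencil_power (w j * c) n"
  shows "n < N \<Longrightarrow> S n 1 = (of_nat n * of_nat N * c) \<odot> h"
proof -
  note [simp] = e_simps(1) h(1)
  have w: "cnj (w j) * w j = 1" "cnj (w j) ^ N = 1" for j
  proof -
    show "cnj (w j) * w j = 1" by (simp add: w_def cis_cnj cis_mult)
    have "w j ^ N = 1"
      using N cis_multiple_2pi[of "real j"] by (simp add: w_def Complex.DeMoivre)
    then show "cnj (w j) ^ N = 1" by (metis complex_cnj_one complex_cnj_power)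
  qed
  have S_closed [simp]: "S n k \<in> carrier A" for n k unfolding S_def by auto
  have rec: "S (Suc n) (Suc k) = S n (Suc k) \<oplus> c \<odot> (S n k \<otimes> h)" for n k
  proof -
    have "cnj (w j) ^ Suc k \<odot> pencil_power (w j * c) (Suc n) =
        cnj (w j) ^ Suc k \<odot> pencil_power (w j * c) n \<oplus>
        c \<odot> ((cnj (w j) ^ k \<odot> pencil_power (w j * c) n) \<otimes> h)" for j
    proof -
      have eq: "cnj (w j) ^ Suc k * (w j * c) = c * cnj (w j) ^ k"
      proof -
        have "cnj (w j) ^ Suc k * (w j * c) = (cnj (w j) * w j) * (c * cnj (w j) ^ k)" by simp
        then show ?thesis by (simp only: w(1) mult_1)
      qed
      let ?p = "pencil_power (w j * c) n"
      have "cnj (w j) ^ Suc k \<odot> pencil_power (w j * c) (Suc n) =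
          cnj (w j) ^ Suc k \<odot> ?p \<oplus> cnj (w j) ^ Suc k \<odot> ((w j * c) \<odot> (?p \<otimes> h))"
        by (simp add: r_distr pencil_power_e smult_mult_right smult_r_distr del: power_Suc)
      also have "cnj (w j) ^ Suc k \<odot> ((w j * c) \<odot> (?p \<otimes> h)) = (c * cnj (w j) ^ k) \<odot> (?p \<otimes> h)"
        by (simp only: eq m_closed pencil_power_closed h(1) flip: smult_smult)
      also have "\<dots> = c \<odot> ((cnj (w j) ^ k \<odot> ?p) \<otimes> h)"
        by (simp add: smult_smult smult_mult_left)
      finally show ?thesis .
    qed
    then have "S (Suc n) (Suc k) = (\<Oplus>j\<in>{..<N}. cnj (w j) ^ Suc k \<odot> pencil_power (w j * c) n \<oplus>
        c \<odot> ((cnj (w j) ^ k \<odot> pencil_power (w j * c) n) \<otimes> h))"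
      unfolding S_def by simp
    also have "\<dots> = S n (Suc k) \<oplus> (\<Oplus>j\<in>{..<N}. c \<odot> ((cnj (w j) ^ k \<odot> pencil_power (w j * c) n) \<otimes> h))"
      unfolding S_def by (intro finsum_addf) auto
    also have "(\<Oplus>j\<in>{..<N}. c \<odot> ((cnj (w j) ^ k \<odot> pencil_power (w j * c) n) \<otimes> h)) =
        c \<odot> (S n k \<otimes> h)"
      unfolding S_def by (subst finsum_smult) (auto simp: finsum_ldistr)
    finally show ?thesis .
  qed
  have periodic: "S n N = S n 0" for n unfolding S_def using w(2) by simp
  have zero: "S 0 k = \<zero>" if "0 < k" "k < N" for k
  proof -
    have "w k ^ N = 1" "w k \<noteq> 1"
    proof -
      show "w k ^ N = 1" by (metis complex_cnj_cnj complex_cnj_one complex_cnj_power w(2))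
      show "w k \<noteq> 1"
      proof
        assume "w k = 1"
        then have "cos (2 * pi * k / N) = 1" by (simp add: w_def complex_eq_iff)
        then obtain m :: int where "2 * pi * k / N = 2 * pi * m"
          by (auto simp: cos_one_2pi_int mult_ac)
        then have "real k = m * real N" using N by (simp add: field_simps)
        then have "int k = m * int N" by (metis of_int_mult of_int_of_nat_eq of_int_eq_iff)
        then show False using that by (metis nat_dvd_not_less dvd_triv_right int_dvd_int_iff)
      qed
    qed
    then have "(\<Sum>j<N. w k ^ j) = 0" by (simp add: geometric_sum)
    moreover have "w j ^ k = w k ^ j" for j by (simp add: w_def Complex.DeMoivre mult_ac)
    ultimately have "(\<Sum>j<N. cnj (w j) ^ k) = 0"
      by (metis (mono_tags, lifting) cnj_sum complex_cnj_power complex_cnj_zero sum.cong)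
    then show ?thesis unfolding S_def by (simp add: finsum_smult_scalar smult_zero_scalar)
  qed
  have vanish: "S n k = \<zero>" if "n < k" "k < N" for n k
    using that
  proof (induction n arbitrary: k)
    case 0
    then show ?case by (rule zero)
  next
    case (Suc n)
    then obtain k' where "k = Suc k'" by (cases k) auto
    then show ?case using Suc rec by simp
  qed
  have const: "S n 0 = of_nat N \<odot> e" if "n < N" for n
    using that
  proof (induction n)
    case 0
    then show ?case unfolding S_def by (simp add: finsum_smult_scalar)
  next
    case (Suc n)
    \<comment> \<open>\<open>rec\<close> speaks only of successor exponents, so the exponent
      \<open>0\<close> is replaced by \<open>N = Suc M\<close>; the term with exponent
      \<open>M\<close> vanishes because \<open>n < M\<close>.\<close>
    obtain M where M: "N = Suc M" using N by (cases N) auto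
    have "S (Suc n) 0 = S (Suc n) (Suc M)" using periodic M by metis
    also have "\<dots> = S n N \<oplus> c \<odot> (S n M \<otimes> h)" using rec M by simp
    also have "S n M = \<zero>" using vanish Suc.prems M by simp
    finally show ?case using Suc periodic by simp
  qed
  show "n < N \<Longrightarrow> S n 1 = (of_nat n * of_nat N * c) \<odot> h"
  proof (induction n)
    case 0
    then show ?case using zero N by (simp add: smult_zero_scalar)
  next
    case (Suc n)
    have "S (Suc n) 1 = S n 1 \<oplus> c \<odot> (S n 0 \<otimes> h)" using rec[of n 0] by simp
    also have "\<dots> = (of_nat n * of_nat N * c) \<odot> h \<oplus> (c * of_nat N) \<odot> h"
      using Suc const[of n] h by (simp add: smult_mult_left smult_smult)
    also have "\<dots> = (of_nat (Suc n) * of_nat N * c) \<odot> h"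
      by (simp flip: smult_l_distr add: algebra_simps)
    finally show ?case .
  qed
qed

lemma proj_extreme:
  assumes "nrm A (e \<oplus> h) \<le> 1" "nrm A (e \<ominus> h) \<le> 1"
  shows "h = \<zero>"
proof -
  have bound: "real n * nrm A h \<le> 2" for n :: nat
  proof -
    \<comment> \<open>Larger than \<open>n\<close>, so that no wrap-around occurs, and at least
      2.\<close>
    define N where "N = n + 2"
    define w where "w = (\<lambda>j::nat. cis (2 * pi * j / N))"
    \<comment> \<open>The factor \<open>1/2\<close> brings the roots of unity into the region
      covered by \<open>nrm_pencil\<close>; it is the origin of the constant 2 in the bound.\<close>
    have nrm: "nrm A (cnj (w j) ^ 1 \<odot> pencil_power (w j * (1/2)) n) \<le> 1" for j
    proof -
      have "\<bar>Re (w j)\<bar> \<le> 1" "\<bar>Im (w j)\<bar> \<le> 1" by (simp_all add: w_def)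
      then have "nrm A (pencil_power (w j * (1/2)) n) \<le> 1"
        by (intro nrm_pencil_power nrm_pencil assms) simp
      moreover have "cmod (cnj (w j)) = 1" by (simp add: w_def)
      ultimately show ?thesis by (simp add: nrm_smult)
    qed
    have "(\<Oplus>j\<in>{..<N}. cnj (w j) ^ 1 \<odot> pencil_power (w j * (1/2)) n) =
        (of_nat n * of_nat N * (1/2)) \<odot> h"
      unfolding w_def by (rule root_of_unity_average) (auto simp: N_def)
    then have "nrm A ((of_nat n * of_nat N * (1/2)) \<odot> h) \<le> N"
      using nrm_finsum_le[of "{..<N}" "\<lambda>j. cnj (w j) ^ 1 \<odot> pencil_power (w j * (1/2)) n"] nrm
      by simp
    then have "real N * (real n * nrm A h) \<le> real N * 2"
      using h(1) by (simp add: nrm_smult norm_mult mult_ac)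
    moreover have "real N > 0" by (simp add: N_def)
    ultimately show ?thesis by (rule mult_left_le_imp_le)
  qed
  have "nrm A h = 0"
  proof (rule ccontr)
    assume "nrm A h \<noteq> 0"
    then have "nrm A h > 0" using nrm_nonneg[OF h(1)] by simp
    then obtain n :: nat where "2 / nrm A h < n" using reals_Archimedean2 by blast
    then show False using bound[of n] \<open>nrm A h > 0\<close> by (simp add: field_simps)
  qed
  then show ?thesis using nrm_eq_0_iff h(1) by simp
qed

end

text \<open>For self-adjoint \<open>h\<close> in \<open>eAe\<close> this is the usual order \<open>h \<ge> 0\<close>.\<close>

definition nonneg :: "'x \<Rightarrow> 'x \<Rightarrow> bool" where
  "nonneg e h \<longleftrightarrow> (\<exists>t::real. t \<ge> 0 \<and> nrm A (t \<odot> e \<ominus> h) \<le> t)"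

text \<open>Witnesses may be enlarged, so two positive elements can share one.\<close>

lemma nonneg_mono:
  assumes "proj e" "h \<in> carrier A" "nrm A (of_real t \<odot> e \<ominus> h) \<le> t" "t \<le> s"
  shows "nrm A (of_real s \<odot> e \<ominus> h) \<le> s"
proof -
  have "of_real s \<odot> e \<ominus> h = of_real (s - t) \<odot> e \<oplus> (of_real t \<odot> e \<ominus> h)"
    using assms smult_l_distr[of e "of_real (s - t)" "of_real t"]
    by (simp add: a_minus_def a_assoc)
  then have "nrm A (of_real s \<odot> e \<ominus> h) \<le> nrm A (of_real (s - t) \<odot> e) + t"
    using assms nrm_triangle[of "of_real (s - t) \<odot> e" "of_real t \<odot> e \<ominus> h"] by simp
  also have "\<dots> = (s - t) * nrm A e + t"
    using assms nrm_smult[of e "of_real (s - t)"] by (simp del: of_real_diff)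
  also have "\<dots> \<le> (s - t) * 1 + t"
    using assms nrm_proj_le by (intro add_mono mult_left_mono) auto
  finally show ?thesis by simp
qed

lemma nonneg_add:
  assumes "e \<in> carrier A" "h \<in> carrier A" "k \<in> carrier A" "nonneg e h" "nonneg e k"
  shows "nonneg e (h \<oplus> k)"
proof -
  obtain t s :: real where t: "t \<ge> 0" "nrm A (t \<odot> e \<ominus> h) \<le> t" and s: "s \<ge> 0" "nrm A (s \<odot> e \<ominus> k) \<le> s"
    using assms(4,5) by (auto simp: nonneg_def)
  have "of_real (t + s) \<odot> e \<ominus> (h \<oplus> k) = (t \<odot> e \<ominus> h) \<oplus> (s \<odot> e \<ominus> k)"
    using assms by (simp add: smult_l_distr a_minus_def minus_add a_ac)
  then have "nrm A (of_real (t + s) \<odot> e \<ominus> (h \<oplus> k)) \<le> t + s"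
    using nrm_triangle[of "t \<odot> e \<ominus> h" "s \<odot> e \<ominus> k"] t s assms by simp
  then show ?thesis using t(1) s(1) unfolding nonneg_def by (meson add_nonneg_nonneg)
qed

lemma nonneg_zero: "e \<in> carrier A \<Longrightarrow> nonneg e \<zero>"
  unfolding nonneg_def by (intro exI[of _ 0]) (simp add: smult_zero_scalar a_minus_def)

lemma nonneg_finsum:
  assumes "e \<in> carrier A" "finite I" "f \<in> I \<rightarrow> carrier A" "\<And>i. i \<in> I \<Longrightarrow> nonneg e (f i)"
  shows "nonneg e (\<Oplus>i\<in>I. f i)"
  using assms(2-4) by induction (auto simp: nonneg_zero assms(1) Pi_def intro!: nonneg_add)

text \<open>The witness is \<open>t = 1\<close>: the difference of \<open>e\<close> and its product
  with \<open>q\<close> is the compression of the projection \<open>\<one> \<ominus> q\<close> and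
  has norm at most one.\<close>

lemma nonneg_compress:
  assumes "proj e" "proj q"
  shows "nonneg e (e \<otimes> q \<otimes> e)"
proof -
  have c: "e \<in> carrier A" "q \<in> carrier A" "e \<otimes> e = e" using assms by (auto simp: proj_def)
  have "e \<otimes> (\<one> \<ominus> q) \<otimes> e = e \<otimes> e \<ominus> e \<otimes> q \<otimes> e" using c(1,2) by algebra
  then have "1 \<odot> e \<ominus> e \<otimes> q \<otimes> e = e \<otimes> (\<one> \<ominus> q) \<otimes> e" using c by (simp add: smult_one)
  also have "nrm A \<dots> \<le> nrm A (e \<otimes> (\<one> \<ominus> q)) * nrm A e" using c by (simp add: nrm_mult)
  also have "\<dots> \<le> (nrm A e * nrm A (\<one> \<ominus> q)) * nrm A e"
    using c by (intro mult_right_mono nrm_mult) (auto simp: nrm_nonneg)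
  also have "\<dots> \<le> (1 * 1) * 1"
    using assms c by (intro mult_mono nrm_proj_le proj_compl) (auto simp: nrm_nonneg)
  finally show ?thesis unfolding nonneg_def by (intro exI[of _ 1]) simp
qed

text \<open>Scaling by a common witness makes \<open>e \<oplus> k\<close> and
  \<open>e \<ominus> k\<close> contractions, and \<open>e\<close> is extreme among the contractions
  of its corner.\<close>

lemma nonneg_antisym:
  assumes e: "proj e" and h: "h \<in> carrier A" "star A h = h" "e \<otimes> h = h" "h \<otimes> e = h"
    and "nonneg e h" "nonneg e (\<ominus> h)"
  shows "h = \<zero>"
proof -
  obtain t s :: real where t: "t \<ge> 0" "nrm A (t \<odot> e \<ominus> h) \<le> t"
    and s: "s \<ge> 0" "nrm A (s \<odot> e \<ominus> (\<ominus> h)) \<le> s"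
    using assms(6,7) by (auto simp: nonneg_def)
  \<comment> \<open>The summand 1 keeps \<open>T\<close> positive when both witnesses are
    zero.\<close>
  define T where "T = max t s + 1"
  have T: "T > 0" "nrm A (T \<odot> e \<ominus> h) \<le> T" "nrm A (T \<odot> e \<oplus> h) \<le> T"
    using nonneg_mono[OF e h(1) t(2), of T] nonneg_mono[OF e _ s(2), of T] t s h e
    by (auto simp: T_def a_minus_def)
  define k where "k = (of_real (1/T)) \<odot> h"
  have "of_real (1/T) \<odot> (of_real T \<odot> e) = e"
    using e T by (simp flip: smult_smult add: smult_one)
  then have "e \<oplus> k = of_real (1/T) \<odot> (T \<odot> e \<oplus> h)" "e \<ominus> k = of_real (1/T) \<odot> (T \<odot> e \<ominus> h)"
    using e h by (auto simp: k_def smult_r_distr a_minus_def smult_minus)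
  then have "nrm A (e \<oplus> k) = (1/T) * nrm A (T \<odot> e \<oplus> h)" "nrm A (e \<ominus> k) = (1/T) * nrm A (T \<odot> e \<ominus> h)"
    using T(1) e h(1) nrm_smult[of _ "of_real (1/T)"] by (auto simp del: of_real_divide)
  then have "nrm A (e \<oplus> k) \<le> 1" "nrm A (e \<ominus> k) \<le> 1"
    using T by simp_all
  then have "k = \<zero>"
    using e h by (intro proj_extreme[of e k]) (auto simp: k_def star_smult smult_mult_left smult_mult_right)
  then show ?thesis using smult_eq_zero[OF h(1), of "of_real (1/T)"] T(1) by (simp add: k_def)
qed

text \<open>Compress the sum to the corner of \<open>e = f j\<close>. After cancelling
  \<open>e\<close>, the compression \<open>h\<close> of \<open>f i\<close> and the compressions of
  the others add up to zero; all are positive, so \<open>h\<close> vanishes. Since \<open>h\<close>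
  is the product of \<open>star A (f i \<otimes> e)\<close> with \<open>f i \<otimes> e\<close>, the
  C*-identity finishes.\<close>

lemma proj_sum_one_orthogonal:
  assumes "finite I" "\<And>i. i \<in> I \<Longrightarrow> proj (f i)" "(\<Oplus>i\<in>I. f i) = \<one>"
    and "i \<in> I" "j \<in> I" "i \<noteq> j"
  shows "f i \<otimes> f j = \<zero>"
proof -
  define e where "e = f j"
  have e: "proj e" "e \<in> carrier A" "e \<otimes> e = e" "star A e = e"
    using assms by (auto simp: e_def proj_def)
  have f: "f \<in> I \<rightarrow> carrier A" using assms(2) by auto
  define h where "h = e \<otimes> f i \<otimes> e"
  have fi: "f i \<in> carrier A" "f i \<otimes> f i = f i" "star A (f i) = f i"
    using assms(2,4) by (auto simp: proj_def)
  have h: "h \<in> carrier A" using e fi by (simp add: h_def)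
  let ?g = "\<lambda>l. e \<otimes> f l \<otimes> e"
  have g: "?g \<in> I \<rightarrow> carrier A" using f e by auto
  have "(\<Oplus>l\<in>I. ?g l) = e \<otimes> (\<Oplus>l\<in>I. f l) \<otimes> e"
    using assms(1) f e by (simp add: finsum_ldistr finsum_rdistr Pi_def)
  also have "\<dots> = e" using assms(3) e by simp
  also have "(\<Oplus>l\<in>I. ?g l) = (\<Oplus>l\<in>{j, i}. ?g l) \<oplus> (\<Oplus>l\<in>I - {j, i}. ?g l)"
    using assms g by (intro finsum_split) auto
  also have "(\<Oplus>l\<in>{j, i}. ?g l) = e \<oplus> h"
    using assms(6) e fi g by (simp add: h_def flip: e_def)
  finally have "e \<oplus> (h \<oplus> (\<Oplus>l\<in>I - {j, i}. ?g l)) = e"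
    using e h g by (subst (asm) a_assoc) (auto simp: Pi_def)
  moreover have r: "(\<Oplus>l\<in>I - {j, i}. ?g l) \<in> carrier A" using g by (auto simp: Pi_def)
  ultimately have "h \<oplus> (\<Oplus>l\<in>I - {j, i}. ?g l) = \<zero>"
    using e h by (metis a_closed add.l_cancel_one)
  then have "\<ominus> h = (\<Oplus>l\<in>I - {j, i}. ?g l)"
    using h r by (metis a_comm minus_equality)
  moreover have "nonneg e (\<Oplus>l\<in>I - {j, i}. ?g l)"
    using assms(1,2) e(1,2) g by (intro nonneg_finsum nonneg_compress) auto
  moreover have "nonneg e h" unfolding h_def using e assms by (intro nonneg_compress) auto
  moreover have "e \<otimes> h = h" "h \<otimes> e = h"
    using e fi by (auto simp: h_def m_assoc) (simp flip: m_assoc)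
  moreover have "star A h = h" using e fi by (simp add: h_def star_mult m_assoc)
  ultimately have "h = \<zero>" using e(1) h by (intro nonneg_antisym) auto
  then have "star A (f i \<otimes> e) \<otimes> (f i \<otimes> e) = \<zero>"
    using e fi by (simp add: h_def star_mult m_assoc) (simp flip: m_assoc)
  then have "(nrm A (f i \<otimes> e))\<^sup>2 = 0" using cstar_identity[of "f i \<otimes> e"] e fi by simp
  then show ?thesis using nrm_eq_0_iff[of "f i \<otimes> e"] e fi by (simp add: e_def)
qed

lemma nonneg_proj_one: "proj p \<Longrightarrow> nonneg \<one> p"
  using nonneg_compress[OF proj_one, of p] by simp

lemma nonneg_smult:
  assumes "e \<in> carrier A" "h \<in> carrier A" "nonneg e h" "c \<ge> 0"
  shows "nonneg e (complex_of_real c \<odot> h)"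
proof -
  obtain t :: real where t: "t \<ge> 0" "nrm A (t \<odot> e \<ominus> h) \<le> t" using assms(3) by (auto simp: nonneg_def)
  have "of_real (c * t) \<odot> e \<ominus> of_real c \<odot> h = of_real c \<odot> (t \<odot> e \<ominus> h)"
    using assms by (simp add: a_minus_def smult_r_distr smult_minus smult_smult)
  then have "nrm A (of_real (c * t) \<odot> e \<ominus> of_real c \<odot> h) = c * nrm A (t \<odot> e \<ominus> h)"
    using assms by (simp add: nrm_smult)
  then show ?thesis
    using t assms(4) unfolding nonneg_def by (intro exI[of _ "c * t"]) (auto intro: mult_left_mono)
qed

text \<open>Dividing by \<open>- c\<close> makes both \<open>p\<close> and its negative positive. In
  the counting argument for Hall's condition \<open>c\<close> is a difference of two
  cardinalities.\<close>

lemma nonneg_multiple: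
  assumes "proj p" "nonneg \<one> (complex_of_real c \<odot> p)" "c < 0"
  shows "p = \<zero>"
proof -
  have p: "p \<in> carrier A" "star A p = p" using assms(1) by (auto simp: proj_def)
  note assms(2)
  then have "nonneg \<one> (of_real (1 / - c) \<odot> (of_real c \<odot> p))"
    by (rule nonneg_smult[rotated 2]) (use p assms(3) in auto)
  moreover have "of_real (1 / - c) \<odot> (of_real c \<odot> p) = \<ominus> p"
  proof -
    have "of_real (1 / - c) \<odot> (of_real c \<odot> p) = (of_real (1 / - c) * of_real c) \<odot> p"
      using smult_smult[OF p(1)] by (simp only:)
    also have "complex_of_real (1 / - c) * of_real c = - 1"
      using assms(3) by (simp flip: of_real_mult)
    finally show ?thesis using p minus_smult[of p 1] by (simp add: smult_one)
  qed
  ultimately have "nonneg \<one> (\<ominus> p)" by simp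
  then show ?thesis
    using p nonneg_antisym[OF proj_one p(1) p(2)] nonneg_proj_one[OF assms(1)] by simp
qed

end

section \<open>Hall's theorem and the support of a magic unitary\<close>

lemma hall:
  assumes "finite J" "\<And>j. j \<in> J \<Longrightarrow> finite (N j)"
    and "\<And>S. S \<subseteq> J \<Longrightarrow> card S \<le> card (\<Union>j\<in>S. N j)"
  shows "\<exists>f. inj_on f J \<and> (\<forall>j\<in>J. f j \<in> N j)"
  using assms
proof (induction "card J" arbitrary: J N rule: less_induct)
  case less
  note finJ = less.prems(1) and finN = less.prems(2) and hall = less.prems(3)
  have fin_Un: "finite (\<Union>j\<in>S. N j)" if "S \<subseteq> J" for S
    using that finJ finN by (meson finite_UN_I finite_subset subsetD)
  show ?case
  proof (cases "\<exists>S\<subset>J. S \<noteq> {} \<and> card (\<Union>j\<in>S. N j) = card S")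
    case True
    \<comment> \<open>A tight proper set: \<open>S\<close> is matched inside its neighbourhood and
      the rest outside it. Tightness is what carries Hall's condition over to the rest.\<close>
    then obtain S where S: "S \<subset> J" "S \<noteq> {}" "card (\<Union>j\<in>S. N j) = card S" by blast
    let ?M = "\<Union>j\<in>S. N j"
    have finS: "finite S" using S(1) finJ finite_subset by blast
    have "card S < card J" using S(1) finJ by (simp add: psubset_card_mono)
    then obtain f where f: "inj_on f S" "\<forall>j\<in>S. f j \<in> N j"
      using less.hyps[of S N] finS finN hall S(1) by (metis psubset_imp_subset subsetD subset_trans)
    have "card (J - S) < card J" using S finJ by (metis Diff_subset card_Diff_subset card_gt_0_iff
          card_mono diff_less finS order_less_le_trans psubset_imp_subset)
    moreover have "card T \<le> card (\<Union>j\<in>T. N j - ?M)" if T: "T \<subseteq> J - S" for T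
    proof -
      have finT: "finite T" using T finJ by (meson Diff_subset finite_subset)
      have TS: "T \<union> S \<subseteq> J" using T S(1) by blast
      have "card T + card S = card (T \<union> S)" using T finT finS by (subst card_Un_disjoint) auto
      also have "\<dots> \<le> card (\<Union>j\<in>T \<union> S. N j)" using hall[OF TS] .
      also have "(\<Union>j\<in>T \<union> S. N j) = (\<Union>j\<in>T. N j - ?M) \<union> ?M" by blast
      also have "card \<dots> \<le> card (\<Union>j\<in>T. N j - ?M) + card ?M" by (rule card_Un_le)
      finally show ?thesis using S(3) by simp
    qed
    ultimately obtain g where g: "inj_on g (J - S)" "\<forall>j\<in>J - S. g j \<in> N j - ?M"
      using less.hyps[of "J - S" "\<lambda>j. N j - ?M"] finJ finN by auto
    let ?h = "\<lambda>j. if j \<in> S then f j else g j"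
    have "inj_on ?h J"
    proof (rule inj_onI)
      fix a b assume ab: "a \<in> J" "b \<in> J" "?h a = ?h b"
      consider "a \<in> S" "b \<in> S" | "a \<notin> S" "b \<notin> S" | "a \<in> S" "b \<notin> S" | "a \<notin> S" "b \<in> S" by blast
      then show "a = b"
      proof cases
        case 1
        then show ?thesis using ab f(1) by (simp add: inj_on_def)
      next
        case 2
        then show ?thesis using ab g(1) by (simp add: inj_on_def)
      next
        case 3
        then have "f a = g b" using ab by simp
        moreover have "f a \<in> ?M" using f(2) 3 by blast
        moreover have "g b \<notin> ?M" using g(2) 3 ab by blast
        ultimately show ?thesis by simp
      next
        case 4
        then have "g a = f b" using ab by simp
        moreover have "f b \<in> ?M" using f(2) 4 by blast
        moreover have "g a \<notin> ?M" using g(2) 4 ab by blast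
        ultimately show ?thesis by simp
      qed
    qed
    then show ?thesis using f(2) g(2) by (intro exI[of _ ?h]) auto
  next
    case False
    show ?thesis
    proof (cases "J = {}")
      case True
      then show ?thesis by simp
    next
      case nonempty: False
      \<comment> \<open>No proper nonempty set is tight, so \<open>j\<close> may take any neighbour
        \<open>i\<close>: every other set has one neighbour to spare.\<close>
      then obtain j where j: "j \<in> J" by blast
      have "card {j} \<le> card (\<Union>j\<in>{j}. N j)" using j by (intro hall) simp
      then have "N j \<noteq> {}" by auto
      then obtain i where i: "i \<in> N j" by blast
      have "card (J - {j}) < card J" using j finJ by (metis card_Diff1_less)
      moreover have "card T \<le> card (\<Union>l\<in>T. N l - {i})" if T: "T \<subseteq> J - {j}" for T
      proof (cases "T = {}")
        case nT: False
        have TJ: "T \<subset> J" using T j by blast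
        then have "card (\<Union>l\<in>T. N l) \<noteq> card T" using False nT by blast
        moreover have "card T \<le> card (\<Union>l\<in>T. N l)" using hall TJ by blast
        ultimately have "card T < card (\<Union>l\<in>T. N l)" by simp
        also have "card (\<Union>l\<in>T. N l) \<le> Suc (card ((\<Union>l\<in>T. N l) - {i}))"
          using card_Suc_Diff1[OF fin_Un] TJ by (metis Diff_empty Diff_insert0 le_SucI order_refl psubset_imp_subset)
        also have "(\<Union>l\<in>T. N l) - {i} = (\<Union>l\<in>T. N l - {i})" by blast
        finally show ?thesis by simp
      qed simp
      ultimately obtain g where g: "inj_on g (J - {j})" "\<forall>l\<in>J - {j}. g l \<in> N l - {i}"
        using less.hyps[of "J - {j}" "\<lambda>l. N l - {i}"] finJ finN by auto
      have "inj_on (g(j := i)) (insert j (J - {j}))"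
        using g by (auto simp: inj_on_def)
      moreover have "insert j (J - {j}) = J" using j by blast
      ultimately show ?thesis using g(2) i by (intro exI[of _ "g(j := i)"]) auto
    qed
  qed
qed

context unital_cstar_algebra
begin

lemma add_left_imp_eq:
  assumes "x \<in> carrier A" "y \<in> carrier A" "z \<in> carrier A" "x \<oplus> y = x \<oplus> z"
  shows "y = z"
proof -
  have "y = \<ominus> x \<oplus> (x \<oplus> y)" using assms(1,2) by (simp add: r_neg1)
  also have "\<dots> = z" using assms(1,3) unfolding assms(4) by (simp add: r_neg1)
  finally show ?thesis .
qed

lemma finsum_constant:
  assumes "finite I" "x \<in> carrier A"
  shows "(\<Oplus>i\<in>I. x) = of_nat (card I) \<odot> x"
  using finsum_smult_scalar[OF assms, of "\<lambda>_. 1"] assms(2) by (simp add: smult_one)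

text \<open>Add up the entries in the rows of \<open>?N\<close>. By rows the total is
  \<open>card ?N\<close> times \<open>p\<close>. The columns in \<open>S\<close> have their whole
  support in these rows and contribute \<open>card S\<close> times \<open>p\<close>; the remainder
  is a sum of projections, so the difference of the cardinalities cannot be negative.\<close>

lemma magic_support_card_le:
  assumes fin: "finite I" "finite J" and pj: "\<And>i j. i \<in> I \<Longrightarrow> j \<in> J \<Longrightarrow> proj (w i j)"
    and col: "\<And>j. j \<in> J \<Longrightarrow> (\<Oplus>i\<in>I. w i j) = p" and row: "\<And>i. i \<in> I \<Longrightarrow> (\<Oplus>j\<in>J. w i j) = p"
    and p: "proj p" "p \<noteq> \<zero>" and S: "S \<subseteq> J"
  shows "card S \<le> card {i \<in> I. \<exists>j\<in>S. w i j \<noteq> \<zero>}" (is "_ \<le> card ?N")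
proof (rule ccontr)
  assume less: "\<not> card S \<le> card ?N"
  have finS: "finite S" and finN: "finite ?N" using fin S finite_subset by auto
  have c: "w i j \<in> carrier A" if "i \<in> I" "j \<in> J" for i j using pj that by blast
  let ?Y = "\<Oplus>i\<in>?N. \<Oplus>j\<in>J - S. w i j"
  have Y: "?Y \<in> carrier A" using c by (intro finsum_closed) (auto intro!: finsum_closed)
  have "of_nat (card ?N) \<odot> p = (\<Oplus>i\<in>?N. \<Oplus>j\<in>J. w i j)"
  proof -
    have "(\<Oplus>i\<in>?N. \<Oplus>j\<in>J. w i j) = (\<Oplus>i\<in>?N. p)"
      using row p by (intro finsum_cong') auto
    then show ?thesis using finsum_constant[OF finN, of p] p by simp
  qed
  also have "\<dots> = (\<Oplus>i\<in>?N. (\<Oplus>j\<in>S. w i j) \<oplus> (\<Oplus>j\<in>J - S. w i j))"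
    using c S fin(2) by (intro finsum_cong' finsum_split) (auto intro!: finsum_closed a_closed)
  also have "\<dots> = (\<Oplus>i\<in>?N. \<Oplus>j\<in>S. w i j) \<oplus> ?Y"
    using c S by (intro finsum_addf) (auto intro!: finsum_closed)
  also have "(\<Oplus>i\<in>?N. \<Oplus>j\<in>S. w i j) = (\<Oplus>j\<in>S. \<Oplus>i\<in>?N. w i j)"
    using c S finS finN by (intro finsum_swap) auto
  also have "\<dots> = (\<Oplus>j\<in>S. p)"
  proof (intro finsum_cong')
    fix j assume "j \<in> S"
    then have "(\<Oplus>i\<in>I. w i j) = (\<Oplus>i\<in>?N. w i j)"
      using fin c S by (intro finsum_restrict) auto
    then show "(\<Oplus>i\<in>?N. w i j) = p" using col S \<open>j \<in> S\<close> by auto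
  qed (use p in auto)
  also have "\<dots> = of_nat (card S) \<odot> p"
    using finsum_constant[OF finS, of p] p by simp
  finally have 1: "of_nat (card ?N) \<odot> p = of_nat (card S) \<odot> p \<oplus> ?Y" .
  define d where "d = real (card ?N) - real (card S)"
  have d: "complex_of_nat (card S) + of_real d = of_nat (card ?N)" by (simp add: d_def)
  have "of_nat (card S) \<odot> p \<oplus> of_real d \<odot> p = of_nat (card ?N) \<odot> p"
    unfolding d[symmetric] using p by (intro smult_l_distr[symmetric]) auto
  with 1 have "of_real d \<odot> p = ?Y"
    using Y p add_left_imp_eq[of "of_nat (card S) \<odot> p" "of_real d \<odot> p" ?Y] by simp
  moreover have "nonneg \<one> ?Y"
    using pj c fin finN by (intro nonneg_finsum nonneg_proj_one) (auto intro!: finsum_closed)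
  ultimately have "nonneg \<one> (of_real d \<odot> p)" by simp
  then have "p = \<zero>" by (rule nonneg_multiple[OF p(1)]) (use less in \<open>simp add: d_def\<close>)
  then show False using p(2) by simp
qed

lemma magic_support_matching:
  assumes fin: "finite I" "finite J" and pj: "\<And>i j. i \<in> I \<Longrightarrow> j \<in> J \<Longrightarrow> proj (w i j)"
    and col: "\<And>j. j \<in> J \<Longrightarrow> (\<Oplus>i\<in>I. w i j) = p" and row: "\<And>i. i \<in> I \<Longrightarrow> (\<Oplus>j\<in>J. w i j) = p"
    and p: "proj p" "p \<noteq> \<zero>"
  shows "\<exists>f. bij_betw f J I \<and> (\<forall>j\<in>J. w (f j) j \<noteq> \<zero>)"
proof -
  have "card S \<le> card (\<Union>j\<in>S. {i \<in> I. w i j \<noteq> \<zero>})" if "S \<subseteq> J" for S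
  proof -
    have "(\<Union>j\<in>S. {i \<in> I. w i j \<noteq> \<zero>}) = {i \<in> I. \<exists>j\<in>S. w i j \<noteq> \<zero>}" by auto
    then show ?thesis using magic_support_card_le[OF assms that] by simp
  qed
  then obtain f where f: "inj_on f J" "\<forall>j\<in>J. f j \<in> {i \<in> I. w i j \<noteq> \<zero>}"
    using hall[of J "\<lambda>j. {i \<in> I. w i j \<noteq> \<zero>}"] fin by auto
  \<comment> \<open>The inequality for the transposed matrix bounds \<open>card I\<close> by
    \<open>card J\<close>, which makes the injection onto.\<close>
  have "card I \<le> card {j \<in> J. \<exists>i\<in>I. w i j \<noteq> \<zero>}"
    using magic_support_card_le[of J I "\<lambda>j i. w i j" p I] assms by auto
  also have "\<dots> \<le> card J" using fin by (intro card_mono) auto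
  finally have "card I \<le> card (f ` J)" using f(1) by (simp add: card_image)
  then have "f ` J = I" using f(2) fin by (intro card_seteq) auto
  then show ?thesis using f by (auto simp: bij_betw_def)
qed

end

section \<open>Quantum isomorphisms of connected graphs\<close>

lemma (in unital_cstar_algebra) finsum_neq_zeroE:
  assumes "(\<Oplus>i\<in>I. f i) \<noteq> \<zero>"
  obtains i where "i \<in> I" "f i \<noteq> \<zero>"
proof -
  have "\<exists>i\<in>I. f i \<noteq> \<zero>"
  proof (rule ccontr)
    assume "\<not> (\<exists>i\<in>I. f i \<noteq> \<zero>)"
    then have "(\<Oplus>i\<in>I. f i) = \<zero>" by (intro add.finprod_one_eqI) auto
    then show False using assms by simp
  qed
  then show ?thesis using that by blast
qed

locale quantum_graph_iso =
  unital_cstar_algebra A + G: fin_conn_graph V R + H: fin_conn_graph V' R'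
  for A :: "'x cstar" (structure)
    and V :: "'v set" and R and V' :: "'w set" and R' +
  fixes u :: "'w \<Rightarrow> 'v \<Rightarrow> 'x"
  assumes one_neq_zero: "\<one> \<noteq> \<zero>"
    and entry_proj: "\<lbrakk>x \<in> V'; a \<in> V\<rbrakk> \<Longrightarrow> proj (u x a)"
    and column_sum: "a \<in> V \<Longrightarrow> (\<Oplus>x\<in>V'. u x a) = \<one>"
    and row_sum: "x \<in> V' \<Longrightarrow> (\<Oplus>a\<in>V. u x a) = \<one>"
    and intertwines: "\<lbrakk>x \<in> V'; b \<in> V\<rbrakk> \<Longrightarrow>
      (\<Oplus>a\<in>V. (if (a, b) \<in> R then 1 else 0) \<odot> u x a) =
      (\<Oplus>y\<in>V'. (if (x, y) \<in> R' then 1 else 0) \<odot> u y b)"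
begin

text \<open>Symmetry of both adjacency relations exchanges the roles of the graphs; one direction of
  each later equivalence is obtained from the other in this way.\<close>

lemma transpose: "quantum_graph_iso A V' R' V R (\<lambda>a x. u x a)"
proof (unfold_locales)
  fix a y assume "a \<in> V" "y \<in> V'"
  then have "(\<Oplus>x\<in>V'. (if (y, x) \<in> R' then 1 else 0) \<odot> u x a) =
      (\<Oplus>b\<in>V. (if (b, a) \<in> R then 1 else 0) \<odot> u y b)"
    using intertwines by simp
  moreover have "(x, y) \<in> R' \<longleftrightarrow> (y, x) \<in> R'" "(a, b) \<in> R \<longleftrightarrow> (b, a) \<in> R" for x b
    using G.symR H.symR by (auto dest: symD)
  ultimately show "(\<Oplus>x\<in>V'. (if (x, y) \<in> R' then 1 else 0) \<odot> u x a) =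
      (\<Oplus>b\<in>V. (if (a, b) \<in> R then 1 else 0) \<odot> u y b)"
    by simp
qed (use one_neq_zero entry_proj column_sum row_sum in auto)

lemma entry_closed [simp]: "\<lbrakk>x \<in> V'; a \<in> V\<rbrakk> \<Longrightarrow> u x a \<in> carrier A"
  using entry_proj by blast

lemma entry_idem: "\<lbrakk>x \<in> V'; a \<in> V\<rbrakk> \<Longrightarrow> u x a \<otimes> u x a = u x a"
  using entry_proj by (simp add: proj_def)

lemma entry_star: "\<lbrakk>x \<in> V'; a \<in> V\<rbrakk> \<Longrightarrow> star A (u x a) = u x a"
  using entry_proj by (simp add: proj_def)

lemma row_orthogonal: "\<lbrakk>x \<in> V'; a \<in> V; b \<in> V; a \<noteq> b\<rbrakk> \<Longrightarrow> u x a \<otimes> u x b = \<zero>"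
  by (rule proj_sum_one_orthogonal[of V "u x"]) (auto simp: G.fin entry_proj row_sum)

lemma column_orthogonal: "\<lbrakk>x \<in> V'; y \<in> V'; a \<in> V; x \<noteq> y\<rbrakk> \<Longrightarrow> u x a \<otimes> u y a = \<zero>"
  by (rule proj_sum_one_orthogonal[of V' "\<lambda>x. u x a"]) (auto simp: H.fin entry_proj column_sum)

text \<open>The quantum counterpart of a map that sends \<open>a\<close> to \<open>x\<close> and
  \<open>b\<close> to \<open>y\<close>.\<close>

definition linked :: "'w \<Rightarrow> 'v \<Rightarrow> 'w \<Rightarrow> 'v \<Rightarrow> bool" where
  "linked x a y b \<longleftrightarrow> u x a \<otimes> u y b \<noteq> \<zero>"

lemma linked_eq_iff:
  "\<lbrakk>x \<in> V'; y \<in> V'; a \<in> V; b \<in> V; linked x a y b\<rbrakk> \<Longrightarrow> a = b \<longleftrightarrow> x = y"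
  using row_orthogonal column_orthogonal unfolding linked_def by metis

lemma linked_target_self:
  "\<lbrakk>x \<in> V'; y \<in> V'; a \<in> V; b \<in> V; linked x a y b\<rbrakk> \<Longrightarrow> linked y b y b"
  unfolding linked_def using entry_idem by auto

lemma linked_column: "\<lbrakk>x \<in> V'; a \<in> V; u x a \<noteq> \<zero>\<rbrakk> \<Longrightarrow> linked x a x a"
  unfolding linked_def using entry_idem by auto

text \<open>The column sum at \<open>c\<close> is one and may be inserted between the two factors;
  some summand survives. In this way a third vertex is carried along with a linked pair.\<close>

lemma linked_insert:
  assumes "x \<in> V'" "y \<in> V'" "a \<in> V" "b \<in> V" "linked x a y b" "c \<in> V"
  obtains z where "z \<in> V'" "linked x a z c" "linked z c y b"
proof -
  have "u x a \<otimes> u y b = u x a \<otimes> (\<Oplus>z\<in>V'. u z c) \<otimes> u y b"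
    using assms column_sum by simp
  also have "\<dots> = (\<Oplus>z\<in>V'. u x a \<otimes> u z c \<otimes> u y b)"
    using assms H.fin by (simp add: finsum_rdistr finsum_ldistr Pi_def)
  finally have "(\<Oplus>z\<in>V'. u x a \<otimes> u z c \<otimes> u y b) \<noteq> \<zero>"
    using assms(5) by (simp add: linked_def)
  then obtain z where z: "z \<in> V'" "u x a \<otimes> u z c \<otimes> u y b \<noteq> \<zero>"
    by (rule finsum_neq_zeroE)
  have "u x a \<otimes> u z c \<noteq> \<zero>" using z assms by auto
  moreover have "u z c \<otimes> u y b \<noteq> \<zero>" using z assms by (auto simp: m_assoc)
  ultimately show ?thesis using that z by (auto simp: linked_def)
qed

text \<open>Entrywise form of the intertwining of the \<open>n\<close>-th powers of the adjacency
  matrices.\<close>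

lemma walks_intertwine:
  assumes "x \<in> V'" "b \<in> V"
  shows "(\<Oplus>a\<in>V. of_nat (walks V R n a b) \<odot> u x a) =
    (\<Oplus>y\<in>V'. of_nat (walks V' R' n x y) \<odot> u y b)"
  using assms(1)
proof (induction n arbitrary: x)
  case 0
  have "(\<Oplus>a\<in>V. of_nat (walks V R 0 a b) \<odot> u x a) = u x b"
    using 0 assms(2) G.fin by (subst finsum_only[of V b]) (auto simp: smult_one smult_zero_scalar)
  moreover have "(\<Oplus>y\<in>V'. of_nat (walks V' R' 0 x y) \<odot> u y b) = u x b"
    using 0 assms(2) H.fin by (subst finsum_only[of V' x]) (auto simp: smult_one smult_zero_scalar)
  ultimately show ?case by simp
next
  case (Suc n)
  define ad where "ad a c = (if (a, c) \<in> R then 1 else 0 :: complex)" for a c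
  define ad' where "ad' a c = (if (a, c) \<in> R' then 1 else 0 :: complex)" for a c
  have W: "of_nat (walks V R (Suc n) a b) = (\<Sum>c\<in>V. ad a c * of_nat (walks V R n c b))" for a
    by (auto simp: ad_def sum.inter_filter[OF G.fin] intro!: sum.cong)
  have W': "of_nat (walks V' R' (Suc n) a z) = (\<Sum>c\<in>V'. ad' a c * of_nat (walks V' R' n c z))" for a z
    by (auto simp: ad'_def sum.inter_filter[OF H.fin] intro!: sum.cong)
  have expand: "of_nat (walks V R (Suc n) a b) \<odot> u x a =
      (\<Oplus>c\<in>V. of_nat (walks V R n c b) \<odot> (ad a c \<odot> u x a))" if "a \<in> V" for a
    unfolding W using that Suc.prems G.fin
    by (subst finsum_smult_scalar[symmetric]) (auto simp: smult_smult[symmetric] mult.commute)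
  have expand': "of_nat (walks V' R' (Suc n) x z) \<odot> u z b =
      (\<Oplus>y\<in>V'. ad' x y \<odot> (of_nat (walks V' R' n y z) \<odot> u z b))" if "z \<in> V'" for z
    unfolding W' using that assms(2) H.fin
    by (subst finsum_smult_scalar[symmetric]) (auto simp: smult_smult[symmetric])
  have "(\<Oplus>a\<in>V. of_nat (walks V R (Suc n) a b) \<odot> u x a) =
      (\<Oplus>a\<in>V. \<Oplus>c\<in>V. of_nat (walks V R n c b) \<odot> (ad a c \<odot> u x a))"
    using expand Suc.prems by (intro finsum_cong') (auto intro!: finsum_closed)
  also have "\<dots> = (\<Oplus>c\<in>V. \<Oplus>a\<in>V. of_nat (walks V R n c b) \<odot> (ad a c \<odot> u x a))"
    using Suc.prems G.fin by (intro finsum_swap) auto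
  also have "\<dots> = (\<Oplus>c\<in>V. of_nat (walks V R n c b) \<odot> (\<Oplus>a\<in>V. ad a c \<odot> u x a))"
    using Suc.prems by (intro finsum_cong') (auto intro!: finsum_closed simp: finsum_smult Pi_def)
  also have "\<dots> = (\<Oplus>c\<in>V. of_nat (walks V R n c b) \<odot> (\<Oplus>y\<in>V'. ad' x y \<odot> u y c))"
    using intertwines Suc.prems
    by (intro finsum_cong') (auto intro!: finsum_closed simp: ad_def ad'_def)
  also have "\<dots> = (\<Oplus>c\<in>V. \<Oplus>y\<in>V'. of_nat (walks V R n c b) \<odot> (ad' x y \<odot> u y c))"
    by (intro finsum_cong') (auto intro!: finsum_closed simp: finsum_smult Pi_def)
  also have "\<dots> = (\<Oplus>y\<in>V'. \<Oplus>c\<in>V. of_nat (walks V R n c b) \<odot> (ad' x y \<odot> u y c))"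
    using G.fin H.fin by (intro finsum_swap) auto
  also have "\<dots> = (\<Oplus>y\<in>V'. ad' x y \<odot> (\<Oplus>c\<in>V. of_nat (walks V R n c b) \<odot> u y c))"
  proof (intro finsum_cong')
    fix y assume y: "y \<in> V'"
    have "of_nat (walks V R n c b) \<odot> (ad' x y \<odot> u y c) =
        ad' x y \<odot> (of_nat (walks V R n c b) \<odot> u y c)" if "c \<in> V" for c
      using that y by (simp add: mult.commute flip: smult_smult)
    then have "(\<Oplus>c\<in>V. of_nat (walks V R n c b) \<odot> (ad' x y \<odot> u y c)) =
        (\<Oplus>c\<in>V. ad' x y \<odot> (of_nat (walks V R n c b) \<odot> u y c))"
      using y by (intro finsum_cong') auto
    then show "(\<Oplus>c\<in>V. of_nat (walks V R n c b) \<odot> (ad' x y \<odot> u y c)) =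
        ad' x y \<odot> (\<Oplus>c\<in>V. of_nat (walks V R n c b) \<odot> u y c)"
      using y by (simp add: finsum_smult Pi_def)
  qed (auto intro!: finsum_closed)
  also have "\<dots> = (\<Oplus>y\<in>V'. ad' x y \<odot> (\<Oplus>z\<in>V'. of_nat (walks V' R' n y z) \<odot> u z b))"
    using Suc.IH assms(2) by (intro finsum_cong') (auto intro!: finsum_closed)
  also have "\<dots> = (\<Oplus>y\<in>V'. \<Oplus>z\<in>V'. ad' x y \<odot> (of_nat (walks V' R' n y z) \<odot> u z b))"
    using assms(2) by (intro finsum_cong') (auto intro!: finsum_closed simp: finsum_smult Pi_def)
  also have "\<dots> = (\<Oplus>z\<in>V'. \<Oplus>y\<in>V'. ad' x y \<odot> (of_nat (walks V' R' n y z) \<odot> u z b))"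
    using assms(2) H.fin by (intro finsum_swap) auto
  also have "\<dots> = (\<Oplus>z\<in>V'. of_nat (walks V' R' (Suc n) x z) \<odot> u z b)"
    using expand' assms(2) by (intro finsum_cong') (auto intro!: finsum_closed)
  finally show ?case .
qed

text \<open>Multiplying by \<open>u x a\<close> on the left and by \<open>u y b\<close> on the right
  leaves one term on either side, by orthogonality in row \<open>x\<close> and in column
  \<open>b\<close>.\<close>

lemma linked_coeff_eq:
  assumes "x \<in> V'" "y \<in> V'" "a \<in> V" "b \<in> V" "linked x a y b"
    and eq: "(\<Oplus>a\<in>V. M a \<odot> u x a) = (\<Oplus>y\<in>V'. N y \<odot> u y b)"
  shows "M a = N y"
proof -
  have 1: "u x a \<otimes> (\<Oplus>c\<in>V. M c \<odot> u x c) = M a \<odot> u x a"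
  proof -
    have "u x a \<otimes> (\<Oplus>c\<in>V. M c \<odot> u x c) = (\<Oplus>c\<in>V. u x a \<otimes> (M c \<odot> u x c))"
      using assms G.fin by (intro finsum_rdistr) auto
    also have "\<dots> = u x a \<otimes> (M a \<odot> u x a)"
      using assms G.fin row_orthogonal by (intro finsum_only) (auto simp: smult_mult_right)
    finally show ?thesis using assms by (simp add: smult_mult_right entry_idem)
  qed
  have 2: "(\<Oplus>z\<in>V'. N z \<odot> u z b) \<otimes> u y b = N y \<odot> u y b"
  proof -
    have "(\<Oplus>z\<in>V'. N z \<odot> u z b) \<otimes> u y b = (\<Oplus>z\<in>V'. (N z \<odot> u z b) \<otimes> u y b)"
      using assms H.fin by (intro finsum_ldistr) auto
    also have "\<dots> = (N y \<odot> u y b) \<otimes> u y b"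
      using assms H.fin column_orthogonal by (intro finsum_only) (auto simp: smult_mult_left)
    finally show ?thesis using assms by (simp add: smult_mult_left entry_idem)
  qed
  have c: "(\<Oplus>z\<in>V'. N z \<odot> u z b) \<in> carrier A" using assms by (intro finsum_closed) auto
  have "M a \<odot> (u x a \<otimes> u y b) = (u x a \<otimes> (\<Oplus>c\<in>V. M c \<odot> u x c)) \<otimes> u y b"
    unfolding 1 using assms by (simp add: smult_mult_left)
  also have "\<dots> = u x a \<otimes> ((\<Oplus>z\<in>V'. N z \<odot> u z b) \<otimes> u y b)"
    unfolding eq using assms c by (simp add: m_assoc)
  also have "\<dots> = N y \<odot> (u x a \<otimes> u y b)"
    unfolding 2 using assms by (simp add: smult_mult_right)
  finally have "(M a - N y) \<odot> (u x a \<otimes> u y b) = \<zero>"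
    using assms smult_l_distr[of "u x a \<otimes> u y b" "M a" "- N y"]
    by (simp add: minus_smult r_neg)
  then show ?thesis
    using smult_eq_zero[of "u x a \<otimes> u y b" "M a - N y"] assms by (auto simp: linked_def)
qed

lemma linked_walks:
  assumes "x \<in> V'" "y \<in> V'" "a \<in> V" "b \<in> V" "linked x a y b"
  shows "walks V R n a b = walks V' R' n x y"
proof -
  have "(of_nat (walks V R n a b) :: complex) = of_nat (walks V' R' n x y)"
    using assms walks_intertwine[of x b n] by (intro linked_coeff_eq[OF assms]) auto
  then show ?thesis by simp
qed

lemma linked_edge:
  assumes "x \<in> V'" "y \<in> V'" "a \<in> V" "b \<in> V" "linked x a y b"
  shows "(a, b) \<in> R \<longleftrightarrow> (x, y) \<in> R'"
  using linked_coeff_eq[OF assms intertwines[OF assms(1,4)]] by (auto split: if_splits)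

text \<open>The walk counts among \<open>a, v, b\<close> agree with those among
  \<open>x, t, y\<close>, and these counts determine the numbers of avoiding walks.\<close>

lemma linked_conn:
  assumes V: "x \<in> V'" "y \<in> V'" "t \<in> V'" "a \<in> V" "b \<in> V" "v \<in> V"
    and l: "linked x a y b" "linked x a t v" "linked t v y b" and ne: "b \<noteq> v"
  shows "G.conn v a b \<longleftrightarrow> H.conn t x y"
proof -
  have "linked t v t v" using linked_target_self l V by blast
  then have "avoiding_walks V R v n a b = avoiding_walks V' R' t n x y" for n
    using V l by (intro avoiding_walks_cong linked_walks) auto
  moreover have "y \<noteq> t" using linked_eq_iff[OF V(3,2,6,5) l(3)] ne by auto
  ultimately show ?thesis using G.conn_iff_avoiding_walks[OF ne] H.conn_iff_avoiding_walks by simp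
qed

text \<open>A candidate separator \<open>t\<close> of \<open>x\<close> and \<open>y\<close> is
  pulled back to some \<open>v\<close> by inserting the row sum at \<open>t\<close>;
  \<open>linked_conn\<close> then compares the two separations.\<close>

lemma linked_same_block_imp:
  assumes V: "x \<in> V'" "y \<in> V'" "a \<in> V" "b \<in> V" and l: "linked x a y b" and sb: "G.same_block a b"
  shows "H.same_block x y"
  unfolding H.same_block_def
proof (intro ballI impI)
  fix t assume t: "t \<in> V'" "t \<noteq> x \<and> t \<noteq> y"
  interpret T: quantum_graph_iso A V' R' V R "\<lambda>a x. u x a" by (rule transpose)
  have "T.linked a x b y" using l by (simp add: T.linked_def linked_def)
  then obtain v where v: "v \<in> V" "T.linked a x v t" "T.linked v t b y"
    using T.linked_insert V t(1) by metis
  then have l': "linked x a t v" "linked t v y b" by (auto simp: T.linked_def linked_def)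
  then have "v \<noteq> a" "v \<noteq> b" using linked_eq_iff V v(1) t by metis+
  then have "G.conn v a b" using sb v(1) G.same_block_conn by blast
  then show "H.conn t x y" using linked_conn[OF V(1,2) t(1) V(3,4) v(1) l l'] \<open>v \<noteq> b\<close> by simp
qed

lemma linked_same_block:
  assumes V: "x \<in> V'" "y \<in> V'" "a \<in> V" "b \<in> V" and l: "linked x a y b"
  shows "G.same_block a b \<longleftrightarrow> H.same_block x y"
proof
  interpret T: quantum_graph_iso A V' R' V R "\<lambda>a x. u x a" by (rule transpose)
  assume "H.same_block x y"
  then show "G.same_block a b"
    using T.linked_same_block_imp[of a b x y] V l by (simp add: T.linked_def linked_def)
qed (rule linked_same_block_imp[OF assms])

subsection \<open>Rectangles\<close>

text \<open>On \<open>D' \<times> D\<close> the matrix \<open>(p u\<^sub>z\<^sub>k)\<close> is a magic unitary over the corner \<open>pAp\<close>. All the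
  corners that occur are described by a single projection of \<open>A\<close>, the matrix \<open>u\<close> never changes.\<close>

definition rect :: "'x \<Rightarrow> 'v set \<Rightarrow> 'w set \<Rightarrow> bool" where
  "rect p D D' \<longleftrightarrow> proj p \<and> p \<noteq> \<zero> \<and> D \<subseteq> V \<and> D' \<subseteq> V' \<and>
     (\<forall>k\<in>D. \<forall>z\<in>D'. p \<otimes> u z k = u z k \<otimes> p) \<and>
     (\<forall>k\<in>D. (\<Oplus>z\<in>D'. p \<otimes> u z k) = p) \<and> (\<forall>z\<in>D'. (\<Oplus>k\<in>D. p \<otimes> u z k) = p)"

lemma rect_transpose:
  "quantum_graph_iso.rect A V' V (\<lambda>a x. u x a) p D' D \<longleftrightarrow> rect p D D'"
proof -
  interpret T: quantum_graph_iso A V' R' V R "\<lambda>a x. u x a" by (rule transpose)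
  show ?thesis unfolding rect_def T.rect_def by auto
qed

lemma rect_full: "rect \<one> V V'"
proof -
  have "(\<Oplus>z\<in>V'. \<one> \<otimes> u z k) = (\<Oplus>z\<in>V'. u z k)" if "k \<in> V" for k
    using that by (intro finsum_cong') auto
  moreover have "(\<Oplus>k\<in>V. \<one> \<otimes> u z k) = (\<Oplus>k\<in>V. u z k)" if "z \<in> V'" for z
    using that by (intro finsum_cong') auto
  ultimately show ?thesis
    using one_neq_zero column_sum row_sum by (simp add: rect_def proj_one)
qed

context
  fixes p D D'
  assumes r: "rect p D D'"
begin

lemma rect_proj: "proj p" "p \<in> carrier A" "p \<otimes> p = p" "star A p = p" "p \<noteq> \<zero>"
  using r by (auto simp: rect_def proj_def)

lemma rect_subset: "k \<in> D \<Longrightarrow> k \<in> V" "z \<in> D' \<Longrightarrow> z \<in> V'" "finite D" "finite D'"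
  using r finite_subset[OF _ G.fin] finite_subset[OF _ H.fin] by (auto simp: rect_def)

lemma rect_commute: "\<lbrakk>k \<in> D; z \<in> D'\<rbrakk> \<Longrightarrow> u z k \<otimes> p = p \<otimes> u z k"
  using r by (auto simp: rect_def)

lemma rect_column: "k \<in> D \<Longrightarrow> (\<Oplus>z\<in>D'. p \<otimes> u z k) = p"
  using r by (auto simp: rect_def)

lemma rect_row: "z \<in> D' \<Longrightarrow> (\<Oplus>k\<in>D. p \<otimes> u z k) = p"
  using r by (auto simp: rect_def)

lemma rect_mult:
  assumes "k \<in> D" "z \<in> D'" "k' \<in> D" "z' \<in> D'"
  shows "(p \<otimes> u z k) \<otimes> (p \<otimes> u z' k') = p \<otimes> u z k \<otimes> u z' k'"
proof -
  have c: "u z k \<in> carrier A" "u z' k' \<in> carrier A" "p \<in> carrier A"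
    using assms rect_subset rect_proj by auto
  have "(p \<otimes> u z k) \<otimes> (p \<otimes> u z' k') = p \<otimes> (u z k \<otimes> p) \<otimes> u z' k'"
    using c by (simp add: m_assoc)
  also have "\<dots> = (p \<otimes> p) \<otimes> u z k \<otimes> u z' k'"
    using c rect_commute assms by (simp add: m_assoc)
  finally show ?thesis using rect_proj by simp
qed

lemma rect_entry_proj:
  assumes "k \<in> D" "z \<in> D'"
  shows "proj (p \<otimes> u z k)"
proof -
  have kz: "k \<in> V" "z \<in> V'" using assms rect_subset by auto
  then have c: "u z k \<in> carrier A" "p \<in> carrier A" using rect_proj by auto
  have "(p \<otimes> u z k) \<otimes> (p \<otimes> u z k) = p \<otimes> (u z k \<otimes> u z k)"
    using rect_mult[OF assms assms] c by (simp add: m_assoc)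
  moreover have "star A (p \<otimes> u z k) = p \<otimes> u z k"
    using c kz rect_proj(4) rect_commute[OF assms] by (simp add: star_mult entry_star)
  ultimately show ?thesis using c kz by (simp add: proj_def entry_idem)
qed

text \<open>Column \<open>c\<close> restricted to \<open>D'\<close> sums to \<open>p\<close> in the
  corner, so the partner of the inserted vertex can be found inside \<open>D'\<close>.\<close>

lemma rect_insert:
  assumes "k \<in> D" "z \<in> D'" "k' \<in> D" "z' \<in> D'" "c \<in> D"
    and "p \<otimes> u z k \<otimes> u z' k' \<noteq> \<zero>"
  obtains w where "w \<in> D'" "p \<otimes> u z k \<otimes> u w c \<noteq> \<zero>" "p \<otimes> u w c \<otimes> u z' k' \<noteq> \<zero>"
proof -
  have cl: "u z k \<in> carrier A" "u z' k' \<in> carrier A" "p \<in> carrier A"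
    "\<And>w. w \<in> D' \<Longrightarrow> u w c \<in> carrier A"
    using assms rect_subset rect_proj by auto
  have "p \<otimes> u z k \<otimes> u z' k' = u z k \<otimes> p \<otimes> u z' k'"
    using rect_commute assms by simp
  also have "\<dots> = u z k \<otimes> (\<Oplus>w\<in>D'. p \<otimes> u w c) \<otimes> u z' k'"
    using rect_column assms by simp
  also have "\<dots> = (\<Oplus>w\<in>D'. u z k \<otimes> (p \<otimes> u w c) \<otimes> u z' k')"
    using cl rect_subset(4) by (simp add: finsum_rdistr finsum_ldistr Pi_def)
  finally have "(\<Oplus>w\<in>D'. u z k \<otimes> (p \<otimes> u w c) \<otimes> u z' k') \<noteq> \<zero>" using assms(6) by simp
  then obtain w where w: "w \<in> D'" "u z k \<otimes> (p \<otimes> u w c) \<otimes> u z' k' \<noteq> \<zero>"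
    by (rule finsum_neq_zeroE)
  have "u z k \<otimes> (p \<otimes> u w c) = p \<otimes> u z k \<otimes> u w c"
    using rect_commute[of k z] assms cl w(1) by (simp flip: m_assoc)
  then have "p \<otimes> u z k \<otimes> u w c \<noteq> \<zero>" using w cl by auto
  moreover have "p \<otimes> u w c \<otimes> u z' k' \<noteq> \<zero>" using w cl by (auto simp: m_assoc)
  ultimately show ?thesis using that w(1) by blast
qed

lemma rect_linked:
  assumes "k \<in> D" "z \<in> D'" "k' \<in> D" "z' \<in> D'" "p \<otimes> u z k \<otimes> u z' k' \<noteq> \<zero>"
  shows "linked z k z' k'"
  using assms rect_subset rect_proj by (auto simp: linked_def m_assoc)

text \<open>The entries below \<open>p\<close>, summed over a class of rows with equal label, depend
  on the column only through its label. They form a magic unitary over \<open>pAp\<close> indexed by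
  labels, and each entry on a matching in its support is the projection of a smaller
  rectangle.\<close>

lemma rect_labels:
  assumes labels: "\<And>k k' z z'. \<lbrakk>k \<in> D; k' \<in> D; z \<in> D'; z' \<in> D'; p \<otimes> u z k \<otimes> u z' k' \<noteq> \<zero>\<rbrakk>
      \<Longrightarrow> f k = f k' \<longleftrightarrow> f' z = f' z'"
  shows "\<exists>\<tau>. bij_betw \<tau> (f ` D) (f' ` D') \<and>
    (\<forall>s\<in>f ` D. \<exists>q. p \<otimes> q = q \<and> q \<otimes> p = q \<and> rect q {k \<in> D. f k = s} {z \<in> D'. f' z = \<tau> s})"
proof -
  define w where "w z k = p \<otimes> u z k" for z k
  have wp: "proj (w z k)" if "k \<in> D" "z \<in> D'" for z k using rect_entry_proj that by (simp add: w_def)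
  have wc [simp]: "w z k \<in> carrier A" if "k \<in> D" "z \<in> D'" for z k using wp that by blast
  have orth: "w z k \<otimes> w z' k' = \<zero>"
    if "k \<in> D" "z \<in> D'" "k' \<in> D" "z' \<in> D'" "(f k = f k') \<noteq> (f' z = f' z')" for k z k' z'
  proof (rule ccontr)
    assume "w z k \<otimes> w z' k' \<noteq> \<zero>"
    then have "p \<otimes> u z k \<otimes> u z' k' \<noteq> \<zero>" using rect_mult[OF that(1-4)] by (simp add: w_def)
    then show False using labels[OF that(1,3,2,4)] that(5) by simp
  qed
  have wp': "w z k \<otimes> p = w z k" "p \<otimes> w z k = w z k" if "k \<in> D" "z \<in> D'" for z k
  proof -
    have c: "u z k \<in> carrier A" "p \<in> carrier A" using that rect_subset rect_proj by auto
    show 1: "p \<otimes> w z k = w z k"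
      using c rect_proj(3) unfolding w_def by (simp flip: m_assoc)
    have "w z k \<otimes> p = p \<otimes> w z k"
      using c rect_commute[OF that] unfolding w_def by (simp add: m_assoc)
    then show "w z k \<otimes> p = w z k" using 1 by simp
  qed
  define Dl where "Dl s = {k \<in> D. f k = s}" for s
  define Dr where "Dr s = {z \<in> D'. f' z = s}" for s
  define P where "P s' k = (\<Oplus>z\<in>Dr s'. w z k)" for s' k
  define Q where "Q s z = (\<Oplus>k\<in>Dl s. w z k)" for s z
  have sub: "\<And>s k. k \<in> Dl s \<Longrightarrow> k \<in> D" "\<And>s z. z \<in> Dr s \<Longrightarrow> z \<in> D'" "\<And>s. finite (Dl s)" "\<And>s. finite (Dr s)"
    using rect_subset(3,4) by (auto simp: Dl_def Dr_def)
  have P_closed [simp]: "P s k \<in> carrier A" if "k \<in> D" for s k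
    unfolding P_def using that sub by (intro finsum_closed) auto
  have Q_closed [simp]: "Q s z \<in> carrier A" if "z \<in> D'" for s z
    unfolding Q_def using that sub by (intro finsum_closed) auto
  \<comment> \<open>Both sides equal the product of \<open>P\<close> and \<open>Q\<close>: multiply
    \<open>P\<close> by the full row of \<open>z\<close> and \<open>Q\<close> by the full column of
    \<open>k\<close>, and drop the products whose labels disagree. Idempotence of \<open>P\<close>
    follows from the same identity.\<close>
  have PQ: "Q (f k) z = P (f' z) k" "P (f' z) k \<otimes> P (f' z) k = P (f' z) k"
    if kz: "k \<in> D" "z \<in> D'" for k z
  proof -
    have vanish1: "P (f' z) k \<otimes> w z l = \<zero>" if "l \<in> D - Dl (f k)" for l
    proof -
      have "P (f' z) k \<otimes> w z l = (\<Oplus>z'\<in>Dr (f' z). w z' k \<otimes> w z l)"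
        unfolding P_def using kz that sub by (intro finsum_ldistr) auto
      also have "\<dots> = \<zero>"
      proof (rule add.finprod_one_eqI)
        fix z' assume "z' \<in> Dr (f' z)"
        then show "w z' k \<otimes> w z l = \<zero>"
          using that kz by (intro orth) (auto simp: Dl_def Dr_def)
      qed
      finally show ?thesis .
    qed
    have vanish2: "w z' k \<otimes> Q (f k) z = \<zero>" if "z' \<in> D' - Dr (f' z)" for z'
    proof -
      have "w z' k \<otimes> Q (f k) z = (\<Oplus>l\<in>Dl (f k). w z' k \<otimes> w z l)"
        unfolding Q_def using kz that sub by (intro finsum_rdistr) auto
      also have "\<dots> = \<zero>"
      proof (rule add.finprod_one_eqI)
        fix l assume "l \<in> Dl (f k)"
        then show "w z' k \<otimes> w z l = \<zero>"
          using that kz by (intro orth) (auto simp: Dl_def Dr_def)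
      qed
      finally show ?thesis .
    qed
    have "P (f' z) k = P (f' z) k \<otimes> p"
      unfolding P_def using kz sub rect_proj
      by (subst finsum_ldistr) (auto simp: wp' intro!: finsum_cong')
    also have "\<dots> = P (f' z) k \<otimes> (\<Oplus>l\<in>D. w z l)"
      using rect_row[OF kz(2)] by (simp add: w_def)
    also have "\<dots> = (\<Oplus>l\<in>D. P (f' z) k \<otimes> w z l)"
      using kz rect_subset by (intro finsum_rdistr) auto
    also have "\<dots> = (\<Oplus>l\<in>Dl (f k). P (f' z) k \<otimes> w z l)"
      using kz rect_subset vanish1 by (intro finsum_restrict) (auto simp: Dl_def)
    also have "\<dots> = P (f' z) k \<otimes> Q (f k) z"
      unfolding Q_def using kz sub by (intro finsum_rdistr[symmetric]) auto
    finally have 1: "P (f' z) k = P (f' z) k \<otimes> Q (f k) z" .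
    have "Q (f k) z = p \<otimes> Q (f k) z"
      unfolding Q_def using kz sub rect_proj
      by (subst finsum_rdistr) (auto simp: wp' intro!: finsum_cong')
    also have "\<dots> = (\<Oplus>z'\<in>D'. w z' k) \<otimes> Q (f k) z"
      using rect_column[OF kz(1)] by (simp add: w_def)
    also have "\<dots> = (\<Oplus>z'\<in>D'. w z' k \<otimes> Q (f k) z)"
      using kz rect_subset by (intro finsum_ldistr) auto
    also have "\<dots> = (\<Oplus>z'\<in>Dr (f' z). w z' k \<otimes> Q (f k) z)"
      using kz rect_subset vanish2 by (intro finsum_restrict) (auto simp: Dr_def)
    also have "\<dots> = P (f' z) k \<otimes> Q (f k) z"
      unfolding P_def using kz sub by (intro finsum_ldistr[symmetric]) auto
    finally have 2: "Q (f k) z = P (f' z) k \<otimes> Q (f k) z" .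
    show eq: "Q (f k) z = P (f' z) k" using 1 2 by (rule trans[OF _ sym, rotated])
    show "P (f' z) k \<otimes> P (f' z) k = P (f' z) k" using 1 unfolding eq by (rule sym)
  qed
  have star_P: "star A (P s k) = P s k" if "k \<in> D" for s k
    unfolding P_def using that sub wp
    by (subst star_finsum) (auto simp: proj_def intro!: finsum_cong')
  have P_proj: "proj (P (f' z) k)" if "k \<in> D" "z \<in> D'" for k z
    using PQ(2)[OF that] star_P that by (simp add: proj_def)
  have Pp: "P s k \<otimes> p = P s k" "p \<otimes> P s k = P s k" if "k \<in> D" for s k
    unfolding P_def using that sub rect_proj
    by (auto simp: finsum_ldistr finsum_rdistr Pi_def wp' intro!: finsum_cong')
  define rep where "rep s = inv_into D f s" for s
  have rep: "rep s \<in> D" "f (rep s) = s" if "s \<in> f ` D" for s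
    using that by (auto simp: rep_def inv_into_into f_inv_into_f)
  \<comment> \<open>By \<open>PQ\<close> the choice of a representative column with label
    \<open>s\<close> is immaterial.\<close>
  define \<pi> where "\<pi> s' s = P s' (rep s)" for s' s
  have P_\<pi>: "P (f' z) k = \<pi> (f' z) (f k)" if "k \<in> D" "z \<in> D'" for k z
  proof -
    have "f k \<in> f ` D" using that by blast
    then show ?thesis
      using PQ(1)[OF that] PQ(1)[OF rep(1) that(2), of "f k"] rep(2)[of "f k"] by (simp add: \<pi>_def)
  qed
  have Q_\<pi>: "Q (f k) z = \<pi> (f' z) (f k)" if "k \<in> D" "z \<in> D'" for k z
    using PQ(1)[OF that] P_\<pi>[OF that] by simp
  have "\<exists>\<tau>. bij_betw \<tau> (f ` D) (f' ` D') \<and> (\<forall>s\<in>f ` D. \<pi> (\<tau> s) s \<noteq> \<zero>)"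
  proof (rule magic_support_matching)
    show "proj (\<pi> i j)" if ij: "i \<in> f' ` D'" "j \<in> f ` D" for i j
    proof -
      obtain k z where "k \<in> D" "z \<in> D'" "i = f' z" "j = f k" using ij by auto
      then show ?thesis using P_proj P_\<pi> by simp
    qed
    show "(\<Oplus>i\<in>f' ` D'. \<pi> i j) = p" if "j \<in> f ` D" for j
      unfolding \<pi>_def P_def Dr_def using rep[OF that] rect_subset rect_column[OF rep(1)[OF that]]
      by (subst finsum_fibres) (auto simp flip: w_def)
    show "(\<Oplus>j\<in>f ` D. \<pi> i j) = p" if i: "i \<in> f' ` D'" for i
    proof -
      obtain z where z: "z \<in> D'" "i = f' z" using i by auto
      have "(\<Oplus>j\<in>f ` D. \<pi> i j) = (\<Oplus>j\<in>f ` D. Q j z)"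
        using z Q_\<pi> by (intro finsum_cong') auto
      also have "\<dots> = p"
        unfolding Q_def Dl_def using z rect_subset rect_row[OF z(1)]
        by (subst finsum_fibres) (auto simp flip: w_def)
      finally show ?thesis .
    qed
  qed (use rect_subset rect_proj in auto)
  then obtain \<tau> where \<tau>: "bij_betw \<tau> (f ` D) (f' ` D')" "\<And>s. s \<in> f ` D \<Longrightarrow> \<pi> (\<tau> s) s \<noteq> \<zero>" by blast
  have "\<exists>q. p \<otimes> q = q \<and> q \<otimes> p = q \<and> rect q {k \<in> D. f k = s} {z \<in> D'. f' z = \<tau> s}"
    if s: "s \<in> f ` D" for s
  proof -
    define q where "q = \<pi> (\<tau> s) s"
    have "\<tau> s \<in> f' ` D'" using s \<tau>(1) by (auto simp: bij_betw_def)
    then obtain z0 where z0: "z0 \<in> D'" "f' z0 = \<tau> s" by auto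
    have qP: "q = P (\<tau> s) k" if "k \<in> Dl s" for k
      using P_\<pi>[of k z0] that z0 by (auto simp: q_def Dl_def)
    have qQ: "q = Q s z" if "z \<in> Dr (\<tau> s)" for z
      using Q_\<pi>[of "rep s" z] that rep[OF s] by (auto simp: q_def Dr_def)
    have rs: "rep s \<in> Dl s" using rep[OF s] by (simp add: Dl_def)
    have q: "proj q" "q \<in> carrier A"
      using qP[OF rs] P_proj[OF _ z0(1), of "rep s"] rep[OF s] z0(2) by auto
    have qp: "q \<otimes> p = q" "p \<otimes> q = q" using qP[OF rs] Pp rep[OF s] by auto
    \<comment> \<open>Of the summands of \<open>q\<close> in column \<open>k\<close> only
      \<open>w z k\<close> meets \<open>u z k\<close>, by column orthogonality. Entries of the
      smaller rectangle are therefore the same below \<open>q\<close> as below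
      \<open>p\<close>.\<close>
    have qu: "q \<otimes> u z k = w z k \<and> u z k \<otimes> q = w z k" if k: "k \<in> Dl s" and z: "z \<in> Dr (\<tau> s)" for k z
    proof -
      have kz: "k \<in> D" "z \<in> D'" "k \<in> V" "z \<in> V'" using k z sub rect_subset by auto
      have w0: "w z' k \<otimes> u z k = (if z' = z then w z k else \<zero>)"
           "u z k \<otimes> w z' k = (if z' = z then w z k else \<zero>)" if "z' \<in> D'" for z'
      proof -
        have z': "z' \<in> V'" using that rect_subset by simp
        have c: "u z k \<in> carrier A" "u z' k \<in> carrier A" "p \<in> carrier A"
          using z' kz rect_proj by auto
        have "u z k \<otimes> w z' k = p \<otimes> (u z k \<otimes> u z' k)"
          using c rect_commute[OF kz(1,2)] unfolding w_def by (simp flip: m_assoc)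
        moreover have "w z' k \<otimes> u z k = p \<otimes> (u z' k \<otimes> u z k)"
          using c unfolding w_def by (simp add: m_assoc)
        ultimately show "w z' k \<otimes> u z k = (if z' = z then w z k else \<zero>)"
            "u z k \<otimes> w z' k = (if z' = z then w z k else \<zero>)"
          using column_orthogonal[OF z' kz(4,3)] column_orthogonal[OF kz(4) z' kz(3)]
            entry_idem[OF kz(4,3)] c by (auto simp: w_def)
      qed
      have "q \<otimes> u z k = (\<Oplus>z'\<in>Dr (\<tau> s). w z' k \<otimes> u z k)"
        unfolding qP[OF k] P_def using kz sub by (intro finsum_ldistr) auto
      also have "\<dots> = w z k"
        using z kz sub w0 by (subst finsum_only[of _ z]) auto
      finally have 1: "q \<otimes> u z k = w z k" .
      have "u z k \<otimes> q = (\<Oplus>z'\<in>Dr (\<tau> s). u z k \<otimes> w z' k)"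
        unfolding qP[OF k] P_def using kz sub by (intro finsum_rdistr) auto
      also have "\<dots> = w z k"
        using z kz sub w0 by (subst finsum_only[of _ z]) auto
      finally show ?thesis using 1 by simp
    qed
    have "(\<Oplus>z\<in>Dr (\<tau> s). q \<otimes> u z k) = q" if "k \<in> Dl s" for k
    proof -
      have "(\<Oplus>z\<in>Dr (\<tau> s). q \<otimes> u z k) = P (\<tau> s) k"
        unfolding P_def using qu that sub by (intro finsum_cong') auto
      then show ?thesis using qP[OF that] by simp
    qed
    moreover have "(\<Oplus>k\<in>Dl s. q \<otimes> u z k) = q" if "z \<in> Dr (\<tau> s)" for z
    proof -
      have "(\<Oplus>k\<in>Dl s. q \<otimes> u z k) = Q s z"
        unfolding Q_def using qu that sub by (intro finsum_cong') auto
      then show ?thesis using qQ[OF that] by simp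
    qed
    ultimately have "rect q (Dl s) (Dr (\<tau> s))"
      using q qu \<tau>(2)[OF s] sub rect_subset by (auto simp: rect_def q_def)
    then show ?thesis using qp unfolding Dl_def Dr_def by blast
  qed
  then show ?thesis using \<tau>(1) by blast
qed

end

end

section \<open>Gluing along labels and the descent through a block\<close>

lemma bij_betw_fibres:
  assumes \<tau>: "bij_betw \<tau> (f ` D) (f' ` D')"
    and \<sigma>: "\<And>s. s \<in> f ` D \<Longrightarrow> bij_betw (\<sigma> s) {k \<in> D. f k = s} {z \<in> D'. f' z = \<tau> s}"
  shows "bij_betw (\<lambda>k. \<sigma> (f k) k) D D'" "k \<in> D \<Longrightarrow> f' (\<sigma> (f k) k) = \<tau> (f k)"
proof -
  have mem: "\<sigma> (f k) k \<in> D' \<and> f' (\<sigma> (f k) k) = \<tau> (f k)" if "k \<in> D" for k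
    using bij_betwE[OF \<sigma>[of "f k"]] that by auto
  then show "k \<in> D \<Longrightarrow> f' (\<sigma> (f k) k) = \<tau> (f k)" by blast
  show "bij_betw (\<lambda>k. \<sigma> (f k) k) D D'"
    unfolding bij_betw_def
  proof
    show "inj_on (\<lambda>k. \<sigma> (f k) k) D"
    proof (rule inj_onI)
      fix k l assume kl: "k \<in> D" "l \<in> D" "\<sigma> (f k) k = \<sigma> (f l) l"
      then have "\<tau> (f k) = \<tau> (f l)" using mem[OF kl(1)] mem[OF kl(2)] by simp
      then have "f k = f l"
        using kl \<tau> by (auto simp: bij_betw_def dest: inj_onD)
      moreover have "inj_on (\<sigma> (f k)) {m \<in> D. f m = f k}"
        using \<sigma>[of "f k"] kl(1) by (auto simp: bij_betw_def)
      ultimately show "k = l"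
        using kl by (auto dest: inj_onD)
    qed
    show "(\<lambda>k. \<sigma> (f k) k) ` D = D'"
    proof
      show "(\<lambda>k. \<sigma> (f k) k) ` D \<subseteq> D'" using mem by blast
      show "D' \<subseteq> (\<lambda>k. \<sigma> (f k) k) ` D"
      proof
        fix z assume z: "z \<in> D'"
        then have "f' z \<in> \<tau> ` f ` D" using \<tau> by (auto simp: bij_betw_def)
        then obtain s where s: "s \<in> f ` D" "f' z = \<tau> s" by blast
        then have "z \<in> \<sigma> s ` {k \<in> D. f k = s}" using \<sigma>[OF s(1)] z by (auto simp: bij_betw_def)
        then show "z \<in> (\<lambda>k. \<sigma> (f k) k) ` D" by auto
      qed
    qed
  qed
qed

context fin_conn_graph
begin

text \<open>A vertex other than \<open>r\<close> cannot separate \<open>m\<close> from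
  \<open>a\<close>, as both are inseparable from \<open>r\<close>; the vertex \<open>r\<close>
  cannot either, as they lie in one component of its complement. A block through \<open>r\<close> is
  thus determined by the branch at \<open>r\<close> that it meets.\<close>

lemma block_of_at_root:
  assumes "r \<in> V" "a \<in> V" "a \<noteq> r" "same_block r a"
  shows "block_of r a = {m \<in> insert r {l \<in> V. l \<noteq> r \<and> conn r a l}. same_block r m}"
proof (intro equalityI subsetI)
  fix m assume "m \<in> block_of r a"
  then have m: "m \<in> V" "same_block m r" "same_block m a" by (auto simp: block_of_def)
  have "m = r \<or> conn r a m" using same_block_conn[OF m(3) assms(1)] assms(3) conn_sym by (cases "m = r") auto
  then show "m \<in> {m \<in> insert r {l \<in> V. l \<noteq> r \<and> conn r a l}. same_block r m}"
    using m same_block_sym by auto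
next
  fix m assume "m \<in> {m \<in> insert r {l \<in> V. l \<noteq> r \<and> conn r a l}. same_block r m}"
  then have m: "m \<in> V" "same_block r m" "m = r \<or> (m \<noteq> r \<and> conn r a m)" using assms(1) by auto
  have "same_block m a"
    unfolding same_block_def
  proof (intro ballI impI)
    fix v assume v: "v \<in> V" "v \<noteq> m \<and> v \<noteq> a"
    show "conn v m a"
    proof (cases "v = r")
      case True
      then show ?thesis using m(3) v conn_sym by auto
    next
      case False
      then have "conn v m r" "conn v r a"
        using same_block_conn[OF m(2) v(1)] same_block_conn[OF assms(4) v(1)] v conn_sym by auto
      then show ?thesis by (rule conn_trans)
    qed
  qed
  then show "m \<in> block_of r a" using m same_block_sym[OF m(2)] by (simp add: block_of_def)
qed

text \<open>For \<open>D\<close> inside \<open>V\<close> this is \<open>r\<close> together with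
  whole components of the complement of \<open>r\<close>, the shape of every subproblem of the
  recursion.\<close>

definition closed_at :: "'v \<Rightarrow> 'v set \<Rightarrow> bool" where
  "closed_at r D \<longleftrightarrow> r \<in> D \<and> (\<forall>k\<in>D - {r}. \<forall>l\<in>V. conn r k l \<longrightarrow> l \<in> D)"

text \<open>A walk from the fibre that avoids \<open>a\<close> keeps its anchor. If \<open>a\<close>
  is not \<open>r\<close>, then \<open>a\<close> separates the fibre from \<open>r\<close>, so such
  a walk avoids \<open>r\<close> as well and cannot leave \<open>C\<close>.\<close>

lemma anchor_fibre_closed:
  assumes B: "is_block B" and r: "r \<in> B" and C: "C \<subseteq> V" "\<And>k l. \<lbrakk>k \<in> C; l \<in> V; conn r k l\<rbrakk> \<Longrightarrow> l \<in> C"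
    and BC: "B \<subseteq> insert r C" and a: "a \<in> B"
  shows "closed_at a {m \<in> insert r C. anchor B m = a}"
  unfolding closed_at_def
proof (intro conjI ballI impI)
  have BV: "B \<subseteq> V" by (rule is_block_subset[OF B])
  show "a \<in> {m \<in> insert r C. anchor B m = a}" using anchor_self[OF B a] a BC by auto
  fix k l assume k: "k \<in> {m \<in> insert r C. anchor B m = a} - {a}" and l: "l \<in> V" "conn a k l"
  have kr: "k \<noteq> r" using k anchor_self[OF B r] by auto
  then have kC: "k \<in> C" "k \<in> V" using k C(1) by auto
  have ka: "k \<noteq> anchor B k" "anchor B k = a" using k by auto
  have "anchor B l = a" using anchor_conn[OF B kC(2) l(1) ka(1)] l(2) ka(2) by simp
  moreover have "l \<in> insert r C"
  proof (cases "l = r \<or> a = r")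
    case True
    then show ?thesis using C(2)[OF kC(1) l(1)] l(2) by auto
  next
    case False
    have "\<not> conn a k r" using anchor_separates[OF B kC(2) ka(1) r] ka(2) False by auto
    then have "\<not> conn a r l" using l(2) conn_sym conn_trans by blast
    then have "conn r k l" using conn_or_through[OF l(2), of r] False by auto
    then show ?thesis using C(2)[OF kC(1) l(1)] by simp
  qed
  ultimately show "l \<in> {m \<in> insert r C. anchor B m = a}" by simp
qed

lemma anchor_image:
  assumes "is_block B" "B \<subseteq> D" "D \<subseteq> V"
  shows "anchor B ` D = B"
proof
  show "anchor B ` D \<subseteq> B" using anchor_mem[OF assms(1)] assms(3) by auto
  show "B \<subseteq> anchor B ` D"
  proof
    fix a assume a: "a \<in> B"
    then have "anchor B a \<in> anchor B ` D" using assms(2) by blast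
    then show "a \<in> anchor B ` D" using anchor_self[OF assms(1) a] by simp
  qed
qed

lemma anchor_fibre_psubset:
  assumes "is_block B" "B \<subseteq> D" "a \<in> B"
  shows "{m \<in> D. anchor B m = a} \<subset> D"
proof -
  obtain c where "c \<in> B" "c \<noteq> a" by (rule is_block_other[OF assms(1)])
  then have "c \<in> D" "anchor B c \<noteq> a" using anchor_self[OF assms(1)] assms(2) by auto
  then show ?thesis by blast
qed

end

context quantum_graph_iso
begin

lemma linked_sym: "\<lbrakk>x \<in> V'; y \<in> V'; a \<in> V; b \<in> V; linked x a y b\<rbrakk> \<Longrightarrow> linked y b x a"
proof -
  assume V: "x \<in> V'" "y \<in> V'" "a \<in> V" "b \<in> V" and l: "linked x a y b"
  have "star A (u y b \<otimes> u x a) = u x a \<otimes> u y b" using V by (simp add: star_mult entry_star)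
  then show ?thesis using l unfolding linked_def by auto
qed

lemma rect_swap:
  assumes r: "rect p D D'" and "k \<in> D" "z \<in> D'" "l \<in> D" "y \<in> D'" "p \<otimes> u z k \<otimes> u y l \<noteq> \<zero>"
  shows "p \<otimes> u y l \<otimes> u z k \<noteq> \<zero>"
proof -
  have c: "u z k \<in> carrier A" "u y l \<in> carrier A" "p \<in> carrier A"
    "star A (u z k) = u z k" "star A (u y l) = u y l" "star A p = p"
    using assms rect_subset[OF r] rect_proj[OF r] entry_star by auto
  have "star A (p \<otimes> u y l \<otimes> u z k) = u z k \<otimes> (u y l \<otimes> p)"
    using c by (simp add: star_mult)
  also have "\<dots> = (u z k \<otimes> p) \<otimes> u y l"
    using c rect_commute[OF r assms(4,5)] by (simp add: m_assoc)
  also have "\<dots> = p \<otimes> u z k \<otimes> u y l"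
    using rect_commute[OF r assms(2,3)] by simp
  finally show ?thesis using assms(6) by auto
qed

lemma rect_entry_nonzero:
  assumes r: "rect p D D'" and "k \<in> D" "z \<in> D'" "l \<in> D" "y \<in> D'" "p \<otimes> u z k \<otimes> u y l \<noteq> \<zero>"
  shows "p \<otimes> u z k \<noteq> \<zero>" "p \<otimes> u y l \<noteq> \<zero>"
proof -
  have c: "u z k \<in> carrier A" "u y l \<in> carrier A"
    using assms rect_subset[OF r] by auto
  show "p \<otimes> u z k \<noteq> \<zero>" using assms(6) c by auto
  show "p \<otimes> u y l \<noteq> \<zero>" using rect_swap[OF assms] c by auto
qed

text \<open>Only zero entries are dropped, so the projection can stay the same.\<close>

lemma rect_restrict:
  assumes r: "rect p D D'" and b: "b \<subseteq> D" "b' \<subseteq> D'"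
    and inv: "\<And>k z. \<lbrakk>k \<in> D; z \<in> D'; p \<otimes> u z k \<noteq> \<zero>\<rbrakk> \<Longrightarrow> k \<in> b \<longleftrightarrow> z \<in> b'"
  shows "rect p b b'"
proof -
  have c: "p \<otimes> u z k \<in> carrier A" if "k \<in> D" "z \<in> D'" for k z
    using that rect_subset[OF r] rect_proj[OF r] by auto
  have "(\<Oplus>z\<in>b'. p \<otimes> u z k) = p" if "k \<in> b" for k
  proof -
    have "p \<otimes> u z k = \<zero>" if "z \<in> D' - b'" for z
      using that inv[of k z] \<open>k \<in> b\<close> b by blast
    then have "(\<Oplus>z\<in>D'. p \<otimes> u z k) = (\<Oplus>z\<in>b'. p \<otimes> u z k)"
      using that b c rect_subset[OF r] by (intro finsum_restrict) auto
    then show ?thesis using rect_column[OF r, of k] that b by auto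
  qed
  moreover have "(\<Oplus>k\<in>b. p \<otimes> u z k) = p" if "z \<in> b'" for z
  proof -
    have "p \<otimes> u z k = \<zero>" if "k \<in> D - b" for k
      using that inv[of k z] \<open>z \<in> b'\<close> b by blast
    then have "(\<Oplus>k\<in>D. p \<otimes> u z k) = (\<Oplus>k\<in>b. p \<otimes> u z k)"
      using that b c rect_subset[OF r] by (intro finsum_restrict) auto
    then show ?thesis using rect_row[OF r, of z] that b by auto
  qed
  ultimately show ?thesis using r b unfolding rect_def by blast
qed

text \<open>The witness \<open>c\<close> of the separation is carried along between \<open>k\<close>
  and \<open>a\<close>; its partner \<open>w\<close> lies in \<open>b'\<close> and is separated from
  \<open>z\<close> by \<open>x\<close>.\<close>

lemma rect_anchored_imp:
  assumes r: "rect p D D'" and b: "b \<subseteq> D" "b' \<subseteq> D'"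
    and inv: "\<And>k z. \<lbrakk>k \<in> D; z \<in> D'; p \<otimes> u z k \<noteq> \<zero>\<rbrakk> \<Longrightarrow> k \<in> b \<longleftrightarrow> z \<in> b'"
    and D: "k \<in> D" "z \<in> D'" "a \<in> D" "x \<in> D'" "p \<otimes> u z k \<otimes> u x a \<noteq> \<zero>"
    and anch: "G.anchored b k a"
  shows "H.anchored b' z x"
proof -
  note V = rect_subset[OF r]
  have x: "x \<in> b'" using inv[OF D(3,4)] rect_entry_nonzero(2)[OF r D] G.anchored_mem[OF anch] by simp
  have l: "linked z k x a" by (rule rect_linked[OF r D])
  show ?thesis
  proof (cases "k = a")
    case True
    then have "z = x" using linked_eq_iff[OF V(2)[OF D(2)] V(2)[OF D(4)] V(1)[OF D(1)] V(1)[OF D(3)] l] by simp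
    then show ?thesis using H.anchored_self[OF x] by simp
  next
    case False
    then obtain c where c: "c \<in> b" "c \<noteq> a" "\<not> G.conn a k c" using anch by (auto simp: G.anchored_def)
    have cD: "c \<in> D" using c(1) b by blast
    obtain w where w: "w \<in> D'" "p \<otimes> u z k \<otimes> u w c \<noteq> \<zero>" "p \<otimes> u w c \<otimes> u x a \<noteq> \<zero>"
      by (rule rect_insert[OF r D(1-4) cD D(5)])
    have wb: "w \<in> b'" using inv[OF cD w(1)] rect_entry_nonzero(2)[OF r D(1,2) cD w(1,2)] c(1) by simp
    have lw: "linked z k w c" "linked w c x a"
      using rect_linked[OF r D(1,2) cD w(1,2)] rect_linked[OF r cD w(1) D(3,4) w(3)] .
    have VV: "z \<in> V'" "w \<in> V'" "x \<in> V'" "k \<in> V" "c \<in> V" "a \<in> V" using V D cD w(1) by auto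
    have "w \<noteq> x" using linked_eq_iff[OF VV(2,3,5,6) lw(2)] c(2) by simp
    moreover have "\<not> H.conn x z w"
      using linked_conn[OF VV lw(1) l linked_sym[OF VV(2,3,5,6) lw(2)] c(2)] c(3) by simp
    ultimately show ?thesis by (rule H.anchoredI[OF x wb])
  qed
qed

lemma rect_anchored:
  assumes r: "rect p D D'" and b: "b \<subseteq> D" "b' \<subseteq> D'"
    and inv: "\<And>k z. \<lbrakk>k \<in> D; z \<in> D'; p \<otimes> u z k \<noteq> \<zero>\<rbrakk> \<Longrightarrow> k \<in> b \<longleftrightarrow> z \<in> b'"
    and D: "k \<in> D" "z \<in> D'" "a \<in> D" "x \<in> D'" "p \<otimes> u z k \<otimes> u x a \<noteq> \<zero>"
  shows "G.anchored b k a \<longleftrightarrow> H.anchored b' z x"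
proof
  interpret T: quantum_graph_iso A V' R' V R "\<lambda>a x. u x a" by (rule transpose)
  assume "H.anchored b' z x"
  then show "G.anchored b k a"
    using T.rect_anchored_imp[of p D' D b' b z k x a] r b inv D by (simp add: rect_transpose)
qed (rule rect_anchored_imp[OF assms])

text \<open>Insert the anchor \<open>a\<close> of \<open>k\<close> between the two factors. Its
  partner \<open>x\<close> is the anchor of \<open>z\<close>, and \<open>l\<close> hangs at
  \<open>a\<close> exactly when \<open>y\<close> hangs at \<open>x\<close>.\<close>

lemma rect_same_anchor:
  assumes r: "rect p D D'" and B: "G.is_block b" "H.is_block b'" and b: "b \<subseteq> D" "b' \<subseteq> D'"
    and inv: "\<And>k z. \<lbrakk>k \<in> D; z \<in> D'; p \<otimes> u z k \<noteq> \<zero>\<rbrakk> \<Longrightarrow> k \<in> b \<longleftrightarrow> z \<in> b'"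
    and D: "k \<in> D" "l \<in> D" "z \<in> D'" "y \<in> D'" "p \<otimes> u z k \<otimes> u y l \<noteq> \<zero>"
  shows "G.anchor b k = G.anchor b l \<longleftrightarrow> H.anchor b' z = H.anchor b' y"
proof -
  note V = rect_subset[OF r]
  define a where "a = G.anchor b k"
  have a: "G.anchored b k a" using G.anchor_iff[OF B(1) V(1)[OF D(1)]] by (simp add: a_def)
  then have aD: "a \<in> D" using G.anchored_mem b by blast
  obtain x where x: "x \<in> D'" "p \<otimes> u z k \<otimes> u x a \<noteq> \<zero>" "p \<otimes> u x a \<otimes> u y l \<noteq> \<zero>"
    by (rule rect_insert[OF r D(1,3,2,4) aD D(5)])
  have zx: "H.anchored b' z x" using rect_anchored[OF r b inv D(1,3) aD x(1,2)] a by blast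
  have "G.anchored b l a \<longleftrightarrow> H.anchored b' y x"
    using rect_anchored[OF r b inv D(2,4) aD x(1) rect_swap[OF r aD x(1) D(2,4) x(3)]] .
  then have "G.anchor b l = a \<longleftrightarrow> H.anchor b' y = x"
    unfolding G.anchor_iff[OF B(1) V(1)[OF D(2)]] H.anchor_iff[OF B(2) V(2)[OF D(4)]] .
  moreover have "H.anchor b' z = x" using zx unfolding H.anchor_iff[OF B(2) V(2)[OF D(3)]] .
  ultimately show ?thesis
    by (simp only: a_def[symmetric] eq_commute[of a] eq_commute[of x])
qed

text \<open>The projection may change from one block to the next, since each descent passes to a
  smaller projection.\<close>

definition block_iso :: "('v \<Rightarrow> 'w) \<Rightarrow> 'v set \<Rightarrow> 'w set \<Rightarrow> bool" where
  "block_iso \<sigma> D D' \<longleftrightarrow> bij_betw \<sigma> D D' \<and>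
     (\<forall>k\<in>D. \<forall>l\<in>D. G.same_block k l \<longleftrightarrow> H.same_block (\<sigma> k) (\<sigma> l)) \<and>
     (\<forall>k\<in>D. \<forall>l\<in>D. k \<noteq> l \<and> G.same_block k l \<longrightarrow>
        (\<exists>p. rect p (G.block_of k l) (H.block_of (\<sigma> k) (\<sigma> l))))"

text \<open>Anchors serve as labels: matched anchors give the branches for \<open>IH\<close>, while
  the block itself keeps \<open>p\<close> because nonzero entries respect \<open>b\<close> and
  \<open>b'\<close>. The second conclusion lets a caller identify the image of a root that lies in
  \<open>b\<close>.\<close>

lemma block_step:
  assumes r: "rect p D D'" and B: "G.is_block b" "H.is_block b'" and b: "b \<subseteq> D" "b' \<subseteq> D'"
    and inv: "\<And>k z. \<lbrakk>k \<in> D; z \<in> D'; p \<otimes> u z k \<noteq> \<zero>\<rbrakk> \<Longrightarrow> k \<in> b \<longleftrightarrow> z \<in> b'"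
    and IH: "\<And>a x q. \<lbrakk>a \<in> b; x \<in> b'; rect q {k \<in> D. G.anchor b k = a} {z \<in> D'. H.anchor b' z = x};
        q \<otimes> u x a = q\<rbrakk> \<Longrightarrow>
        \<exists>\<sigma>. block_iso \<sigma> {k \<in> D. G.anchor b k = a} {z \<in> D'. H.anchor b' z = x} \<and> \<sigma> a = x"
  shows "\<exists>\<sigma>. block_iso \<sigma> D D' \<and> (\<forall>a\<in>b. p \<otimes> u (\<sigma> a) a \<noteq> \<zero>)"
proof -
  note V = rect_subset[OF r]
  let ?f = "G.anchor b" and ?f' = "H.anchor b'"
  have im: "?f ` D = b" "?f' ` D' = b'"
    using G.anchor_image[OF B(1) b(1) subsetI[OF V(1)]]
      H.anchor_image[OF B(2) b(2) subsetI[OF V(2)]] by simp_all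
  have "\<exists>\<tau>. bij_betw \<tau> (?f ` D) (?f' ` D') \<and>
    (\<forall>s\<in>?f ` D. \<exists>q. p \<otimes> q = q \<and> q \<otimes> p = q \<and> rect q {k \<in> D. ?f k = s} {z \<in> D'. ?f' z = \<tau> s})"
    by (rule rect_labels[OF r]) (rule rect_same_anchor[OF r B b inv])
  then obtain \<tau> where \<tau>: "bij_betw \<tau> b b'"
    and q: "\<forall>s\<in>b. \<exists>q. p \<otimes> q = q \<and> q \<otimes> p = q \<and> rect q {k \<in> D. ?f k = s} {z \<in> D'. ?f' z = \<tau> s}"
    unfolding im by blast
  have \<tau>b: "\<tau> a \<in> b'" if "a \<in> b" for a using \<tau> that by (auto simp: bij_betw_def)
  have step: "\<exists>\<sigma>. block_iso \<sigma> {k \<in> D. ?f k = a} {z \<in> D'. ?f' z = \<tau> a} \<and> \<sigma> a = \<tau> a \<and> p \<otimes> u (\<tau> a) a \<noteq> \<zero>"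
    if a: "a \<in> b" for a
  proof -
    obtain q where q: "q \<otimes> p = q" and rq: "rect q {k \<in> D. ?f k = a} {z \<in> D'. ?f' z = \<tau> a}"
      using q a by blast
    have aD: "a \<in> D" "a \<in> V" "?f a = a" using a b V G.anchor_self[OF B(1)] by auto
    have xD: "\<tau> a \<in> D'" "\<tau> a \<in> V'" "?f' (\<tau> a) = \<tau> a" using \<tau>b[OF a] b V H.anchor_self[OF B(2)] by auto
    have qc: "q \<in> carrier A" "p \<in> carrier A" using rect_proj[OF rq] rect_proj[OF r] by auto
    have qu: "q \<otimes> u z a = q \<otimes> (p \<otimes> u z a)" if "z \<in> D'" for z
      using q qc V(2)[OF that] aD(2) by (simp flip: m_assoc)
    \<comment> \<open>Nonzero entries in column \<open>a\<close> stay in \<open>b'\<close>, and the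
      only vertex of \<open>b'\<close> anchored at \<open>\<tau> a\<close> is
      \<open>\<tau> a\<close> itself. This produces the root condition that \<open>IH\<close> asks
      for.\<close>
    have "q \<otimes> u z a = \<zero>" if z: "z \<in> D'" "?f' z = \<tau> a" "z \<noteq> \<tau> a" for z
    proof (rule ccontr)
      assume "q \<otimes> u z a \<noteq> \<zero>"
      then have "p \<otimes> u z a \<noteq> \<zero>" using qu[OF z(1)] qc by auto
      then have "z \<in> b'" using inv aD z a by blast
      then show False using H.anchor_self[OF B(2), of z] z by simp
    qed
    then have "(\<Oplus>z\<in>{z \<in> D'. ?f' z = \<tau> a}. q \<otimes> u z a) = q \<otimes> u (\<tau> a) a"
      using V xD qc aD by (intro finsum_only) auto
    then have root: "q \<otimes> u (\<tau> a) a = q" using rect_column[OF rq, of a] aD by simp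
    then have "p \<otimes> u (\<tau> a) a \<noteq> \<zero>" using qu[OF xD(1)] rect_proj(5)[OF rq] qc by auto
    then show ?thesis using IH[OF a \<tau>b[OF a] rq root] by blast
  qed
  then have "\<exists>\<sigma>. \<forall>a\<in>b. block_iso (\<sigma> a) {k \<in> D. ?f k = a} {z \<in> D'. ?f' z = \<tau> a} \<and>
      \<sigma> a a = \<tau> a \<and> p \<otimes> u (\<tau> a) a \<noteq> \<zero>"
    by (intro bchoice ballI)
  then obtain \<sigma> where \<sigma>: "\<And>a. a \<in> b \<Longrightarrow> block_iso (\<sigma> a) {k \<in> D. ?f k = a} {z \<in> D'. ?f' z = \<tau> a}"
    "\<And>a. a \<in> b \<Longrightarrow> \<sigma> a a = \<tau> a" "\<And>a. a \<in> b \<Longrightarrow> p \<otimes> u (\<tau> a) a \<noteq> \<zero>"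
    by blast
  define \<rho> where "\<rho> k = \<sigma> (?f k) k" for k
  have bij: "bij_betw \<rho> D D'" and lab: "\<And>k. k \<in> D \<Longrightarrow> ?f' (\<rho> k) = \<tau> (?f k)"
    unfolding \<rho>_def
  proof -
    have *: "bij_betw \<tau> (?f ` D) (?f' ` D')"
      "\<And>s. s \<in> ?f ` D \<Longrightarrow> bij_betw (\<sigma> s) {k \<in> D. ?f k = s} {z \<in> D'. ?f' z = \<tau> s}"
      using \<tau> \<sigma>(1) unfolding im block_iso_def by blast+
    show "bij_betw (\<lambda>k. \<sigma> (?f k) k) D D'" by (rule bij_betw_fibres(1)[OF *])
    show "?f' (\<sigma> (?f k) k) = \<tau> (?f k)" if "k \<in> D" for k by (rule bij_betw_fibres(2)[OF * that])
  qed
  have \<rho>b: "\<rho> a = \<tau> a" if "a \<in> b" for a using that G.anchor_self[OF B(1)] \<sigma>(2) by (simp add: \<rho>_def)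
  have \<rho>D: "\<rho> k \<in> D'" "\<rho> k \<in> V'" if "k \<in> D" for k using that bij V by (auto simp: bij_betw_def)
  have fb: "?f k \<in> b" if "k \<in> D" for k using that im by blast
  have \<rho>_inj: "\<rho> k = \<rho> l \<longleftrightarrow> k = l" if "k \<in> D" "l \<in> D" for k l
    using that bij by (auto simp: bij_betw_def dest: inj_onD)
  have same: "G.same_block k l \<longleftrightarrow> H.same_block (\<rho> k) (\<rho> l)" if kl: "k \<in> D" "l \<in> D" for k l
  proof (cases "?f k = ?f l")
    case True
    then show ?thesis using \<sigma>(1)[OF fb[OF kl(1)]] kl unfolding block_iso_def \<rho>_def by auto
  next
    case False
    \<comment> \<open>Between different branches \<open>same_block\<close> forces both vertices into
      the block, and there it always holds; \<open>\<rho>\<close> takes \<open>b\<close> to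
      \<open>b'\<close>.\<close>
    then have ne: "?f' (\<rho> k) \<noteq> ?f' (\<rho> l)"
      using lab kl \<tau> fb by (auto simp: bij_betw_def dest: inj_onD)
    have kfl: "?f k \<in> D" "?f l \<in> D" using fb kl b by auto
    show ?thesis
    proof
      assume "G.same_block k l"
      then have "?f k = k" "?f l = l"
        using G.same_block_across_anchors[OF B(1) V(1)[OF kl(1)] V(1)[OF kl(2)] _ False] by simp_all
      then have "k \<in> b" "l \<in> b" using fb[OF kl(1)] fb[OF kl(2)] by simp_all
      then have "\<rho> k \<in> b'" "\<rho> l \<in> b'" using \<rho>b \<tau>b by auto
      then show "H.same_block (\<rho> k) (\<rho> l)" by (rule H.is_block_pairwise[OF B(2)])
    next
      assume "H.same_block (\<rho> k) (\<rho> l)"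
      then have "?f' (\<rho> k) = \<rho> k" "?f' (\<rho> l) = \<rho> l"
        using H.same_block_across_anchors[OF B(2) \<rho>D(2)[OF kl(1)] \<rho>D(2)[OF kl(2)] _ ne] by simp_all
      then have "\<rho> (?f k) = \<rho> k" "\<rho> (?f l) = \<rho> l"
        using lab[OF kl(1)] lab[OF kl(2)] \<rho>b[OF fb[OF kl(1)]] \<rho>b[OF fb[OF kl(2)]] by simp_all
      then have "?f k = k" "?f l = l" using \<rho>_inj[OF kfl(1) kl(1)] \<rho>_inj[OF kfl(2) kl(2)] by simp_all
      then have "k \<in> b" "l \<in> b" using fb[OF kl(1)] fb[OF kl(2)] by simp_all
      then show "G.same_block k l" by (rule G.is_block_pairwise[OF B(1)])
    qed
  qed
  have "\<exists>p. rect p (G.block_of k l) (H.block_of (\<rho> k) (\<rho> l))"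
    if kl: "k \<in> D" "l \<in> D" "k \<noteq> l" "G.same_block k l" for k l
  proof (cases "?f k = ?f l")
    case True
    then show ?thesis using \<sigma>(1)[OF fb[OF kl(1)]] kl unfolding block_iso_def \<rho>_def by auto
  next
    case False
    then have "?f k = k" "?f l = l"
      using G.same_block_across_anchors[OF B(1) V(1)[OF kl(1)] V(1)[OF kl(2)] kl(4)] by simp_all
    then have klb: "k \<in> b" "l \<in> b" using fb[OF kl(1)] fb[OF kl(2)] by simp_all
    then have "\<rho> k \<in> b'" "\<rho> l \<in> b'" using \<rho>b \<tau>b by simp_all
    moreover have "\<rho> k \<noteq> \<rho> l" using \<rho>_inj[OF kl(1,2)] kl(3) by simp
    ultimately have "b = G.block_of k l" "b' = H.block_of (\<rho> k) (\<rho> l)"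
      using G.is_block_eq_block_of[OF B(1) klb kl(3)] H.is_block_eq_block_of[OF B(2)] by auto
    then show ?thesis using rect_restrict[OF r b inv] by auto
  qed
  then have "block_iso \<rho> D D'" using bij same unfolding block_iso_def by blast
  then show ?thesis using \<rho>b \<sigma>(3) by (intro exI[of _ \<rho>]) auto
qed

end

section \<open>Branches at a root vertex and the rooted recursion\<close>

context fin_conn_graph
begin

text \<open>The component itself serves as the label, so on a closed set the fibre of a label is the
  label, see \<open>component_at_fibre\<close>.\<close>

definition component_at :: "'v \<Rightarrow> 'v \<Rightarrow> 'v set" where
  "component_at r k = {l \<in> V. l \<noteq> r \<and> conn r k l}"

lemma component_at_eq_iff:
  assumes "k \<in> V" "l \<in> V" "k \<noteq> r" "l \<noteq> r"
  shows "component_at r k = component_at r l \<longleftrightarrow> conn r k l"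
proof
  assume "component_at r k = component_at r l"
  then have "l \<in> component_at r k" using assms by (simp add: component_at_def)
  then show "conn r k l" by (simp add: component_at_def)
next
  assume "conn r k l"
  then have "conn r k m \<longleftrightarrow> conn r l m" for m using conn_sym conn_trans by blast
  then show "component_at r k = component_at r l" by (simp add: component_at_def)
qed

lemma component_at_fibre:
  assumes D: "closed_at r D" "D \<subseteq> V" and k: "k \<in> D" "k \<noteq> r"
  shows "{l \<in> D - {r}. component_at r l = component_at r k} = component_at r k"
proof (intro equalityI subsetI)
  fix l assume l: "l \<in> {l \<in> D - {r}. component_at r l = component_at r k}"
  then show "l \<in> component_at r k"
    using component_at_eq_iff[of l k r] D(2) k conn_sym by (auto simp: component_at_def)
next
  fix l assume "l \<in> component_at r k"
  then have l: "l \<in> V" "l \<noteq> r" "conn r k l" by (auto simp: component_at_def)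
  then have "l \<in> D" using D(1) k by (auto simp: closed_at_def)
  then show "l \<in> {l \<in> D - {r}. component_at r l = component_at r k}"
    using component_at_eq_iff[of l k r] D(2) k l conn_sym by auto
qed

text \<open>The block of \<open>r\<close> and a neighbour of \<open>r\<close> in the branch. Its
  description mentions only \<open>r\<close> and the branch, which is what linked entries
  respect.\<close>

lemma block_at_component:
  assumes "r \<in> V" "k \<in> V" "k \<noteq> r"
  obtains b where "is_block b" "r \<in> b" "b = {m \<in> insert r (component_at r k). same_block r m}"
proof -
  obtain a where a: "a \<in> V" "a \<noteq> r" "(r, a) \<in> R" "conn r k a"
    using exists_neighbour_towards assms by blast
  have sb: "same_block r a" using same_block_edge a(3) .
  have "component_at r a = component_at r k"
    using component_at_eq_iff[of a k r] assms a conn_sym by blast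
  then have eq: "block_of r a = {m \<in> insert r (component_at r k). same_block r m}"
    using block_of_at_root[OF assms(1) a(1,2) sb] by (simp add: component_at_def)
  have "is_block (block_of r a)" "r \<in> block_of r a"
    using is_block_block_of[OF assms(1) a(1) a(2)[symmetric] sb] block_of_mem[OF assms(1) a(1) sb] by auto
  then show ?thesis using that eq by blast
qed

end

context quantum_graph_iso
begin

text \<open>Since \<open>q\<close> absorbs \<open>u r' r\<close>, every entry below \<open>q\<close>
  is multiplied by \<open>u r' r\<close> from the left; orthogonality then leaves \<open>r\<close>
  and \<open>r'\<close> as each other's only partners.\<close>

lemma rect_root:
  assumes r: "rect q D D'" and rr: "r \<in> D" "r' \<in> D'" "q \<otimes> u r' r = q"
  shows "z \<in> D' \<Longrightarrow> q \<otimes> u z r \<noteq> \<zero> \<Longrightarrow> z = r'"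
    and "k \<in> D \<Longrightarrow> q \<otimes> u r' k \<noteq> \<zero> \<Longrightarrow> k = r"
    and "\<lbrakk>k \<in> D; z \<in> D'; q \<otimes> u z k \<noteq> \<zero>\<rbrakk> \<Longrightarrow> linked r' r z k"
proof -
  note V = rect_subset[OF r]
  have qc: "q \<in> carrier A" using rect_proj[OF r] by simp
  have *: "q \<otimes> u z k = q \<otimes> (u r' r \<otimes> u z k)" if "k \<in> D" "z \<in> D'" for z k
  proof -
    have "q \<otimes> u z k = (q \<otimes> u r' r) \<otimes> u z k" using rr(3) by simp
    then show ?thesis using V that rr(1,2) qc by (simp add: m_assoc)
  qed
  show "z = r'" if "z \<in> D'" "q \<otimes> u z r \<noteq> \<zero>"
  proof (rule ccontr)
    assume "z \<noteq> r'"
    then have "u r' r \<otimes> u z r = \<zero>"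
      using column_orthogonal V(1)[OF rr(1)] V(2)[OF rr(2)] V(2)[OF that(1)] by auto
    then show False using *[OF rr(1) that(1)] that(2) qc by simp
  qed
  show "k = r" if "k \<in> D" "q \<otimes> u r' k \<noteq> \<zero>"
  proof (rule ccontr)
    assume "k \<noteq> r"
    then have "u r' r \<otimes> u r' k = \<zero>"
      using row_orthogonal V(1)[OF rr(1)] V(2)[OF rr(2)] V(1)[OF that(1)] by auto
    then show False using *[OF that(1) rr(2)] that(2) qc by simp
  qed
  show "linked r' r z k" if "k \<in> D" "z \<in> D'" "q \<otimes> u z k \<noteq> \<zero>"
    using *[OF that(1,2)] that(3) qc by (auto simp: linked_def)
qed

text \<open>The root is put back into a matched pair of components: below \<open>p\<close> the entry
  at the roots is \<open>p\<close>, and the rest of that row and column is zero. Then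
  \<open>block_step\<close> applies to the block through the root, whose anchor fibres are proper
  subsets of \<open>D\<close>.\<close>

lemma rooted_component:
  assumes r: "rect q D D'" and D: "G.closed_at r D" "H.closed_at r' D'" and root: "q \<otimes> u r' r = q"
    and k0: "k0 \<in> D" "k0 \<noteq> r" and z0: "z0 \<in> D'" "z0 \<noteq> r'"
    and p: "p \<otimes> q = p" "rect p (G.component_at r k0) (H.component_at r' z0)"
    and IH: "\<And>p E E' a x. \<lbrakk>E \<subset> D; rect p E E'; G.closed_at a E; H.closed_at x E'; p \<otimes> u x a = p\<rbrakk> \<Longrightarrow>
        \<exists>\<sigma>. block_iso \<sigma> E E' \<and> \<sigma> a = x"
  shows "\<exists>\<sigma>. block_iso \<sigma> (insert r (G.component_at r k0)) (insert r' (H.component_at r' z0)) \<and> \<sigma> r = r'"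
proof -
  let ?C = "G.component_at r k0" and ?C' = "H.component_at r' z0"
  note V = rect_subset[OF r]
  have rD: "r \<in> D" "r' \<in> D'" "r \<in> V" "r' \<in> V'" using D V by (auto simp: G.closed_at_def H.closed_at_def)
  have C: "?C \<subseteq> D" "?C' \<subseteq> D'" "r \<notin> ?C" "r' \<notin> ?C'"
    using D k0 z0 by (auto simp: G.closed_at_def H.closed_at_def G.component_at_def H.component_at_def)
  have CV: "?C \<subseteq> V" "?C' \<subseteq> V'" using C V by auto
  have fin: "finite ?C" "finite ?C'" using C V(3,4) finite_subset by auto
  have c: "p \<in> carrier A" "q \<in> carrier A" "star A p = p" using rect_proj[OF p(2)] rect_proj[OF r] by auto
  have pq: "p \<otimes> u z k = p \<otimes> (q \<otimes> u z k)" if "z \<in> V'" "k \<in> V" for z k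
    using p(1) c that by (simp flip: m_assoc)
  have prr: "p \<otimes> u r' r = p" using pq[OF rD(4,3)] root p(1) by simp
  have pz: "p \<otimes> u z r = \<zero>" if "z \<in> ?C'" for z
  proof -
    have "z \<in> D'" "z \<in> V'" "z \<noteq> r'" using that C CV by auto
    then have "q \<otimes> u z r = \<zero>" using rect_root(1)[OF r rD(1,2) root, of z] by blast
    then show ?thesis using pq[OF \<open>z \<in> V'\<close> rD(3)] c by simp
  qed
  have pk: "p \<otimes> u r' k = \<zero>" if "k \<in> ?C" for k
  proof -
    have "k \<in> D" "k \<in> V" "k \<noteq> r" using that C CV by auto
    then have "q \<otimes> u r' k = \<zero>" using rect_root(2)[OF r rD(1,2) root, of k] by blast
    then show ?thesis using pq[OF rD(4) \<open>k \<in> V\<close>] c by simp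
  qed
  \<comment> \<open>When the product is \<open>p\<close> or zero it is self-adjoint, and its adjoint
    is the product in the other order.\<close>
  have comm: "u z k \<otimes> p = p \<otimes> u z k" if "p \<otimes> u z k = p \<or> p \<otimes> u z k = \<zero>" "z \<in> V'" "k \<in> V" for z k
  proof -
    have "u z k \<otimes> p = star A (p \<otimes> u z k)" using c that by (simp add: star_mult entry_star)
    then show ?thesis using that(1) c by auto
  qed
  have rp: "rect p (insert r ?C) (insert r' ?C')"
    unfolding rect_def
  proof (intro conjI ballI)
    show "insert r ?C \<subseteq> V" "insert r' ?C' \<subseteq> V'" using CV rD by auto
    show "p \<otimes> u z k = u z k \<otimes> p" if "k \<in> insert r ?C" "z \<in> insert r' ?C'" for k z
    proof (cases "k \<in> ?C \<and> z \<in> ?C'")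
      case True
      then show ?thesis using rect_commute[OF p(2)] by simp
    next
      case False
      then have "p \<otimes> u z k = p \<or> p \<otimes> u z k = \<zero>" using that prr pz pk by auto
      moreover have "z \<in> V'" "k \<in> V" using that CV rD by auto
      ultimately show ?thesis using comm by simp
    qed
    show "(\<Oplus>z\<in>insert r' ?C'. p \<otimes> u z k) = p" if "k \<in> insert r ?C" for k
    proof -
      have kV: "k \<in> V" using that CV rD by auto
      have "(\<Oplus>z\<in>insert r' ?C'. p \<otimes> u z k) = p \<otimes> u r' k \<oplus> (\<Oplus>z\<in>?C'. p \<otimes> u z k)"
        using fin C CV rD c kV by (intro finsum_insert) auto
      also have "\<dots> = p"
      proof (cases "k = r")
        case True
        then have "(\<Oplus>z\<in>?C'. p \<otimes> u z k) = \<zero>" using pz by (intro add.finprod_one_eqI) auto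
        then show ?thesis using True prr c by simp
      next
        case False
        then show ?thesis using that pk rect_column[OF p(2)] c by auto
      qed
      finally show ?thesis .
    qed
    show "(\<Oplus>k\<in>insert r ?C. p \<otimes> u z k) = p" if "z \<in> insert r' ?C'" for z
    proof -
      have zV: "z \<in> V'" using that CV rD by auto
      have "(\<Oplus>k\<in>insert r ?C. p \<otimes> u z k) = p \<otimes> u z r \<oplus> (\<Oplus>k\<in>?C. p \<otimes> u z k)"
        using fin C CV rD c zV by (intro finsum_insert) auto
      also have "\<dots> = p"
      proof (cases "z = r'")
        case True
        then have "(\<Oplus>k\<in>?C. p \<otimes> u z k) = \<zero>" using pk by (intro add.finprod_one_eqI) auto
        then show ?thesis using True prr c by simp
      next
        case False
        then show ?thesis using that pz rect_row[OF p(2)] c by auto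
      qed
      finally show ?thesis .
    qed
  qed (use rect_proj[OF p(2)] in auto)
  have k0V: "k0 \<in> V" "z0 \<in> V'" using k0 z0 V by auto
  obtain b where b: "G.is_block b" "r \<in> b" "b = {m \<in> insert r ?C. G.same_block r m}"
    by (rule G.block_at_component[OF rD(3) k0V(1) k0(2)])
  obtain b' where b': "H.is_block b'" "r' \<in> b'" "b' = {m \<in> insert r' ?C'. H.same_block r' m}"
    by (rule H.block_at_component[OF rD(4) k0V(2) z0(2)])
  have bC: "b \<subseteq> insert r ?C" "b' \<subseteq> insert r' ?C'" using b(3) b'(3) by blast+
  have "\<exists>\<sigma>. block_iso \<sigma> (insert r ?C) (insert r' ?C') \<and> (\<forall>a\<in>b. p \<otimes> u (\<sigma> a) a \<noteq> \<zero>)"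
  proof (rule block_step[OF rp b(1) b'(1) bC])
    fix k z assume kz: "k \<in> insert r ?C" "z \<in> insert r' ?C'" "p \<otimes> u z k \<noteq> \<zero>"
    have "linked r' r z k" using rect_root(3)[OF rp _ _ prr kz] by simp
    moreover have "k \<in> V" "z \<in> V'" using kz CV rD by auto
    ultimately have "G.same_block r k \<longleftrightarrow> H.same_block r' z" using linked_same_block rD by blast
    then show "k \<in> b \<longleftrightarrow> z \<in> b'" using b(3) b'(3) kz by blast
  next
    fix a x p'
    let ?E = "{k \<in> insert r ?C. G.anchor b k = a}" and ?E' = "{z \<in> insert r' ?C'. H.anchor b' z = x}"
    assume a: "a \<in> b" and x: "x \<in> b'" and rq: "rect p' ?E ?E'" and "p' \<otimes> u x a = p'"
    moreover have "?E \<subset> D"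
      using G.anchor_fibre_psubset[OF b(1) bC(1) a] C rD by blast
    moreover have "G.closed_at a ?E"
      by (rule G.anchor_fibre_closed[OF b(1,2) CV(1) _ bC(1) a])
        (auto simp: G.component_at_def intro: G.conn_trans dest: G.conn_neq)
    moreover have "H.closed_at x ?E'"
      by (rule H.anchor_fibre_closed[OF b'(1,2) CV(2) _ bC(2) x])
        (auto simp: H.component_at_def intro: H.conn_trans dest: H.conn_neq)
    ultimately show "\<exists>\<sigma>. block_iso \<sigma> ?E ?E' \<and> \<sigma> a = x" using IH by blast
  qed
  then obtain \<sigma> where \<sigma>: "block_iso \<sigma> (insert r ?C) (insert r' ?C')" "\<forall>a\<in>b. p \<otimes> u (\<sigma> a) a \<noteq> \<zero>" by blast
  have "\<sigma> r \<in> insert r' ?C'" using \<sigma>(1) by (auto simp: block_iso_def bij_betw_def)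
  then have "\<sigma> r = r'" using rect_root(1)[OF rp _ _ prr, of "\<sigma> r"] \<sigma>(2) b(2) by simp
  then show ?thesis using \<sigma>(1) by blast
qed

text \<open>Two kinds of descent alternate: at a vertex into the components of its complement, at a
  block into its anchor fibres. Both kinds of pieces, with the vertex at which they hang, are closed
  at that vertex.\<close>

lemma rooted_block_iso:
  assumes "rect q D D'" "G.closed_at r D" "H.closed_at r' D'" "q \<otimes> u r' r = q"
  shows "\<exists>\<sigma>. block_iso \<sigma> D D' \<and> \<sigma> r = r'"
  using assms
proof (induction "card D" arbitrary: q D D' r r' rule: less_induct)
  case less
  note r = less.prems(1) and D = less.prems(2,3) and root = less.prems(4)
  note V = rect_subset[OF r]
  have rD: "r \<in> D" "r' \<in> D'" "r \<in> V" "r' \<in> V'" using D V by (auto simp: G.closed_at_def H.closed_at_def)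
  have DV: "D \<subseteq> V" "D' \<subseteq> V'" using V by auto
  have IH: "\<exists>\<sigma>. block_iso \<sigma> E E' \<and> \<sigma> a = x"
    if "E \<subset> D" "rect p E E'" "G.closed_at a E" "H.closed_at x E'" "p \<otimes> u x a = p" for p E E' a x
    using less.hyps[OF psubset_card_mono[OF V(3) that(1)] that(2-5)] .
  let ?D = "D - {r}" and ?D' = "D' - {r'}"
  let ?f = "G.component_at r" and ?f' = "H.component_at r'"
  have r0: "rect q ?D ?D'"
  proof (rule rect_restrict[OF r])
    fix k z assume "k \<in> D" "z \<in> D'" "q \<otimes> u z k \<noteq> \<zero>"
    then show "k \<in> ?D \<longleftrightarrow> z \<in> ?D'"
      using rect_root(1,2)[OF r rD(1,2) root] by auto
  qed auto
  have "\<exists>\<tau>. bij_betw \<tau> (?f ` ?D) (?f' ` ?D') \<and>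
    (\<forall>s\<in>?f ` ?D. \<exists>p. q \<otimes> p = p \<and> p \<otimes> q = p \<and> rect p {k \<in> ?D. ?f k = s} {z \<in> ?D'. ?f' z = \<tau> s})"
  proof (rule rect_labels[OF r0])
    fix k l z y assume kl: "k \<in> ?D" "l \<in> ?D" "z \<in> ?D'" "y \<in> ?D'" and nz: "q \<otimes> u z k \<otimes> u y l \<noteq> \<zero>"
    have m: "k \<in> D" "l \<in> D" "z \<in> D'" "y \<in> D'" and ne: "k \<noteq> r" "l \<noteq> r" "z \<noteq> r'" "y \<noteq> r'" using kl by auto
    \<comment> \<open>Inserting the root supplies the three links needed to compare separation by
      \<open>r\<close> with separation by \<open>r'\<close>, since the partner of the root is forced
      to be \<open>r'\<close>.\<close>
    obtain w where w: "w \<in> D'" "q \<otimes> u z k \<otimes> u w r \<noteq> \<zero>" "q \<otimes> u w r \<otimes> u y l \<noteq> \<zero>"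
      by (rule rect_insert[OF r m(1,3,2,4) rD(1) nz])
    have "w = r'"
      using rect_root(1)[OF r rD(1,2) root w(1)] rect_entry_nonzero(1)[OF r rD(1) w(1) m(2,4) w(3)] by blast
    then have l: "linked z k r' r" "linked r' r y l" "linked z k y l"
      using rect_linked[OF r m(1,3) rD(1) w(1,2)] rect_linked[OF r rD(1) w(1) m(2,4) w(3)]
        rect_linked[OF r m(1,3,2,4) nz] by auto
    have VV: "z \<in> V'" "y \<in> V'" "k \<in> V" "l \<in> V" using m DV by auto
    have "G.conn r k l \<longleftrightarrow> H.conn r' z y"
      using linked_conn[OF VV(1,2) rD(4) VV(3,4) rD(3) l(3,1,2) ne(2)] .
    then show "?f k = ?f l \<longleftrightarrow> ?f' z = ?f' y"
      using G.component_at_eq_iff[OF VV(3,4) ne(1,2)] H.component_at_eq_iff[OF VV(1,2) ne(3,4)] by simp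
  qed
  then obtain \<tau> where \<tau>: "bij_betw \<tau> (?f ` ?D) (?f' ` ?D')"
    and p: "\<forall>s\<in>?f ` ?D. \<exists>p. q \<otimes> p = p \<and> p \<otimes> q = p \<and>
        rect p {k \<in> ?D. ?f k = s} {z \<in> ?D'. ?f' z = \<tau> s}" by blast
  have fib: "{k \<in> ?D. ?f k = s} = s" if s: "s \<in> ?f ` ?D" for s
  proof -
    obtain k where k: "k \<in> D" "k \<noteq> r" "s = ?f k" using s by auto
    show ?thesis unfolding k(3) by (rule G.component_at_fibre[OF D(1) DV(1) k(1,2)])
  qed
  have fib': "{z \<in> ?D'. ?f' z = t} = t" if t: "t \<in> ?f' ` ?D'" for t
  proof -
    obtain k where k: "k \<in> D'" "k \<noteq> r'" "t = ?f' k" using t by auto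
    show ?thesis unfolding k(3) by (rule H.component_at_fibre[OF D(2) DV(2) k(1,2)])
  qed
  have \<tau>im: "\<tau> s \<in> ?f' ` ?D'" if "s \<in> ?f ` ?D" for s using \<tau> that by (auto simp: bij_betw_def)
  have "\<forall>s\<in>?f ` ?D. \<exists>\<sigma>. block_iso \<sigma> (insert r s) (insert r' (\<tau> s)) \<and> \<sigma> r = r'"
  proof
    fix s assume s: "s \<in> ?f ` ?D"
    obtain k0 where k0: "k0 \<in> D" "k0 \<noteq> r" "s = ?f k0" using s by auto
    obtain z0 where z0: "z0 \<in> D'" "z0 \<noteq> r'" "\<tau> s = ?f' z0" using \<tau>im[OF s] by auto
    obtain p where pq: "p \<otimes> q = p" and "rect p {k \<in> ?D. ?f k = s} {z \<in> ?D'. ?f' z = \<tau> s}"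
      using p s by blast
    then have "rect p (?f k0) (?f' z0)"
      unfolding fib[OF s] fib'[OF \<tau>im[OF s]] by (simp only: k0(3)[symmetric] z0(3)[symmetric])
    then show "\<exists>\<sigma>. block_iso \<sigma> (insert r s) (insert r' (\<tau> s)) \<and> \<sigma> r = r'"
      using rooted_component[OF r D root k0(1,2) z0(1,2) pq _ IH] by (simp only: k0(3)[symmetric] z0(3)[symmetric])
  qed
  then have "\<exists>\<sigma>. \<forall>s\<in>?f ` ?D. block_iso (\<sigma> s) (insert r s) (insert r' (\<tau> s)) \<and> \<sigma> s r = r'"
    by (rule bchoice)
  then obtain \<sigma> where \<sigma>: "\<And>s. s \<in> ?f ` ?D \<Longrightarrow> block_iso (\<sigma> s) (insert r s) (insert r' (\<tau> s))"
    "\<And>s. s \<in> ?f ` ?D \<Longrightarrow> \<sigma> s r = r'" by blast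
  have notin: "r \<notin> s" "r' \<notin> \<tau> s" if "s \<in> ?f ` ?D" for s
    using that \<tau>im[OF that] by (auto simp: G.component_at_def H.component_at_def)
  have bij_s: "bij_betw (\<sigma> s) {k \<in> ?D. ?f k = s} {z \<in> ?D'. ?f' z = \<tau> s}" if s: "s \<in> ?f ` ?D" for s
  proof -
    have "bij_betw (\<sigma> s) (insert r s) (insert r' (\<tau> s))" using \<sigma>(1)[OF s] by (simp add: block_iso_def)
    then have "bij_betw (\<sigma> s) (insert r s - {r}) (insert r' (\<tau> s) - {r'})"
      using \<sigma>(2)[OF s] by (intro bij_betw_DiffI) auto
    then show ?thesis unfolding fib[OF s] fib'[OF \<tau>im[OF s]] using notin[OF s] by simp
  qed
  define \<rho>0 where "\<rho>0 k = \<sigma> (?f k) k" for k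
  define \<rho> where "\<rho> k = (if k = r then r' else \<rho>0 k)" for k
  have bij0: "bij_betw \<rho>0 ?D ?D'" and lab0: "\<And>k. k \<in> ?D \<Longrightarrow> ?f' (\<rho>0 k) = \<tau> (?f k)"
    unfolding \<rho>0_def using bij_betw_fibres[OF \<tau> bij_s] by auto
  have bij: "bij_betw \<rho> D D'"
  proof -
    have "bij_betw \<rho> ?D ?D'" using bij0 bij_betw_cong[of ?D \<rho> \<rho>0 ?D'] by (simp add: \<rho>_def)
    moreover have "bij_betw \<rho> {r} {r'}" by (simp add: \<rho>_def bij_betw_def)
    ultimately have "bij_betw \<rho> ({r} \<union> ?D) ({r'} \<union> ?D')" by (intro bij_betw_combine) auto
    then show ?thesis using rD by (simp add: insert_absorb)
  qed
  have \<rho>_eq: "\<rho> m = \<sigma> s m" if s: "s \<in> ?f ` ?D" and m: "m \<in> insert r s" for s m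
  proof (cases "m = r")
    case True
    then show ?thesis using \<sigma>(2)[OF s] by (simp add: \<rho>_def)
  next
    case False
    then have "m \<in> {k \<in> ?D. ?f k = s}" using m fib[OF s] by simp
    then show ?thesis using False by (simp add: \<rho>_def \<rho>0_def)
  qed
  have local: "(G.same_block k l \<longleftrightarrow> H.same_block (\<rho> k) (\<rho> l)) \<and>
      (k \<noteq> l \<and> G.same_block k l \<longrightarrow> (\<exists>p. rect p (G.block_of k l) (H.block_of (\<rho> k) (\<rho> l))))"
    if s: "s \<in> ?f ` ?D" and "k \<in> insert r s" "l \<in> insert r s" for s k l
    using \<sigma>(1)[OF s] that(2,3) unfolding block_iso_def \<rho>_eq[OF s that(2)] \<rho>_eq[OF s that(3)] by blast
  have main: "(G.same_block k l \<longleftrightarrow> H.same_block (\<rho> k) (\<rho> l)) \<and>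
      (k \<noteq> l \<and> G.same_block k l \<longrightarrow> (\<exists>p. rect p (G.block_of k l) (H.block_of (\<rho> k) (\<rho> l))))"
    if kl: "k \<in> D" "l \<in> D" for k l
  proof -
    have self: "m \<in> ?f m" "?f m \<in> ?f ` ?D" if "m \<in> D" "m \<noteq> r" for m
      using that DV by (auto simp: G.component_at_def)
    consider "k = r" "l = r" | "k \<noteq> r" "l = r" | "k = r" "l \<noteq> r" | "k \<noteq> r" "l \<noteq> r" "?f k = ?f l"
      | "k \<noteq> r" "l \<noteq> r" "?f k \<noteq> ?f l" by blast
    then show ?thesis
    proof cases
      case 1
      then show ?thesis by simp
    next
      case 2
      then show ?thesis using local[OF self(2)[OF kl(1)]] self(1)[OF kl(1)] by simp
    next
      case 3
      then show ?thesis using local[OF self(2)[OF kl(2)]] self(1)[OF kl(2)] by simp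
    next
      case 4
      then show ?thesis using local[OF self(2)[OF kl(1)], of k l] self(1)[OF kl(1)] self(1)[OF kl(2)] by simp
    next
      case 5
      have "\<tau> (?f k) \<noteq> \<tau> (?f l)"
        using \<tau> 5 kl by (auto simp: bij_betw_def dest: inj_onD)
      then have "?f' (\<rho> k) \<noteq> ?f' (\<rho> l)" using lab0 kl 5 by (simp add: \<rho>_def)
      moreover have "\<rho> k \<in> ?D'" "\<rho> l \<in> ?D'" using bij0 kl 5 by (auto simp: \<rho>_def bij_betw_def)
      ultimately have "\<not> H.conn r' (\<rho> k) (\<rho> l)"
        using H.component_at_eq_iff[of "\<rho> k" "\<rho> l" r'] DV by auto
      moreover have "\<not> G.conn r k l" using G.component_at_eq_iff[of k l r] 5 kl DV by auto
      ultimately have "\<not> G.same_block k l" "\<not> H.same_block (\<rho> k) (\<rho> l)"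
        using G.same_block_conn[of k l r] H.same_block_conn[of "\<rho> k" "\<rho> l" r'] 5 rD
          \<open>\<rho> k \<in> ?D'\<close> \<open>\<rho> l \<in> ?D'\<close> by auto
      then show ?thesis by blast
    qed
  qed
  have "block_iso \<rho> D D'" unfolding block_iso_def using bij main by blast
  moreover have "\<rho> r = r'" by (simp add: \<rho>_def)
  ultimately show ?case by blast
qed

end

section \<open>Eccentricity and the centre\<close>

context fin_conn_graph
begin

text \<open>Distance at most \<open>n\<close>, phrased through walk counts because these are
  preserved along links.\<close>

definition reach_le :: "nat \<Rightarrow> 'v \<Rightarrow> 'v \<Rightarrow> bool" where
  "reach_le n a b \<longleftrightarrow> (\<exists>m\<le>n. walks V R m a b > 0)"

definition ecc :: "'v \<Rightarrow> nat" where
  "ecc a = (LEAST n. \<forall>b\<in>V. reach_le n a b)"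

definition center :: "'v set" where
  "center = {a \<in> V. \<forall>b\<in>V. ecc a \<le> ecc b}"

lemma walks_exist:
  assumes "a \<in> V" "b \<in> V"
  shows "\<exists>n. walks V R n a b > 0"
  using connected[OF assms]
proof (induction rule: converse_rtrancl_induct)
  case base
  have "walks V R 0 b b > 0" by simp
  then show ?case by blast
next
  case (step a c)
  then obtain n where n: "walks V R n c b > 0" by blast
  have "c \<in> {c. c \<in> V \<and> (a, c) \<in> R}" "finite {c. c \<in> V \<and> (a, c) \<in> R}"
    using step(1) edges fin by auto
  then have "(\<Sum>c | c \<in> V \<and> (a, c) \<in> R. walks V R n c b) > 0"
    using n by (metis (no_types, lifting) not_gr_zero sum_eq_0_iff)
  then have "walks V R (Suc n) a b > 0" by simp
  then show ?case by blast
qed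

lemma reach_le_ecc:
  assumes "a \<in> V" "b \<in> V"
  shows "reach_le (ecc a) a b"
proof -
  have "\<forall>b\<in>V. \<exists>n. walks V R n a b > 0" using walks_exist assms(1) by blast
  then obtain f where f: "\<forall>b\<in>V. walks V R (f b) a b > 0" by (auto dest: bchoice)
  have "reach_le (Max (f ` V)) a b" if "b \<in> V" for b
    using that f fin unfolding reach_le_def by (intro exI[of _ "f b"]) auto
  then have "\<forall>b\<in>V. reach_le (Max (f ` V)) a b" by blast
  then have "\<forall>b\<in>V. reach_le (ecc a) a b" unfolding ecc_def by (rule LeastI)
  then show ?thesis using assms(2) by blast
qed

lemma farthest:
  assumes "v \<in> V" "c \<in> V" "c \<noteq> v"
  obtains w where "w \<in> V" "\<And>m. m < ecc v \<Longrightarrow> walks V R m v w = 0"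
proof -
  \<comment> \<open>The second vertex \<open>c\<close> makes the eccentricity positive, so that
    minimality may be applied to its predecessor.\<close>
  have pos: "ecc v > 0"
  proof (rule ccontr)
    assume "\<not> ecc v > 0"
    then have "reach_le 0 v c" using reach_le_ecc[OF assms(1,2)] by simp
    then show False using assms(3) by (simp add: reach_le_def split: if_splits)
  qed
  then have "ecc v - 1 < (LEAST n. \<forall>b\<in>V. reach_le n v b)" by (simp add: ecc_def)
  then have "\<not> (\<forall>b\<in>V. reach_le (ecc v - 1) v b)" by (rule not_less_Least)
  then obtain w where w: "w \<in> V" "\<not> reach_le (ecc v - 1) v w" by blast
  have "walks V R m v w = 0" if "m < ecc v" for m
    using w(2) that unfolding reach_le_def by auto
  then show ?thesis using that w(1) by blast
qed

text \<open>A walk from \<open>c\<close> to \<open>w\<close> of length at most \<open>ecc c\<close>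
  would have to pass through \<open>v\<close> after at least one step; the part from
  \<open>v\<close> to \<open>w\<close> is then shorter than \<open>ecc v\<close>, against the choice
  of \<open>w\<close>.\<close>

lemma center_conn_farthest:
  assumes "c \<in> center" "v \<in> V" "c \<noteq> v" "w \<in> V"
    and far: "\<And>m. m < ecc v \<Longrightarrow> walks V R m v w = 0"
  shows "conn v c w"
proof (rule ccontr)
  assume nc: "\<not> conn v c w"
  have c: "c \<in> V" "ecc c \<le> ecc v" using assms by (auto simp: center_def)
  obtain m where m: "m \<le> ecc c" "walks V R m c w > 0"
    using reach_le_ecc[OF c(1) assms(4)] by (auto simp: reach_le_def)
  have "avoiding_walks V R v m c w = 0"
    using nc avoiding_walks_imp_conn[of V R v m c w] by auto
  then have "(\<Sum>k\<le>m. first_passages V R k c v * walks V R (m - k) v w) > 0"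
    using m(2) walks_decomp[of V R m c w v] by simp
  then obtain k where k: "k \<le> m" "first_passages V R k c v * walks V R (m - k) v w > 0"
    by (metis (no_types, lifting) atMost_iff not_gr_zero sum.neutral)
  then have "k \<noteq> 0" using assms(3) by (cases k) auto
  then have "m - k < ecc v" using k(1) m(1) c(2) by linarith
  then show False using far k(2) by simp
qed

text \<open>The centre of a connected graph lies in a single block: a farthest vertex from a separating
  vertex \<open>v\<close> would be farther from a central vertex on the other side of \<open>v\<close>.\<close>

lemma center_same_block:
  assumes "c \<in> center" "d \<in> center"
  shows "same_block c d"
  unfolding same_block_def
proof (intro ballI impI)
  fix v assume v: "v \<in> V" "v \<noteq> c \<and> v \<noteq> d"
  have "c \<in> V" using assms(1) by (simp add: center_def)
  then obtain w where w: "w \<in> V" "\<And>m. m < ecc v \<Longrightarrow> walks V R m v w = 0"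
    using farthest[of v c] v by auto
  have "conn v c w" "conn v d w"
    using center_conn_farthest[OF _ v(1) _ w] assms v by auto
  then show "conn v c d" using conn_sym conn_trans by blast
qed

lemma center_nonempty: "V \<noteq> {} \<Longrightarrow> center \<noteq> {}"
proof -
  assume "V \<noteq> {}"
  then obtain a where "a \<in> V" by blast
  then obtain b where "b \<in> V" "\<forall>c. c \<in> V \<longrightarrow> ecc b \<le> ecc c"
    using ex_has_least_nat[of "\<lambda>b. b \<in> V" a ecc] by blast
  then show ?thesis by (auto simp: center_def)
qed

text \<open>The second description depends on the centre alone and not on \<open>c\<close> and
  \<open>d\<close>, so the entries of \<open>u\<close> can be shown to respect it.\<close>

lemma center_block:
  assumes "c \<in> center" "d \<in> center" "c \<noteq> d"
  shows "is_block (block_of c d)" "block_of c d = {m \<in> V. \<forall>z\<in>center. same_block m z}"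
proof -
  have V: "c \<in> V" "d \<in> V" using assms by (auto simp: center_def)
  show B: "is_block (block_of c d)"
    by (rule is_block_block_of[OF V assms(3) center_same_block[OF assms(1,2)]])
  have Z: "z \<in> block_of c d" if "z \<in> center" for z
    using that center_same_block assms by (simp add: block_of_def center_def)
  show "block_of c d = {m \<in> V. \<forall>z\<in>center. same_block m z}"
  proof (intro equalityI subsetI)
    fix m assume m: "m \<in> block_of c d"
    then have "m \<in> V" by (simp add: block_of_def)
    moreover have "\<forall>z\<in>center. same_block m z" using is_block_pairwise[OF B m Z] by blast
    ultimately show "m \<in> {m \<in> V. \<forall>z\<in>center. same_block m z}" by simp
  next
    fix m assume "m \<in> {m \<in> V. \<forall>z\<in>center. same_block m z}"
    then show "m \<in> block_of c d" using assms(1,2) by (simp add: block_of_def)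
  qed
qed

end

context quantum_graph_iso
begin

lemma entry_in_row:
  assumes "x \<in> V'"
  obtains a where "a \<in> V" "u x a \<noteq> \<zero>"
proof (rule finsum_neq_zeroE[of "u x" V])
  show "(\<Oplus>a\<in>V. u x a) \<noteq> \<zero>" using row_sum[OF assms] one_neq_zero by simp
qed (rule that)

lemma linked_insert_row:
  assumes "x \<in> V'" "y \<in> V'" "a \<in> V" "b \<in> V" "linked x a y b" "t \<in> V'"
  obtains c where "c \<in> V" "linked x a t c" "linked t c y b"
proof -
  interpret T: quantum_graph_iso A V' R' V R "\<lambda>a x. u x a" by (rule transpose)
  show ?thesis
    using T.linked_insert[of a b x y t] assms that by (auto simp: T.linked_def linked_def)
qed

text \<open>Inserting a row or column sum gives each vertex on one side a partner with the same walk
  counts on the other.\<close>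

lemma entry_same_ecc:
  assumes "x \<in> V'" "a \<in> V" "u x a \<noteq> \<zero>"
  shows "G.ecc a = H.ecc x"
proof -
  have l: "linked x a x a" by (rule linked_column[OF assms])
  have "(\<forall>b\<in>V. G.reach_le n a b) \<longleftrightarrow> (\<forall>y\<in>V'. H.reach_le n x y)" for n
  proof (intro iffI ballI)
    fix y assume y: "y \<in> V'" and G: "\<forall>b\<in>V. G.reach_le n a b"
    obtain b where b: "b \<in> V" "linked x a y b"
      by (rule linked_insert_row[OF assms(1,1,2,2) l y])
    have "G.reach_le n a b" using G b(1) by blast
    then show "H.reach_le n x y"
      by (simp add: G.reach_le_def H.reach_le_def linked_walks[OF assms(1) y assms(2) b])
  next
    fix b assume b: "b \<in> V" and H: "\<forall>y\<in>V'. H.reach_le n x y"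
    obtain y where y: "y \<in> V'" "linked x a y b"
      by (rule linked_insert[OF assms(1,1,2,2) l b])
    have "H.reach_le n x y" using H y(1) by blast
    then show "G.reach_le n a b"
      by (simp add: G.reach_le_def H.reach_le_def linked_walks[OF assms(1) y(1) assms(2) b y(2)])
  qed
  then show ?thesis by (simp add: G.ecc_def H.ecc_def)
qed

lemma entry_center_imp:
  assumes "x \<in> V'" "a \<in> V" "u x a \<noteq> \<zero>" "a \<in> G.center"
  shows "x \<in> H.center"
proof -
  have "H.ecc x \<le> H.ecc y" if y: "y \<in> V'" for y
  proof -
    obtain b where "b \<in> V" "u y b \<noteq> \<zero>" by (rule entry_in_row[OF y])
    then show ?thesis
      using entry_same_ecc[OF assms(1-3)] entry_same_ecc[OF y] assms(4) by (auto simp: G.center_def)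
  qed
  then show ?thesis using assms(1) by (simp add: H.center_def)
qed

lemma entry_center:
  assumes "x \<in> V'" "a \<in> V" "u x a \<noteq> \<zero>"
  shows "a \<in> G.center \<longleftrightarrow> x \<in> H.center"
proof
  interpret T: quantum_graph_iso A V' R' V R "\<lambda>a x. u x a" by (rule transpose)
  show "a \<in> G.center" if "x \<in> H.center" using T.entry_center_imp[of a x] that assms by simp
qed (rule entry_center_imp[OF assms])

lemma entry_center_block_imp:
  assumes "x \<in> V'" "a \<in> V" "u x a \<noteq> \<zero>" "\<forall>z\<in>G.center. G.same_block a z"
  shows "\<forall>z\<in>H.center. H.same_block x z"
proof
  fix y assume y: "y \<in> H.center"
  then have yV: "y \<in> V'" by (simp add: H.center_def)
  obtain b where b: "b \<in> V" "linked x a y b"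
    by (rule linked_insert_row[OF assms(1,1,2,2) linked_column[OF assms(1-3)] yV])
  then have "u y b \<noteq> \<zero>" using assms(1,2) by (auto simp: linked_def)
  then have "b \<in> G.center" using entry_center[OF yV b(1)] y by simp
  then show "H.same_block x y" using linked_same_block[OF assms(1) yV assms(2) b] assms(4) by blast
qed

lemma entry_center_block:
  assumes "x \<in> V'" "a \<in> V" "u x a \<noteq> \<zero>"
  shows "(\<forall>z\<in>G.center. G.same_block a z) \<longleftrightarrow> (\<forall>z\<in>H.center. H.same_block x z)"
proof
  interpret T: quantum_graph_iso A V' R' V R "\<lambda>a x. u x a" by (rule transpose)
  show "\<forall>z\<in>G.center. G.same_block a z" if "\<forall>z\<in>H.center. H.same_block x z"
    using T.entry_center_block_imp[of a x] that assms by simp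
qed (rule entry_center_block_imp[OF assms])

lemma center_two_imp:
  assumes "c \<in> G.center" "d \<in> G.center" "c \<noteq> d"
  shows "\<exists>x\<in>H.center. \<exists>y\<in>H.center. x \<noteq> y"
proof -
  interpret T: quantum_graph_iso A V' R' V R "\<lambda>a x. u x a" by (rule transpose)
  have V: "c \<in> V" "d \<in> V" using assms by (auto simp: G.center_def)
  obtain x where x: "x \<in> V'" "u x c \<noteq> \<zero>" by (rule T.entry_in_row[OF V(1)])
  obtain y where y: "y \<in> V'" "linked x c y d"
    by (rule linked_insert[OF x(1,1) V(1,1) linked_column[OF x(1) V(1) x(2)] V(2)])
  have "u y d \<noteq> \<zero>" using y x(1) V by (auto simp: linked_def)
  then have "x \<in> H.center" "y \<in> H.center" using entry_center x y V assms by auto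
  moreover have "x \<noteq> y" using linked_eq_iff[OF x(1) y(1) V y(2)] assms(3) by simp
  ultimately show ?thesis by blast
qed

text \<open>The root is the central vertex if there is only one, and otherwise the block that
  contains the centre.\<close>

theorem exists_block_iso:
  assumes "V \<noteq> {}"
  shows "\<exists>\<sigma>. block_iso \<sigma> V V'"
proof -
  interpret T: quantum_graph_iso A V' R' V R "\<lambda>a x. u x a" by (rule transpose)
  obtain c where c: "c \<in> G.center" "c \<in> V" using G.center_nonempty[OF assms] by (auto simp: G.center_def)
  obtain x where x: "x \<in> V'" "u x c \<noteq> \<zero>" by (rule T.entry_in_row[OF c(2)])
  have xc: "x \<in> H.center" using entry_center[OF x(1) c(2) x(2)] c(1) by simp
  show ?thesis
  proof (cases "\<exists>d\<in>G.center. d \<noteq> c")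
    case False
    have only: "y = x" if "y \<in> H.center" for y
    proof (rule ccontr)
      assume "y \<noteq> x"
      then have "\<exists>a\<in>G.center. \<exists>b\<in>G.center. a \<noteq> b" using T.center_two_imp[OF that xc] by simp
      then show False using False by metis
    qed
    \<comment> \<open>Column \<open>c\<close> is supported on the centre of the second graph, here
      only \<open>x\<close>. Hence \<open>u x c\<close> is one, which is the root condition for the
      projection one.\<close>
    have "u z c = \<zero>" if "z \<in> V' - {x}" for z
      using that only entry_center[of z c] c by auto
    then have "(\<Oplus>z\<in>V'. u z c) = u x c" using x c H.fin by (intro finsum_only) auto
    then have "\<one> \<otimes> u x c = \<one>" using column_sum[OF c(2)] entry_idem[OF x(1) c(2)] by simp
    moreover have "G.closed_at c V" "H.closed_at x V'"
      using c(2) x(1) by (auto simp: G.closed_at_def H.closed_at_def)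
    ultimately show ?thesis using rooted_block_iso[OF rect_full] by blast
  next
    case True
    then obtain d where d: "d \<in> G.center" "d \<noteq> c" by blast
    obtain y z where yz: "y \<in> H.center" "z \<in> H.center" "y \<noteq> z"
      using center_two_imp[OF d(1) c(1) d(2)] by blast
    define b where "b = G.block_of c d"
    define b' where "b' = H.block_of y z"
    have b: "G.is_block b" "b = {m \<in> V. \<forall>z\<in>G.center. G.same_block m z}"
      unfolding b_def using G.center_block[OF c(1) d(1) d(2)[symmetric]] .
    have b': "H.is_block b'" "b' = {m \<in> V'. \<forall>z\<in>H.center. H.same_block m z}"
      unfolding b'_def using H.center_block[OF yz] .
    have bV: "b \<subseteq> V" "b' \<subseteq> V'" using G.is_block_subset[OF b(1)] H.is_block_subset[OF b'(1)] .
    obtain a0 where a0: "a0 \<in> b" by (rule G.is_block_two[OF b(1)])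
    obtain x0 where x0: "x0 \<in> b'" by (rule H.is_block_two[OF b'(1)])
    have "\<exists>\<sigma>. block_iso \<sigma> V V' \<and> (\<forall>a\<in>b. \<one> \<otimes> u (\<sigma> a) a \<noteq> \<zero>)"
    proof (rule block_step[OF rect_full b(1) b'(1) bV])
      fix k z assume "k \<in> V" "z \<in> V'" "\<one> \<otimes> u z k \<noteq> \<zero>"
      then show "k \<in> b \<longleftrightarrow> z \<in> b'"
        using entry_center_block[of z k] unfolding b(2) b'(2) by simp
    next
      fix a x q
      assume a: "a \<in> b" and x: "x \<in> b'"
        and q: "rect q {k \<in> V. G.anchor b k = a} {z \<in> V'. H.anchor b' z = x}" "q \<otimes> u x a = q"
      \<comment> \<open>At the top there is no parent vertex: \<open>anchor_fibre_closed\<close> is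
        used with the whole vertex set as \<open>C\<close>, and any vertex of the block can stand
        for its root.\<close>
      have ins: "insert a0 V = V" "insert x0 V' = V'" using a0 x0 bV by auto
      have "G.closed_at a {k \<in> insert a0 V. G.anchor b k = a}"
        by (rule G.anchor_fibre_closed[OF b(1) a0 _ _ _ a]) (use bV in auto)
      moreover have "H.closed_at x {z \<in> insert x0 V'. H.anchor b' z = x}"
        by (rule H.anchor_fibre_closed[OF b'(1) x0 _ _ _ x]) (use bV in auto)
      ultimately show "\<exists>\<sigma>. block_iso \<sigma> {k \<in> V. G.anchor b k = a} {z \<in> V'. H.anchor b' z = x} \<and> \<sigma> a = x"
        unfolding ins using rooted_block_iso[OF q(1) _ _ q(2)] by blast
    qed
    then show ?thesis by blast
  qed
qed

end

section \<open>Completion of a countably generated corner\<close>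

text \<open>
  The definition of \<open>Metric_space.mcomplete\<close> can be unfolded only when the distance is
  symmetric and nonnegative on the whole type, which the norm of a C*-algebra need not satisfy
  outside the carrier; so the completeness of a given algebra cannot be used. Instead the corner
  \<open>pAp\<close> is replaced by the completion of a countable *-subalgebra over the Gaussian rationals.
  It has at most the cardinality of \<open>\<complex>\<close>, hence is carried by the type of the given algebra.
\<close>

datatype cstar_term =
  Gen nat | Unit | Sum cstar_term cstar_term | Prod cstar_term cstar_term
| Star cstar_term | Scale rat rat cstar_term

instance cstar_term :: countable by countable_datatype

lemma null_sandwich:
  fixes f g :: "'i \<Rightarrow> real"
  assumes "\<And>i. 0 \<le> f i" "\<And>i. f i \<le> g i" "(g \<longlongrightarrow> 0) F"
  shows "(f \<longlongrightarrow> 0) F"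
  by (rule tendsto_sandwich[OF _ _ tendsto_const assms(3)]) (use assms in auto)

lemma rat_sequence_tendsto:
  fixes x :: real
  shows "\<exists>q :: nat \<Rightarrow> rat. (\<lambda>n. of_rat (q n)) \<longlonglongrightarrow> x"
proof -
  have "\<exists>q :: rat. \<bar>of_rat q - x\<bar> < 1 / real (Suc n)" for n
  proof -
    obtain q :: rat where "x < of_rat q" "of_rat q < x + 1 / real (Suc n)"
      using of_rat_dense[of x "x + 1 / real (Suc n)"] by auto
    then show ?thesis by (intro exI[of _ q]) auto
  qed
  then obtain q :: "nat \<Rightarrow> rat" where q: "\<And>n. \<bar>of_rat (q n) - x\<bar> < 1 / real (Suc n)" by metis
  have "(\<lambda>n. \<bar>of_rat (q n) - x\<bar>) \<longlonglongrightarrow> 0"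
  proof (rule null_sandwich[OF _ _ LIMSEQ_inverse_real_of_nat])
    show "\<bar>of_rat (q n) - x\<bar> \<le> inverse (real (Suc n))" for n
      using q[of n] by (simp only: inverse_eq_divide)
  qed simp
  then have "(\<lambda>n. of_rat (q n) - x) \<longlonglongrightarrow> 0" by (rule tendsto_rabs_zero_cancel)
  then have "(\<lambda>n. of_rat (q n)) \<longlonglongrightarrow> x" by (rule LIM_zero_cancel)
  then show ?thesis by (rule exI[of _ q])
qed

section \<open>Norm estimates and asymptotically equal families\<close>

context unital_cstar_algebra
begin

lemma nrm_star: "x \<in> carrier A \<Longrightarrow> nrm A (star A x) = nrm A x"
proof -
  have le: "nrm A x \<le> nrm A (star A x)" if x: "x \<in> carrier A" for x
  proof (cases "nrm A x = 0")
    case False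
    then have "nrm A x > 0" using nrm_nonneg[OF x] by simp
    moreover have "nrm A x * nrm A x \<le> nrm A (star A x) * nrm A x"
      using cstar_identity[OF x] nrm_mult[of "star A x" x] x by (simp add: power2_eq_square)
    ultimately show ?thesis by (rule mult_right_le_imp_le[rotated])
  qed (use x in \<open>simp add: nrm_nonneg\<close>)
  assume "x \<in> carrier A"
  then show ?thesis using le[of x] le[of "star A x"] by (simp add: star_star)
qed

lemma nrm_diff_commute:
  assumes "x \<in> carrier A" "y \<in> carrier A"
  shows "nrm A (x \<ominus> y) = nrm A (y \<ominus> x)"
proof -
  have "x \<ominus> y = \<ominus> (y \<ominus> x)" using assms by (simp add: a_minus_def minus_add a_comm)
  then show ?thesis using assms by simp
qed

lemma nrm_diff_triangle:
  assumes "x \<in> carrier A" "y \<in> carrier A" "z \<in> carrier A"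
  shows "nrm A (x \<ominus> z) \<le> nrm A (x \<ominus> y) + nrm A (y \<ominus> z)"
proof -
  have "x \<ominus> z = (x \<ominus> y) \<oplus> (y \<ominus> z)" using assms by (simp add: a_minus_def a_assoc r_neg1)
  then show ?thesis using nrm_triangle[of "x \<ominus> y" "y \<ominus> z"] assms by simp
qed

lemma nrm_diff_ineq:
  assumes "x \<in> carrier A" "y \<in> carrier A"
  shows "\<bar>nrm A x - nrm A y\<bar> \<le> nrm A (x \<ominus> y)"
proof -
  have *: "nrm A x \<le> nrm A (x \<ominus> y) + nrm A y" if "x \<in> carrier A" "y \<in> carrier A" for x y
  proof -
    have "x = (x \<ominus> y) \<oplus> y" using that by (simp add: a_minus_def a_assoc l_neg)
    then show ?thesis using nrm_triangle[of "x \<ominus> y" y] that by simp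
  qed
  show ?thesis using *[OF assms] *[OF assms(2,1)] nrm_diff_commute[OF assms] by linarith
qed

lemma nrm_diff_add:
  assumes "x \<in> carrier A" "y \<in> carrier A" "x' \<in> carrier A" "y' \<in> carrier A"
  shows "nrm A ((x \<oplus> x') \<ominus> (y \<oplus> y')) \<le> nrm A (x \<ominus> y) + nrm A (x' \<ominus> y')"
proof -
  have "(x \<oplus> x') \<ominus> (y \<oplus> y') = (x \<ominus> y) \<oplus> (x' \<ominus> y')"
    using assms by (simp add: a_minus_def minus_add a_ac)
  then show ?thesis using nrm_triangle[of "x \<ominus> y" "x' \<ominus> y'"] assms by simp
qed

lemma nrm_diff_mult:
  assumes "x \<in> carrier A" "y \<in> carrier A" "x' \<in> carrier A" "y' \<in> carrier A"
  shows "nrm A ((x \<otimes> x') \<ominus> (y \<otimes> y')) \<le> nrm A (x \<ominus> y) * nrm A x' + nrm A y * nrm A (x' \<ominus> y')"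
proof -
  have "(x \<otimes> x') \<ominus> (y \<otimes> y') = (x \<ominus> y) \<otimes> x' \<oplus> y \<otimes> (x' \<ominus> y')"
    using assms by algebra
  then show ?thesis
    using nrm_triangle[of "(x \<ominus> y) \<otimes> x'" "y \<otimes> (x' \<ominus> y')"] nrm_mult[of "x \<ominus> y" x']
      nrm_mult[of y "x' \<ominus> y'"] assms by simp
qed

lemma nrm_diff_star:
  assumes "x \<in> carrier A" "y \<in> carrier A"
  shows "nrm A (star A x \<ominus> star A y) = nrm A (x \<ominus> y)"
  using nrm_star[of "x \<ominus> y"] assms by (simp add: a_minus_def star_add star_minus)

lemma nrm_diff_smult:
  assumes "x \<in> carrier A" "y \<in> carrier A"
  shows "nrm A ((c \<odot> x) \<ominus> (d \<odot> y)) \<le> cmod c * nrm A (x \<ominus> y) + cmod (c - d) * nrm A y"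
proof -
  have "c \<odot> (x \<ominus> y) \<oplus> (c - d) \<odot> y = c \<odot> x \<oplus> (\<ominus> (c \<odot> y) \<oplus> (c \<odot> y \<oplus> \<ominus> (d \<odot> y)))"
    using assms smult_l_distr[of y c "- d"]
    by (simp add: a_minus_def smult_r_distr smult_minus minus_smult a_assoc)
  then have "(c \<odot> x) \<ominus> (d \<odot> y) = c \<odot> (x \<ominus> y) \<oplus> (c - d) \<odot> y"
    using assms by (simp add: r_neg1 a_minus_def)
  then show ?thesis
    using nrm_triangle[of "c \<odot> (x \<ominus> y)" "(c - d) \<odot> y"] assms by (simp add: nrm_smult)
qed

text \<open>An arbitrary filter lets the same estimates serve equivalence of sequences, over
  \<open>sequentially\<close>, and the Cauchy property, over pairs of indices.\<close>

definition close :: "'i filter \<Rightarrow> ('i \<Rightarrow> 'x) \<Rightarrow> ('i \<Rightarrow> 'x) \<Rightarrow> bool" where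
  "close F f g \<longleftrightarrow> ((\<lambda>i. nrm A (f i \<ominus> g i)) \<longlongrightarrow> 0) F"

context
  fixes f f' g g' :: "'i \<Rightarrow> 'x" and F :: "'i filter"
  assumes carr: "\<And>i. f i \<in> carrier A" "\<And>i. f' i \<in> carrier A" "\<And>i. g i \<in> carrier A" "\<And>i. g' i \<in> carrier A"
begin

lemma close_sym: "close F f g \<Longrightarrow> close F g f"
  unfolding close_def using carr by (simp add: nrm_diff_commute)

lemma close_trans: "close F f g \<Longrightarrow> close F g f' \<Longrightarrow> close F f f'"
  unfolding close_def
  by (rule null_sandwich[where g = "\<lambda>i. nrm A (f i \<ominus> g i) + nrm A (g i \<ominus> f' i)"])
    (auto simp: carr nrm_nonneg nrm_diff_triangle intro: tendsto_add_zero)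

lemma close_add: "close F f g \<Longrightarrow> close F f' g' \<Longrightarrow> close F (\<lambda>i. f i \<oplus> f' i) (\<lambda>i. g i \<oplus> g' i)"
  unfolding close_def
  by (rule null_sandwich[where g = "\<lambda>i. nrm A (f i \<ominus> g i) + nrm A (f' i \<ominus> g' i)"])
    (auto simp: carr nrm_nonneg nrm_diff_add intro: tendsto_add_zero)

lemma close_mult:
  assumes "close F f g" "close F f' g'" and K: "\<And>i. nrm A (f' i) \<le> K" and L: "\<And>i. nrm A (g i) \<le> L"
  shows "close F (\<lambda>i. f i \<otimes> f' i) (\<lambda>i. g i \<otimes> g' i)"
  unfolding close_def
proof (rule null_sandwich[where g = "\<lambda>i. nrm A (f i \<ominus> g i) * K + L * nrm A (f' i \<ominus> g' i)"])
  fix i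
  show "nrm A (f i \<otimes> f' i \<ominus> g i \<otimes> g' i) \<le> nrm A (f i \<ominus> g i) * K + L * nrm A (f' i \<ominus> g' i)"
    using carr K[of i] L[of i]
    by (intro order_trans[OF nrm_diff_mult] add_mono mult_left_mono mult_right_mono)
      (auto simp: nrm_nonneg)
  show "((\<lambda>i. nrm A (f i \<ominus> g i) * K + L * nrm A (f' i \<ominus> g' i)) \<longlongrightarrow> 0) F"
    using assms(1,2) unfolding close_def
    by (intro tendsto_add_zero tendsto_mult_left_zero tendsto_mult_right_zero)
qed (use carr in \<open>simp add: nrm_nonneg\<close>)

lemma close_star: "close F f g \<Longrightarrow> close F (\<lambda>i. star A (f i)) (\<lambda>i. star A (g i))"
  unfolding close_def using carr by (simp add: nrm_diff_star)

lemma close_smult: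
  assumes "close F f g" "((\<lambda>i. cmod (c i - d i)) \<longlongrightarrow> 0) F"
    and K: "\<And>i. nrm A (g i) \<le> K" and L: "\<And>i. cmod (c i) \<le> L"
  shows "close F (\<lambda>i. c i \<odot> f i) (\<lambda>i. d i \<odot> g i)"
  unfolding close_def
proof (rule null_sandwich[where g = "\<lambda>i. L * nrm A (f i \<ominus> g i) + cmod (c i - d i) * K"])
  fix i
  show "nrm A (c i \<odot> f i \<ominus> d i \<odot> g i) \<le> L * nrm A (f i \<ominus> g i) + cmod (c i - d i) * K"
    using carr K[of i] L[of i]
    by (intro order_trans[OF nrm_diff_smult] add_mono mult_left_mono mult_right_mono)
      (auto simp: nrm_nonneg)
  show "((\<lambda>i. L * nrm A (f i \<ominus> g i) + cmod (c i - d i) * K) \<longlongrightarrow> 0) F"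
    using assms(1,2) unfolding close_def
    by (intro tendsto_add_zero tendsto_mult_left_zero tendsto_mult_right_zero)
qed (use carr in \<open>simp add: nrm_nonneg\<close>)

end

lemma close_refl: "(\<And>i. f i \<in> carrier A) \<Longrightarrow> close F f f"
  unfolding close_def by (simp add: a_minus_def r_neg)

definition cauchy :: "(nat \<Rightarrow> 'x) \<Rightarrow> bool" where
  "cauchy \<sigma> \<longleftrightarrow> close (sequentially \<times>\<^sub>F sequentially) (\<lambda>z. \<sigma> (fst z)) (\<lambda>z. \<sigma> (snd z))"

lemma cauchyI:
  assumes \<sigma>: "\<And>n. \<sigma> n \<in> carrier A"
    and "\<And>e. e > 0 \<Longrightarrow> \<exists>N. \<forall>m\<ge>N. \<forall>n\<ge>N. nrm A (\<sigma> n \<ominus> \<sigma> m) < e"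
  shows "cauchy \<sigma>"
  unfolding cauchy_def close_def
proof (rule tendstoI)
  fix e :: real assume "e > 0"
  then show "\<forall>\<^sub>F z in sequentially \<times>\<^sub>F sequentially. dist (nrm A (\<sigma> (fst z) \<ominus> \<sigma> (snd z))) 0 < e"
    using assms(2)[of e] \<sigma> by (simp add: eventually_prod_sequentially nrm_nonneg)
qed

lemma cauchyD:
  assumes "cauchy \<sigma>" "\<And>n. \<sigma> n \<in> carrier A" "e > 0"
  shows "\<exists>N. \<forall>m\<ge>N. \<forall>n\<ge>N. nrm A (\<sigma> n \<ominus> \<sigma> m) < e"
  using tendstoD[OF assms(1)[unfolded cauchy_def close_def] assms(3)] assms(2)
  by (simp add: eventually_prod_sequentially nrm_nonneg)

lemma cauchy_diff_nrm_convergent: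
  assumes "cauchy \<sigma>" "\<And>n. \<sigma> n \<in> carrier A"
  shows "convergent (\<lambda>n. nrm A (\<sigma> n))"
proof -
  have "Cauchy (\<lambda>n. nrm A (\<sigma> n))"
  proof (rule CauchyI)
    fix e :: real assume "e > 0"
    then obtain N where N: "\<forall>m\<ge>N. \<forall>n\<ge>N. nrm A (\<sigma> n \<ominus> \<sigma> m) < e" using cauchyD assms by blast
    have "norm (nrm A (\<sigma> m) - nrm A (\<sigma> n)) < e" if "m \<ge> N" "n \<ge> N" for m n
      using N that nrm_diff_ineq[OF assms(2,2), of m n] by (simp add: order_le_less_trans)
    then show "\<exists>M. \<forall>m\<ge>M. \<forall>n\<ge>M. norm (nrm A (\<sigma> m) - nrm A (\<sigma> n)) < e" by blast
  qed
  then show ?thesis by (rule Cauchy_convergent)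
qed

lemma convergent_nrm_bounded:
  assumes "convergent (\<lambda>n. nrm A (\<sigma> n))"
  shows "\<exists>K. \<forall>n. nrm A (\<sigma> n) \<le> K"
proof -
  have "Bseq (\<lambda>n. nrm A (\<sigma> n))" using assms by (rule convergent_imp_Bseq)
  then obtain K where "\<And>n. \<bar>nrm A (\<sigma> n)\<bar> \<le> K" by (auto simp: Bseq_def)
  then have "\<forall>n. nrm A (\<sigma> n) \<le> K" by (simp add: abs_le_iff)
  then show ?thesis by (rule exI[of _ K])
qed

end

section \<open>Approximable Cauchy sequences in a corner\<close>

locale corner_completion = unital_cstar_algebra A for A :: "'x cstar" (structure) +
  fixes p :: 'x and gen :: "nat \<Rightarrow> 'x"
  assumes p: "proj p" "p \<noteq> \<zero>"
    and gen: "\<And>n. gen n \<in> carrier A" "\<And>n. p \<otimes> gen n = gen n" "\<And>n. gen n \<otimes> p = gen n"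
begin

text \<open>The corner \<open>pAp\<close>, whose unit is \<open>p\<close>.\<close>

definition P :: "'x set" where "P = {x \<in> carrier A. p \<otimes> x = x \<and> x \<otimes> p = x}"

lemma p_simps: "p \<in> carrier A" "p \<otimes> p = p" "star A p = p"
  using p(1) by (auto simp: proj_def)

lemma P_carrier: "x \<in> P \<Longrightarrow> x \<in> carrier A" by (simp add: P_def)

lemma P_unit: "x \<in> P \<Longrightarrow> p \<otimes> x = x" "x \<in> P \<Longrightarrow> x \<otimes> p = x" by (simp_all add: P_def)

lemma P_one: "p \<in> P" and P_zero: "\<zero> \<in> P" using p_simps by (simp_all add: P_def)

lemma P_add: "x \<in> P \<Longrightarrow> y \<in> P \<Longrightarrow> x \<oplus> y \<in> P"
  using p_simps by (simp add: P_def l_distr r_distr)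

lemma P_mult: assumes "x \<in> P" "y \<in> P" shows "x \<otimes> y \<in> P"
proof -
  have "p \<otimes> (x \<otimes> y) = (p \<otimes> x) \<otimes> y" "(x \<otimes> y) \<otimes> p = x \<otimes> (y \<otimes> p)"
    using assms p_simps by (simp_all add: m_assoc P_carrier)
  then show ?thesis using assms by (simp add: P_def)
qed

lemma P_smult: "x \<in> P \<Longrightarrow> c \<odot> x \<in> P"
  using p_simps by (simp add: P_def smult_mult_left smult_mult_right)

lemma P_star: assumes "x \<in> P" shows "star A x \<in> P"
proof -
  have "p \<otimes> star A x = star A (x \<otimes> p)" "star A x \<otimes> p = star A (p \<otimes> x)"
    using assms p_simps by (simp_all add: star_mult P_carrier)
  then show ?thesis using assms by (simp add: P_def)
qed

primrec eval_term :: "cstar_term \<Rightarrow> 'x" where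
  "eval_term (Gen n) = gen n"
| "eval_term Unit = p"
| "eval_term (Sum s t) = eval_term s \<oplus> eval_term t"
| "eval_term (Prod s t) = eval_term s \<otimes> eval_term t"
| "eval_term (Star t) = star A (eval_term t)"
| "eval_term (Scale a b t) = Complex (of_rat a) (of_rat b) \<odot> eval_term t"

definition D :: "'x set" where "D = range eval_term"

lemma D_P: "x \<in> D \<Longrightarrow> x \<in> P"
proof -
  have "eval_term t \<in> P" for t
    by (induction t) (auto simp: P_one P_add P_mult P_star P_smult, simp add: P_def gen)
  then show "x \<in> D \<Longrightarrow> x \<in> P" by (auto simp: D_def)
qed

lemma countable_D: "countable D" by (simp add: D_def)

lemma D_gen: "gen n \<in> D" and D_unit: "p \<in> D"
  unfolding D_def by (metis eval_term.simps(1) rangeI) (metis eval_term.simps(2) rangeI)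

lemma D_add: "x \<in> D \<Longrightarrow> y \<in> D \<Longrightarrow> x \<oplus> y \<in> D"
  unfolding D_def by (auto intro: range_eqI[of _ _ "Sum _ _"])

lemma D_mult: "x \<in> D \<Longrightarrow> y \<in> D \<Longrightarrow> x \<otimes> y \<in> D"
  unfolding D_def by (auto intro: range_eqI[of _ _ "Prod _ _"])

lemma D_star: "x \<in> D \<Longrightarrow> star A x \<in> D"
  unfolding D_def by (auto intro: range_eqI[of _ _ "Star _"])

lemma D_scale: "x \<in> D \<Longrightarrow> Complex (of_rat a) (of_rat b) \<odot> x \<in> D"
  unfolding D_def by (auto intro: range_eqI[of _ _ "Scale a b _"])

lemma D_zero: "\<zero> \<in> D"
proof -
  have "Complex (of_rat 0) (of_rat 0) \<odot> p \<in> D" by (rule D_scale[OF D_unit])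
  moreover have "Complex (of_rat 0) (of_rat 0) = 0" by (simp add: complex_eq_iff)
  ultimately show ?thesis using p_simps by (simp add: smult_zero_scalar)
qed

abbreviation equiv_seq :: "(nat \<Rightarrow> 'x) \<Rightarrow> (nat \<Rightarrow> 'x) \<Rightarrow> bool" where
  "equiv_seq \<equiv> close sequentially"

definition approximable :: "(nat \<Rightarrow> 'x) \<Rightarrow> (nat \<Rightarrow> 'x) \<Rightarrow> bool" where
  "approximable \<sigma> \<tau> \<longleftrightarrow> (\<forall>n. \<tau> n \<in> D) \<and> equiv_seq \<sigma> \<tau>"

text \<open>The values range over the whole corner, which is closed under all complex scalars,
  whereas \<open>D\<close> is built with Gaussian rationals only. An asymptotically equal sequence
  in \<open>D\<close> keeps the classes few enough to be coded.\<close>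

definition Cseq :: "(nat \<Rightarrow> 'x) set" where
  "Cseq = {\<sigma>. (\<forall>n. \<sigma> n \<in> P) \<and> cauchy \<sigma> \<and> (\<exists>\<tau>. approximable \<sigma> \<tau>)}"

lemma Cseq_P: "\<sigma> \<in> Cseq \<Longrightarrow> \<sigma> n \<in> P" by (simp add: Cseq_def)

lemma Cseq_carrier [simp]: "\<sigma> \<in> Cseq \<Longrightarrow> \<sigma> n \<in> carrier A" using Cseq_P P_carrier by blast

lemma Cseq_cauchy: "\<sigma> \<in> Cseq \<Longrightarrow> cauchy \<sigma>" by (simp add: Cseq_def)

lemma Cseq_approx: "\<sigma> \<in> Cseq \<Longrightarrow> \<exists>\<tau>. approximable \<sigma> \<tau>" by (simp add: Cseq_def)

lemma approximable_carrier: "approximable \<sigma> \<tau> \<Longrightarrow> \<tau> n \<in> carrier A"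
  using D_P P_carrier by (simp add: approximable_def)

lemma CseqI:
  "\<lbrakk>\<And>n. \<sigma> n \<in> P; cauchy \<sigma>; \<And>n. \<tau> n \<in> D; equiv_seq \<sigma> \<tau>\<rbrakk> \<Longrightarrow> \<sigma> \<in> Cseq"
  unfolding Cseq_def approximable_def by blast

lemma Cseq_nrm_convergent: "\<sigma> \<in> Cseq \<Longrightarrow> convergent (\<lambda>n. nrm A (\<sigma> n))"
  by (rule cauchy_diff_nrm_convergent) (auto simp: Cseq_cauchy)

lemma Cseq_bounded: "\<sigma> \<in> Cseq \<Longrightarrow> \<exists>K. \<forall>n. nrm A (\<sigma> n) \<le> K"
  by (rule convergent_nrm_bounded[OF Cseq_nrm_convergent])

lemma approximable_bounded:
  assumes "\<sigma> \<in> Cseq" "approximable \<sigma> \<tau>"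
  shows "\<exists>K. \<forall>n. nrm A (\<tau> n) \<le> K"
proof -
  obtain K where K: "\<And>n. nrm A (\<sigma> n) \<le> K" using Cseq_bounded[OF assms(1)] by blast
  have "convergent (\<lambda>n. nrm A (\<sigma> n \<ominus> \<tau> n))"
    using assms(2) by (auto simp: approximable_def close_def convergent_def)
  then obtain L where L: "\<And>n. nrm A (\<sigma> n \<ominus> \<tau> n) \<le> L"
    using convergent_nrm_bounded[of "\<lambda>n. \<sigma> n \<ominus> \<tau> n"] by blast
  have "nrm A (\<tau> n) \<le> K + L" for n
    using nrm_diff_ineq[of "\<sigma> n" "\<tau> n"] K[of n] L[of n] assms approximable_carrier[OF assms(2)]
    by (simp add: abs_le_iff)
  then show ?thesis by blast
qed

lemma Cseq_const: "x \<in> D \<Longrightarrow> (\<lambda>n. x) \<in> Cseq"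
  using D_P[of x] by (intro CseqI[of _ "\<lambda>n. x"]) (auto simp: cauchy_def P_carrier intro: close_refl)

lemma Cseq_zero: "(\<lambda>n. \<zero>) \<in> Cseq" and Cseq_unit: "(\<lambda>n. p) \<in> Cseq"
  by (simp_all add: Cseq_const D_zero D_unit)

lemma Cseq_add:
  assumes "\<sigma> \<in> Cseq" "\<tau> \<in> Cseq"
  shows "(\<lambda>n. \<sigma> n \<oplus> \<tau> n) \<in> Cseq"
proof -
  obtain \<sigma>' \<tau>' where a: "approximable \<sigma> \<sigma>'" "approximable \<tau> \<tau>'" using assms Cseq_approx by blast
  show ?thesis
  proof (rule CseqI[of _ "\<lambda>n. \<sigma>' n \<oplus> \<tau>' n"])
    show "\<sigma> n \<oplus> \<tau> n \<in> P" for n using assms Cseq_P P_add by simp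
    show "cauchy (\<lambda>n. \<sigma> n \<oplus> \<tau> n)"
      using assms Cseq_cauchy unfolding cauchy_def by (intro close_add) auto
    show "\<sigma>' n \<oplus> \<tau>' n \<in> D" for n using a D_add by (simp add: approximable_def)
    show "equiv_seq (\<lambda>n. \<sigma> n \<oplus> \<tau> n) (\<lambda>n. \<sigma>' n \<oplus> \<tau>' n)"
      using a assms approximable_carrier by (intro close_add) (auto simp: approximable_def)
  qed
qed

lemma Cseq_mult:
  assumes "\<sigma> \<in> Cseq" "\<tau> \<in> Cseq"
  shows "(\<lambda>n. \<sigma> n \<otimes> \<tau> n) \<in> Cseq"
proof -
  obtain \<sigma>' \<tau>' where a: "approximable \<sigma> \<sigma>'" "approximable \<tau> \<tau>'" using assms Cseq_approx by blast
  obtain K where K: "\<And>n. nrm A (\<tau> n) \<le> K" using Cseq_bounded[OF assms(2)] by blast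
  obtain L where L: "\<And>n. nrm A (\<sigma> n) \<le> L" using Cseq_bounded[OF assms(1)] by blast
  obtain M where M: "\<And>n. nrm A (\<sigma>' n) \<le> M" using approximable_bounded[OF assms(1) a(1)] by blast
  show ?thesis
  proof (rule CseqI[of _ "\<lambda>n. \<sigma>' n \<otimes> \<tau>' n"])
    show "\<sigma> n \<otimes> \<tau> n \<in> P" for n using assms Cseq_P P_mult by simp
    show "cauchy (\<lambda>n. \<sigma> n \<otimes> \<tau> n)"
      using assms Cseq_cauchy K L unfolding cauchy_def by (intro close_mult) auto
    show "\<sigma>' n \<otimes> \<tau>' n \<in> D" for n using a D_mult by (simp add: approximable_def)
    show "equiv_seq (\<lambda>n. \<sigma> n \<otimes> \<tau> n) (\<lambda>n. \<sigma>' n \<otimes> \<tau>' n)"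
      using a assms approximable_carrier K M by (intro close_mult) (auto simp: approximable_def)
  qed
qed

lemma Cseq_star:
  assumes "\<sigma> \<in> Cseq"
  shows "(\<lambda>n. star A (\<sigma> n)) \<in> Cseq"
proof -
  obtain \<sigma>' where a: "approximable \<sigma> \<sigma>'" using assms Cseq_approx by blast
  show ?thesis
  proof (rule CseqI[of _ "\<lambda>n. star A (\<sigma>' n)"])
    show "star A (\<sigma> n) \<in> P" for n using assms Cseq_P P_star by simp
    show "cauchy (\<lambda>n. star A (\<sigma> n))"
      using assms Cseq_cauchy unfolding cauchy_def by (intro close_star) auto
    show "star A (\<sigma>' n) \<in> D" for n using a D_star by (simp add: approximable_def)
    show "equiv_seq (\<lambda>n. star A (\<sigma> n)) (\<lambda>n. star A (\<sigma>' n))"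
      using a assms approximable_carrier by (intro close_star) (auto simp: approximable_def)
  qed
qed

lemma Cseq_smult:
  assumes "\<sigma> \<in> Cseq"
  shows "(\<lambda>n. c \<odot> \<sigma> n) \<in> Cseq"
proof -
  obtain \<sigma>' where a: "approximable \<sigma> \<sigma>'" using assms Cseq_approx by blast
  obtain L where L: "\<And>n. nrm A (\<sigma> n) \<le> L" using Cseq_bounded[OF assms] by blast
  obtain M where M: "\<And>n. nrm A (\<sigma>' n) \<le> M" using approximable_bounded[OF assms a] by blast
  \<comment> \<open>The approximating sequence is scaled by Gaussian rationals that tend to
    \<open>c\<close>, since these keep it in \<open>D\<close>.\<close>
  obtain q1 q2 :: "nat \<Rightarrow> rat" where q: "(\<lambda>n. of_rat (q1 n)) \<longlonglongrightarrow> Re c" "(\<lambda>n. of_rat (q2 n)) \<longlonglongrightarrow> Im c"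
    using rat_sequence_tendsto by blast
  define q where "q n = Complex (of_rat (q1 n)) (of_rat (q2 n))" for n
  have "q \<longlonglongrightarrow> Complex (Re c) (Im c)" unfolding q_def using q by (intro tendsto_Complex)
  then have q0: "(\<lambda>n. cmod (c - q n)) \<longlonglongrightarrow> 0"
    using tendsto_norm_zero[OF LIM_zero[of q c]] by (simp add: norm_minus_commute)
  show ?thesis
  proof (rule CseqI[of _ "\<lambda>n. q n \<odot> \<sigma>' n"])
    show "c \<odot> \<sigma> n \<in> P" for n using assms Cseq_P P_smult by simp
    show "cauchy (\<lambda>n. c \<odot> \<sigma> n)"
      using assms Cseq_cauchy L unfolding cauchy_def by (intro close_smult[where L = "cmod c"]) auto
    show "q n \<odot> \<sigma>' n \<in> D" for n using a D_scale by (simp add: approximable_def q_def)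
    show "equiv_seq (\<lambda>n. c \<odot> \<sigma> n) (\<lambda>n. q n \<odot> \<sigma>' n)"
      using a assms approximable_carrier M q0
      by (intro close_smult[where L = "cmod c"]) (auto simp: approximable_def)
  qed
qed

end

lemma limit_zero_iff:
  fixes f :: "nat \<Rightarrow> real"
  assumes "f \<longlonglongrightarrow> l"
  shows "l = 0 \<longleftrightarrow> f \<longlonglongrightarrow> 0"
proof
  show "f \<longlonglongrightarrow> 0" if "l = 0" using assms that by simp
  show "l = 0" if "f \<longlonglongrightarrow> 0" by (rule LIMSEQ_unique[OF assms that])
qed

section \<open>The completion on the type of the given algebra\<close>

context corner_completion
begin

lemma one_neq_zero: "\<one> \<noteq> \<zero>"
proof
  assume "\<one> = \<zero>"
  then have "p = \<zero>" using p_simps(1) by (metis l_one l_null)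
  then show False using p(2) by simp
qed

lemma smult_one_inj: "c \<odot> \<one> = d \<odot> \<one> \<Longrightarrow> c = d"
proof (rule ccontr)
  assume eq: "c \<odot> \<one> = d \<odot> \<one>" and "c \<noteq> d"
  have "(c - d) \<odot> \<one> = \<zero>"
    using smult_l_distr[of \<one> c "- d"] eq by (simp add: minus_smult r_neg)
  then show False using smult_eq_zero[of \<one> "c - d"] one_neq_zero \<open>c \<noteq> d\<close> by simp
qed

text \<open>The graph of a sequence in the countable set \<open>D\<close> is coded by a set of
  natural numbers, that by a real number, and that by a scalar multiple of the unit.\<close>

lemma sequence_code_exists:
  "\<exists>j :: (nat \<Rightarrow> 'x) \<Rightarrow> 'x. \<forall>\<sigma> \<tau>. (\<forall>n. \<sigma> n \<in> D) \<and> (\<forall>n. \<tau> n \<in> D) \<and> j \<sigma> = j \<tau> \<longrightarrow> \<sigma> = \<tau>"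
proof -
  obtain h :: "nat set \<Rightarrow> real" where h: "inj h"
    using nat_sets_eqpoll_reals by (auto simp: eqpoll_def bij_betw_def)
  define c where "c \<sigma> = {prod_encode (n, to_nat_on D (\<sigma> n)) | n. True}" for \<sigma>
  define j where "j \<sigma> = complex_of_real (h (c \<sigma>)) \<odot> \<one>" for \<sigma>
  have "\<sigma> = \<tau>" if D: "\<forall>n. \<sigma> n \<in> D" "\<forall>n. \<tau> n \<in> D" and eq: "j \<sigma> = j \<tau>" for \<sigma> \<tau>
  proof
    fix n
    have "h (c \<sigma>) = h (c \<tau>)" using smult_one_inj eq unfolding j_def by (metis of_real_eq_iff)
    then have "c \<sigma> = c \<tau>" using h by (simp add: inj_eq)
    moreover have "prod_encode (n, to_nat_on D (\<sigma> n)) \<in> c \<sigma>" unfolding c_def by blast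
    ultimately have "prod_encode (n, to_nat_on D (\<sigma> n)) \<in> c \<tau>" by simp
    then obtain m where "prod_encode (n, to_nat_on D (\<sigma> n)) = prod_encode (m, to_nat_on D (\<tau> m))"
      unfolding c_def by blast
    then have "to_nat_on D (\<sigma> n) = to_nat_on D (\<tau> n)" by (auto simp: prod_encode_eq)
    then show "\<sigma> n = \<tau> n" using D countable_D by (metis to_nat_on_inj)
  qed
  then show ?thesis by blast
qed

definition code :: "(nat \<Rightarrow> 'x) \<Rightarrow> 'x" where
  "code = (SOME j. \<forall>\<sigma> \<tau>. (\<forall>n. \<sigma> n \<in> D) \<and> (\<forall>n. \<tau> n \<in> D) \<and> j \<sigma> = j \<tau> \<longrightarrow> \<sigma> = \<tau>)"

lemma code_inj: "\<lbrakk>\<forall>n. \<sigma> n \<in> D; \<forall>n. \<tau> n \<in> D; code \<sigma> = code \<tau>\<rbrakk> \<Longrightarrow> \<sigma> = \<tau>"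
  using someI_ex[OF sequence_code_exists, folded code_def] by blast

definition point :: "(nat \<Rightarrow> 'x) \<Rightarrow> 'x" where
  "point \<sigma> = code (SOME \<tau>. approximable \<sigma> \<tau>)"

lemma equiv_seq_sym:
  assumes "\<And>n. a n \<in> carrier A" "\<And>n. b n \<in> carrier A" "equiv_seq a b"
  shows "equiv_seq b a"
  by (rule close_sym[of a a b b, OF assms(1,1,2,2,3)])

lemma equiv_seq_trans:
  assumes "\<And>n. a n \<in> carrier A" "\<And>n. b n \<in> carrier A" "\<And>n. c n \<in> carrier A"
    "equiv_seq a b" "equiv_seq b c"
  shows "equiv_seq a c"
  by (rule close_trans[of a c b b, OF assms(1,3,2,2,4,5)])

text \<open>Equivalent sequences have the same approximants, so the choice operator picks the same
  one for both; conversely a common approximant makes sequences equivalent.\<close>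

lemma point_eq_iff:
  assumes "\<sigma> \<in> Cseq" "\<tau> \<in> Cseq"
  shows "point \<sigma> = point \<tau> \<longleftrightarrow> equiv_seq \<sigma> \<tau>"
proof
  assume eq: "point \<sigma> = point \<tau>"
  have a: "approximable \<sigma> (SOME \<rho>. approximable \<sigma> \<rho>)" "approximable \<tau> (SOME \<rho>. approximable \<tau> \<rho>)"
    using someI_ex[OF Cseq_approx] assms by blast+
  have "(SOME \<rho>. approximable \<sigma> \<rho>) = (SOME \<rho>. approximable \<tau> \<rho>)"
    using code_inj eq a unfolding point_def approximable_def by blast
  then obtain \<rho> where \<rho>: "approximable \<sigma> \<rho>" "approximable \<tau> \<rho>" using a by simp
  have c: "\<rho> n \<in> carrier A" "\<sigma> n \<in> carrier A" "\<tau> n \<in> carrier A" for n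
    using assms approximable_carrier[OF \<rho>(1)] by auto
  have "equiv_seq \<sigma> \<rho>" "equiv_seq \<tau> \<rho>" using \<rho> by (simp_all add: approximable_def)
  then show "equiv_seq \<sigma> \<tau>" using equiv_seq_trans[OF c(2,1,3)] equiv_seq_sym[OF c(3,1)] by simp
next
  assume eq: "equiv_seq \<sigma> \<tau>"
  have c: "\<sigma> n \<in> carrier A" "\<tau> n \<in> carrier A" for n using assms by auto
  have "approximable \<sigma> \<rho> = approximable \<tau> \<rho>" for \<rho>
  proof (cases "\<forall>n. \<rho> n \<in> D")
    case True
    then have r: "\<rho> n \<in> carrier A" for n using D_P P_carrier by blast
    have "equiv_seq \<tau> \<sigma>" by (rule equiv_seq_sym[OF c eq])
    then have "equiv_seq \<tau> \<rho>" if "equiv_seq \<sigma> \<rho>"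
      by (rule equiv_seq_trans[of \<tau> \<sigma> \<rho>, rotated 3]) (use c r that in auto)
    moreover have "equiv_seq \<sigma> \<rho>" if "equiv_seq \<tau> \<rho>"
      by (rule equiv_seq_trans[of \<sigma> \<tau> \<rho>, OF _ _ _ eq that]) (use c r in auto)
    ultimately have "equiv_seq \<sigma> \<rho> = equiv_seq \<tau> \<rho>" by blast
    then show ?thesis by (simp add: approximable_def)
  qed (auto simp: approximable_def)
  then show "point \<sigma> = point \<tau>" by (simp add: point_def)
qed

text \<open>The default zero sequence keeps \<open>rep x\<close> in \<open>Cseq\<close> for every
  \<open>x\<close>. This totality makes the distance symmetric and nonnegative on the whole type, as
  \<open>Metric_space\<close> demands.\<close>

definition rep :: "'x \<Rightarrow> nat \<Rightarrow> 'x" where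
  "rep x = (if x \<in> point ` Cseq then inv_into Cseq point x else (\<lambda>n. \<zero>))"

lemma rep_Cseq: "rep x \<in> Cseq"
  using inv_into_into[of x point Cseq] Cseq_zero by (simp add: rep_def)

lemma point_rep: "x \<in> point ` Cseq \<Longrightarrow> point (rep x) = x"
  by (simp add: rep_def f_inv_into_f)

lemma rep_point: "\<sigma> \<in> Cseq \<Longrightarrow> equiv_seq (rep (point \<sigma>)) \<sigma>"
  using point_eq_iff[OF rep_Cseq, of \<sigma> "point \<sigma>"] point_rep by simp

definition completion :: "'x cstar" where
  "completion = \<lparr>carrier = point ` Cseq,
     monoid.mult = (\<lambda>x y. point (\<lambda>n. rep x n \<otimes> rep y n)), one = point (\<lambda>n. p),
     zero = point (\<lambda>n. \<zero>), add = (\<lambda>x y. point (\<lambda>n. rep x n \<oplus> rep y n)),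
     smult = (\<lambda>c x. point (\<lambda>n. c \<odot> rep x n)),
     star = (\<lambda>x. point (\<lambda>n. star A (rep x n))),
     nrm = (\<lambda>x. lim (\<lambda>n. nrm A (rep x n)))\<rparr>"

abbreviation "B \<equiv> completion"

lemma B_simps: "carrier B = point ` Cseq" "\<one>\<^bsub>B\<^esub> = point (\<lambda>n. p)" "\<zero>\<^bsub>B\<^esub> = point (\<lambda>n. \<zero>)"
  by (simp_all add: completion_def)

lemma B_elem: assumes "x \<in> carrier B" obtains \<sigma> where "\<sigma> \<in> Cseq" "x = point \<sigma>"
  using assms by (auto simp: B_simps)

lemma B_add:
  assumes "\<sigma> \<in> Cseq" "\<tau> \<in> Cseq"
  shows "point \<sigma> \<oplus>\<^bsub>B\<^esub> point \<tau> = point (\<lambda>n. \<sigma> n \<oplus> \<tau> n)"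
proof -
  have "equiv_seq (\<lambda>n. rep (point \<sigma>) n \<oplus> rep (point \<tau>) n) (\<lambda>n. \<sigma> n \<oplus> \<tau> n)"
    using assms rep_Cseq rep_point by (intro close_add) auto
  then show ?thesis
    using point_eq_iff[OF Cseq_add[OF rep_Cseq rep_Cseq] Cseq_add[OF assms]]
    by (simp add: completion_def)
qed

lemma B_mult:
  assumes "\<sigma> \<in> Cseq" "\<tau> \<in> Cseq"
  shows "point \<sigma> \<otimes>\<^bsub>B\<^esub> point \<tau> = point (\<lambda>n. \<sigma> n \<otimes> \<tau> n)"
proof -
  obtain K L where "\<And>n. nrm A (rep (point \<tau>) n) \<le> K" "\<And>n. nrm A (\<sigma> n) \<le> L"
    using Cseq_bounded[OF rep_Cseq] Cseq_bounded[OF assms(1)] by blast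
  then have "equiv_seq (\<lambda>n. rep (point \<sigma>) n \<otimes> rep (point \<tau>) n) (\<lambda>n. \<sigma> n \<otimes> \<tau> n)"
    using assms rep_Cseq rep_point by (intro close_mult) auto
  then show ?thesis
    using point_eq_iff[OF Cseq_mult[OF rep_Cseq rep_Cseq] Cseq_mult[OF assms]]
    by (simp add: completion_def)
qed

lemma B_star:
  assumes "\<sigma> \<in> Cseq"
  shows "star B (point \<sigma>) = point (\<lambda>n. star A (\<sigma> n))"
proof -
  have "equiv_seq (\<lambda>n. star A (rep (point \<sigma>) n)) (\<lambda>n. star A (\<sigma> n))"
    using assms rep_Cseq rep_point by (intro close_star) auto
  then show ?thesis
    using point_eq_iff[OF Cseq_star[OF rep_Cseq] Cseq_star[OF assms]]
    by (simp add: completion_def)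
qed

lemma B_smult:
  assumes "\<sigma> \<in> Cseq"
  shows "c \<odot>\<^bsub>B\<^esub> point \<sigma> = point (\<lambda>n. c \<odot> \<sigma> n)"
proof -
  obtain K where "\<And>n. nrm A (\<sigma> n) \<le> K" using Cseq_bounded[OF assms] by blast
  then have "equiv_seq (\<lambda>n. c \<odot> rep (point \<sigma>) n) (\<lambda>n. c \<odot> \<sigma> n)"
    using assms rep_Cseq rep_point by (intro close_smult[where L = "cmod c"]) auto
  then show ?thesis
    using point_eq_iff[OF Cseq_smult[OF rep_Cseq] Cseq_smult[OF assms]]
    by (simp add: completion_def)
qed

lemma B_nrm:
  assumes "\<sigma> \<in> Cseq"
  shows "nrm B (point \<sigma>) = lim (\<lambda>n. nrm A (\<sigma> n))" "(\<lambda>n. nrm A (\<sigma> n)) \<longlonglongrightarrow> nrm B (point \<sigma>)"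
proof -
  have l: "(\<lambda>n. nrm A (\<sigma> n)) \<longlonglongrightarrow> lim (\<lambda>n. nrm A (\<sigma> n))"
    using Cseq_nrm_convergent[OF assms] by (simp add: convergent_LIMSEQ_iff)
  have "(\<lambda>n. nrm A (rep (point \<sigma>) n \<ominus> \<sigma> n)) \<longlonglongrightarrow> 0"
    using rep_point[OF assms] by (simp add: close_def)
  then have "(\<lambda>n. \<bar>nrm A (rep (point \<sigma>) n) - nrm A (\<sigma> n)\<bar>) \<longlonglongrightarrow> 0"
    by (rule null_sandwich[rotated 2]) (use assms rep_Cseq in \<open>auto intro: nrm_diff_ineq\<close>)
  then have "(\<lambda>n. nrm A (rep (point \<sigma>) n) - nrm A (\<sigma> n)) \<longlonglongrightarrow> 0"
    by (rule tendsto_rabs_zero_cancel)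
  from tendsto_add[OF this l]
  have "(\<lambda>n. nrm A (rep (point \<sigma>) n)) \<longlonglongrightarrow> lim (\<lambda>n. nrm A (\<sigma> n))" by simp
  then show eq: "nrm B (point \<sigma>) = lim (\<lambda>n. nrm A (\<sigma> n))"
    by (simp add: completion_def limI)
  show "(\<lambda>n. nrm A (\<sigma> n)) \<longlonglongrightarrow> nrm B (point \<sigma>)" unfolding eq by (rule l)
qed

lemma Cseq_minus: "\<sigma> \<in> Cseq \<Longrightarrow> (\<lambda>n. \<ominus> \<sigma> n) \<in> Cseq"
  using Cseq_smult[of \<sigma> "- 1"] by (simp add: minus_smult smult_one)

lemma Cseq_diff: "\<sigma> \<in> Cseq \<Longrightarrow> \<tau> \<in> Cseq \<Longrightarrow> (\<lambda>n. \<sigma> n \<ominus> \<tau> n) \<in> Cseq"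
  unfolding a_minus_def by (intro Cseq_add Cseq_minus)

lemmas B_ops = B_add B_mult B_star B_smult Cseq_add Cseq_mult Cseq_star Cseq_smult
  Cseq_zero Cseq_unit Cseq_minus

lemma ring_B: "ring B"
proof (rule ringI)
  show "abelian_group B"
  proof (rule abelian_groupI)
    fix x y z assume "x \<in> carrier B" "y \<in> carrier B" "z \<in> carrier B"
    then obtain \<sigma> \<tau> \<rho> where s: "\<sigma> \<in> Cseq" "x = point \<sigma>" "\<tau> \<in> Cseq" "y = point \<tau>"
      "\<rho> \<in> Cseq" "z = point \<rho>" by (auto simp: B_simps)
    show "x \<oplus>\<^bsub>B\<^esub> y \<in> carrier B" using s by (simp add: B_ops B_simps)
    show "x \<oplus>\<^bsub>B\<^esub> y \<oplus>\<^bsub>B\<^esub> z = x \<oplus>\<^bsub>B\<^esub> (y \<oplus>\<^bsub>B\<^esub> z)" using s by (simp add: B_ops a_assoc)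
    show "x \<oplus>\<^bsub>B\<^esub> y = y \<oplus>\<^bsub>B\<^esub> x" using s by (simp add: B_ops a_comm)
    show "\<zero>\<^bsub>B\<^esub> \<oplus>\<^bsub>B\<^esub> x = x" using s by (simp add: B_ops B_simps)
    show "\<exists>y\<in>carrier B. y \<oplus>\<^bsub>B\<^esub> x = \<zero>\<^bsub>B\<^esub>"
      using s by (intro bexI[of _ "point (\<lambda>n. \<ominus> \<sigma> n)"]) (simp_all add: B_ops B_simps l_neg)
  qed (simp add: B_simps Cseq_zero)
  show "Group.monoid B"
  proof (rule monoidI)
    fix x y z assume "x \<in> carrier B" "y \<in> carrier B" "z \<in> carrier B"
    then obtain \<sigma> \<tau> \<rho> where s: "\<sigma> \<in> Cseq" "x = point \<sigma>" "\<tau> \<in> Cseq" "y = point \<tau>"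
      "\<rho> \<in> Cseq" "z = point \<rho>" by (auto simp: B_simps)
    have u: "p \<otimes> \<sigma> n = \<sigma> n" "\<sigma> n \<otimes> p = \<sigma> n" for n using P_unit Cseq_P[OF s(1)] by auto
    show "x \<otimes>\<^bsub>B\<^esub> y \<in> carrier B" using s by (simp add: B_ops B_simps)
    show "x \<otimes>\<^bsub>B\<^esub> y \<otimes>\<^bsub>B\<^esub> z = x \<otimes>\<^bsub>B\<^esub> (y \<otimes>\<^bsub>B\<^esub> z)" using s by (simp add: B_ops m_assoc)
    show "\<one>\<^bsub>B\<^esub> \<otimes>\<^bsub>B\<^esub> x = x" "x \<otimes>\<^bsub>B\<^esub> \<one>\<^bsub>B\<^esub> = x" using s u by (simp_all add: B_ops B_simps)
  qed (simp add: B_simps Cseq_unit)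
  fix x y z assume "x \<in> carrier B" "y \<in> carrier B" "z \<in> carrier B"
  then obtain \<sigma> \<tau> \<rho> where s: "\<sigma> \<in> Cseq" "x = point \<sigma>" "\<tau> \<in> Cseq" "y = point \<tau>"
    "\<rho> \<in> Cseq" "z = point \<rho>" by (auto simp: B_simps)
  show "(x \<oplus>\<^bsub>B\<^esub> y) \<otimes>\<^bsub>B\<^esub> z = x \<otimes>\<^bsub>B\<^esub> z \<oplus>\<^bsub>B\<^esub> y \<otimes>\<^bsub>B\<^esub> z" using s by (simp add: B_ops l_distr)
  show "z \<otimes>\<^bsub>B\<^esub> (x \<oplus>\<^bsub>B\<^esub> y) = z \<otimes>\<^bsub>B\<^esub> x \<oplus>\<^bsub>B\<^esub> z \<otimes>\<^bsub>B\<^esub> y" using s by (simp add: B_ops r_distr)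
qed

text \<open>All operations of \<open>completion\<close> are total functions of representatives, so this holds for
  arguments outside the carrier as well.\<close>

lemma B_diff: "x \<ominus>\<^bsub>B\<^esub> y = point (\<lambda>n. rep x n \<ominus> rep y n)"
proof -
  have "\<ominus>\<^bsub>B\<^esub> y = point (\<lambda>n. \<ominus> rep y n)"
    unfolding a_inv_def[of B] m_inv_def[of "add_monoid B"]
  proof (rule the_equality)
    \<comment> \<open>Outside the carrier the ring laws do not apply to \<open>y\<close>, so the
      definite description behind the additive inverse is evaluated directly, with \<open>y\<close>
      acting through \<open>rep y\<close>.\<close>
    have add_rep: "y \<oplus>\<^bsub>B\<^esub> point \<sigma> = point (\<lambda>n. rep y n \<oplus> \<sigma> n)"
        "point \<sigma> \<oplus>\<^bsub>B\<^esub> y = point (\<lambda>n. \<sigma> n \<oplus> rep y n)" if "\<sigma> \<in> Cseq" for \<sigma>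
    proof -
      have "equiv_seq (\<lambda>n. rep y n \<oplus> rep (point \<sigma>) n) (\<lambda>n. rep y n \<oplus> \<sigma> n)"
        "equiv_seq (\<lambda>n. rep (point \<sigma>) n \<oplus> rep y n) (\<lambda>n. \<sigma> n \<oplus> rep y n)"
        using that rep_Cseq rep_point by (auto intro!: close_add close_refl)
      then show "y \<oplus>\<^bsub>B\<^esub> point \<sigma> = point (\<lambda>n. rep y n \<oplus> \<sigma> n)"
        "point \<sigma> \<oplus>\<^bsub>B\<^esub> y = point (\<lambda>n. \<sigma> n \<oplus> rep y n)"
        using point_eq_iff[OF Cseq_add Cseq_add] rep_Cseq that by (auto simp: completion_def)
    qed
    show "point (\<lambda>n. \<ominus> rep y n) \<in> carrier (add_monoid B) \<and>
        y \<otimes>\<^bsub>add_monoid B\<^esub> point (\<lambda>n. \<ominus> rep y n) = \<one>\<^bsub>add_monoid B\<^esub> \<and>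
        point (\<lambda>n. \<ominus> rep y n) \<otimes>\<^bsub>add_monoid B\<^esub> y = \<one>\<^bsub>add_monoid B\<^esub>"
      using rep_Cseq[of y] by (simp add: add_rep Cseq_minus B_simps r_neg l_neg)
    fix z assume "z \<in> carrier (add_monoid B) \<and> y \<otimes>\<^bsub>add_monoid B\<^esub> z = \<one>\<^bsub>add_monoid B\<^esub> \<and>
        z \<otimes>\<^bsub>add_monoid B\<^esub> y = \<one>\<^bsub>add_monoid B\<^esub>"
    then have z: "z \<in> carrier B" "y \<oplus>\<^bsub>B\<^esub> z = \<zero>\<^bsub>B\<^esub>" by auto
    obtain \<sigma> where \<sigma>: "\<sigma> \<in> Cseq" "z = point \<sigma>" using B_elem[OF z(1)] .
    have "equiv_seq (\<lambda>n. rep y n \<oplus> \<sigma> n) (\<lambda>n. \<zero>)"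
      using z(2) add_rep \<sigma> point_eq_iff[OF Cseq_add[OF rep_Cseq \<sigma>(1)] Cseq_zero]
      by (simp add: B_simps)
    moreover have "(rep y n \<oplus> \<sigma> n) \<ominus> \<zero> = \<sigma> n \<ominus> (\<ominus> rep y n)" for n
      using \<sigma>(1) rep_Cseq[of y] by (simp add: a_minus_def a_comm)
    ultimately have "equiv_seq \<sigma> (\<lambda>n. \<ominus> rep y n)" by (simp add: close_def)
    then show "z = point (\<lambda>n. \<ominus> rep y n)"
      using point_eq_iff[OF \<sigma>(1) Cseq_minus[OF rep_Cseq]] \<sigma>(2) by simp
  qed
  moreover have "x \<oplus>\<^bsub>B\<^esub> point (\<lambda>n. \<ominus> rep y n) = point (\<lambda>n. rep x n \<oplus> \<ominus> rep y n)"
  proof -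
    have "equiv_seq (\<lambda>n. rep x n \<oplus> rep (point (\<lambda>n. \<ominus> rep y n)) n) (\<lambda>n. rep x n \<oplus> \<ominus> rep y n)"
      using rep_Cseq Cseq_minus rep_point by (intro close_add close_refl) auto
    then show ?thesis
      using point_eq_iff[OF Cseq_add[OF rep_Cseq rep_Cseq] Cseq_add[OF rep_Cseq Cseq_minus[OF rep_Cseq]]]
      by (simp add: completion_def)
  qed
  ultimately show ?thesis by (simp add: a_minus_def)
qed

lemma B_dist: "(\<lambda>n. nrm A (rep x n \<ominus> rep y n)) \<longlonglongrightarrow> nrm B (x \<ominus>\<^bsub>B\<^esub> y)"
  unfolding B_diff by (rule B_nrm(2)[OF Cseq_diff[OF rep_Cseq rep_Cseq]])

lemma B_dist_point:
  assumes "\<sigma> \<in> Cseq" "\<tau> \<in> Cseq"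
  shows "(\<lambda>n. nrm A (\<sigma> n \<ominus> \<tau> n)) \<longlonglongrightarrow> nrm B (point \<sigma> \<ominus>\<^bsub>B\<^esub> point \<tau>)"
proof -
  have "equiv_seq (\<lambda>n. rep (point \<sigma>) n \<oplus> \<ominus> rep (point \<tau>) n) (\<lambda>n. \<sigma> n \<oplus> \<ominus> \<tau> n)"
  proof (intro close_add)
    have "equiv_seq (\<lambda>n. (- 1) \<odot> rep (point \<tau>) n) (\<lambda>n. (- 1) \<odot> \<tau> n)"
      using B_smult[OF assms(2), of "- 1"] point_eq_iff[OF Cseq_smult[OF rep_Cseq] Cseq_smult[OF assms(2)]]
      by (simp add: completion_def)
    then show "equiv_seq (\<lambda>n. \<ominus> rep (point \<tau>) n) (\<lambda>n. \<ominus> \<tau> n)"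
      using assms rep_Cseq by (simp add: minus_smult smult_one)
  qed (use assms rep_Cseq rep_point in auto)
  then have "point \<sigma> \<ominus>\<^bsub>B\<^esub> point \<tau> = point (\<lambda>n. \<sigma> n \<ominus> \<tau> n)"
    unfolding B_diff using point_eq_iff[OF Cseq_diff[OF rep_Cseq rep_Cseq] Cseq_diff[OF assms]]
    by (simp add: a_minus_def)
  then show ?thesis using B_nrm(2)[OF Cseq_diff[OF assms]] by simp
qed

lemma Metric_space_B: "Metric_space (carrier B) (\<lambda>x y. nrm B (x \<ominus>\<^bsub>B\<^esub> y))"
proof
  fix x y
  show "0 \<le> nrm B (x \<ominus>\<^bsub>B\<^esub> y)"
    using rep_Cseq by (intro LIMSEQ_le_const[OF B_dist[of x y]]) (auto simp: nrm_nonneg)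
  have "nrm A (rep x n \<ominus> rep y n) = nrm A (rep y n \<ominus> rep x n)" for n
    using rep_Cseq by (intro nrm_diff_commute) auto
  then show "nrm B (x \<ominus>\<^bsub>B\<^esub> y) = nrm B (y \<ominus>\<^bsub>B\<^esub> x)"
    using LIMSEQ_unique[OF B_dist[of x y]] B_dist[of y x] by simp
next
  fix x y assume xy: "x \<in> carrier B" "y \<in> carrier B"
  have "nrm B (x \<ominus>\<^bsub>B\<^esub> y) = 0 \<longleftrightarrow> equiv_seq (rep x) (rep y)"
    unfolding close_def by (rule limit_zero_iff[OF B_dist])
  also have "\<dots> \<longleftrightarrow> x = y"
    using point_eq_iff[OF rep_Cseq rep_Cseq, of x y] point_rep xy by (simp add: B_simps)
  finally show "nrm B (x \<ominus>\<^bsub>B\<^esub> y) = 0 \<longleftrightarrow> x = y" .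
next
  fix x y z
  have "nrm A (rep x n \<ominus> rep z n) \<le> nrm A (rep x n \<ominus> rep y n) + nrm A (rep y n \<ominus> rep z n)" for n
    using rep_Cseq by (intro nrm_diff_triangle) auto
  then show "nrm B (x \<ominus>\<^bsub>B\<^esub> z) \<le> nrm B (x \<ominus>\<^bsub>B\<^esub> y) + nrm B (y \<ominus>\<^bsub>B\<^esub> z)"
    by (intro LIMSEQ_le[OF B_dist tendsto_add[OF B_dist B_dist]]) auto
qed

text \<open>A late enough term of the approximating sequence in \<open>D\<close> is near the whole
  tail of \<open>\<sigma>\<close>.\<close>

lemma dense_constants:
  assumes "\<sigma> \<in> Cseq" "e > 0"
  obtains y where "y \<in> D" "nrm B (point \<sigma> \<ominus>\<^bsub>B\<^esub> point (\<lambda>n. y)) \<le> e"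
proof -
  obtain \<tau> where \<tau>: "approximable \<sigma> \<tau>" using Cseq_approx[OF assms(1)] by blast
  obtain N where N: "\<And>m n. m \<ge> N \<Longrightarrow> n \<ge> N \<Longrightarrow> nrm A (\<sigma> n \<ominus> \<sigma> m) < e / 2"
    using cauchyD[OF Cseq_cauchy[OF assms(1)], of "e / 2"] assms by auto
  have "(\<lambda>n. nrm A (\<sigma> n \<ominus> \<tau> n)) \<longlonglongrightarrow> 0"
    using \<tau> by (simp add: approximable_def close_def)
  then have "\<forall>\<^sub>F n in sequentially. nrm A (\<sigma> n \<ominus> \<tau> n) < e / 2"
    by (rule order_tendstoD(2)) (use assms(2) in simp)
  then obtain M where M: "\<And>n. n \<ge> M \<Longrightarrow> nrm A (\<sigma> n \<ominus> \<tau> n) < e / 2"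
    unfolding eventually_sequentially by blast
  define k where "k = max N M"
  have y: "\<tau> k \<in> D" "\<tau> k \<in> carrier A" using \<tau> approximable_carrier[OF \<tau>] by (auto simp: approximable_def)
  have le: "nrm A (\<sigma> n \<ominus> \<tau> k) \<le> e" if "n \<ge> N" for n
    using nrm_diff_triangle[of "\<sigma> n" "\<sigma> k" "\<tau> k"] N[of k n] M[of k] that assms(1) y(2)
    by (simp add: k_def)
  have "nrm B (point \<sigma> \<ominus>\<^bsub>B\<^esub> point (\<lambda>n. \<tau> k)) \<le> e"
    by (rule LIMSEQ_le_const2[OF B_dist_point[OF assms(1) Cseq_const[OF y(1)]]]) (use le in blast)
  then show ?thesis using that y(1) by blast
qed

lemma nrm_constants:
  assumes "x \<in> D" "y \<in> D"
  shows "nrm B (point (\<lambda>n. x) \<ominus>\<^bsub>B\<^esub> point (\<lambda>n. y)) = nrm A (x \<ominus> y)"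
  using LIMSEQ_unique[OF B_dist_point[OF Cseq_const[OF assms(1)] Cseq_const[OF assms(2)]] tendsto_const] .

text \<open>Replace \<open>S m\<close> by the class of a constant \<open>y m\<close> from
  \<open>D\<close> within \<open>1 / (m + 1)\<close>. Constants keep their distances, so
  \<open>y\<close> is itself a Cauchy sequence in \<open>D\<close>, and its class is the
  limit.\<close>

lemma mcomplete_B: "Metric_space.mcomplete (carrier B) (\<lambda>x y. nrm B (x \<ominus>\<^bsub>B\<^esub> y))"
proof -
  interpret M: Metric_space "carrier B" "\<lambda>x y. nrm B (x \<ominus>\<^bsub>B\<^esub> y)" by (rule Metric_space_B)
  show ?thesis
    unfolding M.mcomplete_def
  proof (intro allI impI)
    fix S assume S: "M.MCauchy S"
    then have SB: "S m \<in> carrier B" for m by (auto simp: M.MCauchy_def)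
    have "\<exists>y\<in>D. nrm B (S m \<ominus>\<^bsub>B\<^esub> point (\<lambda>n. y)) \<le> inverse (real (Suc m))" for m
    proof -
      obtain \<sigma> where "\<sigma> \<in> Cseq" "S m = point \<sigma>" using B_elem[OF SB] .
      then show ?thesis using dense_constants[of \<sigma> "inverse (real (Suc m))"] by auto
    qed
    then have "\<forall>m. \<exists>y. y \<in> D \<and> nrm B (S m \<ominus>\<^bsub>B\<^esub> point (\<lambda>n. y)) \<le> inverse (real (Suc m))" by blast
    from choice[OF this] obtain y where y: "\<And>m. y m \<in> D"
      "\<And>m. nrm B (S m \<ominus>\<^bsub>B\<^esub> point (\<lambda>n. y m)) \<le> inverse (real (Suc m))" by blast
    define c where "c m = point (\<lambda>n. y m)" for m
    have cB: "c m \<in> carrier B" for m using Cseq_const[OF y(1)] by (simp add: c_def B_simps)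
    have yc: "y m \<in> carrier A" for m using y(1) D_P P_carrier by blast
    have Sc: "nrm B (S m \<ominus>\<^bsub>B\<^esub> c m) \<le> inverse (real (Suc m))" for m using y(2) by (simp add: c_def)
    have dy: "nrm A (y m \<ominus> y n) = nrm B (c m \<ominus>\<^bsub>B\<^esub> c n)" for m n
      using nrm_constants[OF y(1) y(1)] by (simp add: c_def)
    have small: "\<exists>N. \<forall>n\<ge>N. inverse (real (Suc n)) < e" if "e > 0" for e
      using order_tendstoD(2)[OF LIMSEQ_inverse_real_of_nat that] by (simp add: eventually_sequentially)
    have cau: "cauchy y"
    proof (rule cauchyI[OF yc])
      fix e :: real assume e: "e > 0"
      obtain N1 where N1: "\<And>n. n \<ge> N1 \<Longrightarrow> inverse (real (Suc n)) < e / 3" using small[of "e / 3"] e by auto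
      obtain N2 where N2: "\<And>m n. m \<ge> N2 \<Longrightarrow> n \<ge> N2 \<Longrightarrow> nrm B (S m \<ominus>\<^bsub>B\<^esub> S n) < e / 3"
        using S e unfolding M.MCauchy_def by (meson divide_pos_pos zero_less_numeral)
      have "nrm A (y n \<ominus> y m) < e" if "m \<ge> max N1 N2" "n \<ge> max N1 N2" for m n
      proof -
        have "nrm B (c n \<ominus>\<^bsub>B\<^esub> c m) \<le> nrm B (c n \<ominus>\<^bsub>B\<^esub> S n) + (nrm B (S n \<ominus>\<^bsub>B\<^esub> S m) + nrm B (S m \<ominus>\<^bsub>B\<^esub> c m))"
          using M.triangle[OF cB[of n] SB[of n] cB[of m]] M.triangle[OF SB[of n] SB[of m] cB[of m]]
          by linarith
        then show ?thesis
          using Sc[of n] Sc[of m] M.commute[of "c n" "S n"] N1[of n] N1[of m] N2[of n m] that dy[of n m] by simp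
      qed
      then show "\<exists>N. \<forall>m\<ge>N. \<forall>n\<ge>N. nrm A (y n \<ominus> y m) < e" by blast
    qed
    have yC: "y \<in> Cseq"
      using y(1) D_P cau yc by (intro CseqI[of _ y]) (auto intro: close_refl)
    have "limitin M.mtopology S (point y) sequentially"
      unfolding M.limitin_metric
    proof (intro conjI allI impI)
      show "point y \<in> carrier B" using yC by (simp add: B_simps)
      then have yB: "point y \<in> carrier B" .
      fix e :: real assume e: "e > 0"
      obtain N1 where N1: "\<And>n. n \<ge> N1 \<Longrightarrow> inverse (real (Suc n)) < e / 2" using small[of "e / 2"] e by auto
      obtain N2 where N2: "\<And>m n. m \<ge> N2 \<Longrightarrow> n \<ge> N2 \<Longrightarrow> nrm A (y n \<ominus> y m) < e / 2"
        using cauchyD[OF cau yc, of "e / 2"] e by auto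
      have "nrm B (S m \<ominus>\<^bsub>B\<^esub> point y) < e" if m: "m \<ge> max N1 N2" for m
      proof -
        have "nrm B (c m \<ominus>\<^bsub>B\<^esub> point y) \<le> e / 2"
          unfolding c_def
        proof (rule LIMSEQ_le_const2[OF B_dist_point[OF Cseq_const[OF y(1)] yC]])
          have "nrm A (y m \<ominus> y n) \<le> e / 2" if "n \<ge> N2" for n using N2[of n m] that m by simp
          then show "\<exists>N. \<forall>n\<ge>N. nrm A (y m \<ominus> y n) \<le> e / 2" by blast
        qed
        then show ?thesis
          using M.triangle[OF SB cB yB, of m m] Sc[of m] N1[of m] m by simp
      qed
      then show "\<forall>\<^sub>F m in sequentially. S m \<in> carrier B \<and> nrm B (S m \<ominus>\<^bsub>B\<^esub> point y) < e"
        unfolding eventually_sequentially using SB by blast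
    qed
    then show "\<exists>x. limitin M.mtopology S x sequentially" by blast
  qed
qed

text \<open>The algebraic laws hold term by term on representatives, and the norm laws pass to the
  limit.\<close>

lemma cstar_B: "unital_cstar_algebra B"
proof (intro unital_cstar_algebra.intro[OF ring_B] unital_cstar_algebra_axioms.intro mcomplete_B)
  fix x y c d assume "x \<in> carrier B"
  then obtain \<sigma> where s: "\<sigma> \<in> Cseq" "x = point \<sigma>" by (auto simp: B_simps)
  show "c \<odot>\<^bsub>B\<^esub> x \<in> carrier B" "star B x \<in> carrier B" using s by (simp_all add: B_ops B_simps)
  show "(c + d) \<odot>\<^bsub>B\<^esub> x = c \<odot>\<^bsub>B\<^esub> x \<oplus>\<^bsub>B\<^esub> d \<odot>\<^bsub>B\<^esub> x" using s by (simp add: B_ops smult_l_distr)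
  show "(c * d) \<odot>\<^bsub>B\<^esub> x = c \<odot>\<^bsub>B\<^esub> (d \<odot>\<^bsub>B\<^esub> x)" using s by (simp add: B_ops smult_smult)
  show "1 \<odot>\<^bsub>B\<^esub> x = x" using s by (simp add: B_ops smult_one)
  show "star B (star B x) = x" using s by (simp add: B_ops star_star)
  show "star B (c \<odot>\<^bsub>B\<^esub> x) = cnj c \<odot>\<^bsub>B\<^esub> star B x" using s by (simp add: B_ops star_smult)
  show "0 \<le> nrm B x"
    unfolding s(2) by (rule LIMSEQ_le_const[OF B_nrm(2)[OF s(1)]]) (use s(1) in \<open>auto simp: nrm_nonneg\<close>)
  have z: "\<sigma> n \<ominus> \<zero> = \<sigma> n" for n using s(1) by (simp add: a_minus_def)
  have "nrm B x = 0 \<longleftrightarrow> (\<lambda>n. nrm A (\<sigma> n)) \<longlonglongrightarrow> 0"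
    unfolding s(2) by (rule limit_zero_iff[OF B_nrm(2)[OF s(1)]])
  also have "\<dots> \<longleftrightarrow> x = \<zero>\<^bsub>B\<^esub>"
    using point_eq_iff[OF s(1) Cseq_zero] s(2) by (simp add: close_def z B_simps)
  finally show "nrm B x = 0 \<longleftrightarrow> x = \<zero>\<^bsub>B\<^esub>" .
  have "(\<lambda>n. nrm A (c \<odot> \<sigma> n)) \<longlonglongrightarrow> cmod c * nrm B x"
    unfolding s(2) using s(1) by (simp add: nrm_smult tendsto_mult_left B_nrm(2))
  then show "nrm B (c \<odot>\<^bsub>B\<^esub> x) = cmod c * nrm B x"
    using LIMSEQ_unique[OF B_nrm(2)[OF Cseq_smult[OF s(1)]]] s B_smult[OF s(1), of c] by simp
  have "(\<lambda>n. nrm A (star A (\<sigma> n) \<otimes> \<sigma> n)) \<longlonglongrightarrow> (nrm B x)\<^sup>2"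
    unfolding s(2) using s(1) by (simp add: cstar_identity tendsto_power B_nrm(2))
  then show "nrm B (star B x \<otimes>\<^bsub>B\<^esub> x) = (nrm B x)\<^sup>2"
    using LIMSEQ_unique[OF B_nrm(2)[OF Cseq_mult[OF Cseq_star[OF s(1)] s(1)]]] s
      B_mult[OF Cseq_star[OF s(1)] s(1)] B_star[OF s(1)] by simp
next
  fix x y c assume "x \<in> carrier B" "y \<in> carrier B"
  then obtain \<sigma> \<tau> where s: "\<sigma> \<in> Cseq" "x = point \<sigma>" "\<tau> \<in> Cseq" "y = point \<tau>" by (auto simp: B_simps)
  show "c \<odot>\<^bsub>B\<^esub> (x \<oplus>\<^bsub>B\<^esub> y) = c \<odot>\<^bsub>B\<^esub> x \<oplus>\<^bsub>B\<^esub> c \<odot>\<^bsub>B\<^esub> y" using s by (simp add: B_ops smult_r_distr)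
  show "c \<odot>\<^bsub>B\<^esub> x \<otimes>\<^bsub>B\<^esub> y = c \<odot>\<^bsub>B\<^esub> (x \<otimes>\<^bsub>B\<^esub> y)" using s by (simp add: B_ops smult_mult_left)
  show "x \<otimes>\<^bsub>B\<^esub> (c \<odot>\<^bsub>B\<^esub> y) = c \<odot>\<^bsub>B\<^esub> (x \<otimes>\<^bsub>B\<^esub> y)" using s by (simp add: B_ops smult_mult_right)
  show "star B (x \<oplus>\<^bsub>B\<^esub> y) = star B x \<oplus>\<^bsub>B\<^esub> star B y" using s by (simp add: B_ops star_add)
  show "star B (x \<otimes>\<^bsub>B\<^esub> y) = star B y \<otimes>\<^bsub>B\<^esub> star B x" using s by (simp add: B_ops star_mult)
  show "nrm B (x \<oplus>\<^bsub>B\<^esub> y) \<le> nrm B x + nrm B y"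
    unfolding s(2,4) B_add[OF s(1,3)]
    by (rule LIMSEQ_le[OF B_nrm(2)[OF Cseq_add[OF s(1,3)]] tendsto_add[OF B_nrm(2)[OF s(1)] B_nrm(2)[OF s(3)]]])
      (use s in \<open>simp add: nrm_triangle\<close>)
  show "nrm B (x \<otimes>\<^bsub>B\<^esub> y) \<le> nrm B x * nrm B y"
    unfolding s(2,4) B_mult[OF s(1,3)]
    by (rule LIMSEQ_le[OF B_nrm(2)[OF Cseq_mult[OF s(1,3)]] tendsto_mult[OF B_nrm(2)[OF s(1)] B_nrm(2)[OF s(3)]]])
      (use s in \<open>simp add: nrm_mult\<close>)
qed

definition embed :: "'x \<Rightarrow> 'x" where "embed x = point (\<lambda>n. x)"

lemma embed_closed: "x \<in> D \<Longrightarrow> embed x \<in> carrier B"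
  by (simp add: embed_def B_simps Cseq_const)

lemma embed_add: "x \<in> D \<Longrightarrow> y \<in> D \<Longrightarrow> embed (x \<oplus> y) = embed x \<oplus>\<^bsub>B\<^esub> embed y"
  by (simp add: embed_def B_add Cseq_const)

lemma embed_mult: "x \<in> D \<Longrightarrow> y \<in> D \<Longrightarrow> embed (x \<otimes> y) = embed x \<otimes>\<^bsub>B\<^esub> embed y"
  by (simp add: embed_def B_mult Cseq_const)

lemma embed_star: "x \<in> D \<Longrightarrow> embed (star A x) = star B (embed x)"
  by (simp add: embed_def B_star Cseq_const)

lemma embed_one: "embed p = \<one>\<^bsub>B\<^esub>" and embed_zero: "embed \<zero> = \<zero>\<^bsub>B\<^esub>"
  by (simp_all add: embed_def B_simps)

lemma B_one_neq_zero: "\<one>\<^bsub>B\<^esub> \<noteq> \<zero>\<^bsub>B\<^esub>"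
proof
  assume "\<one>\<^bsub>B\<^esub> = \<zero>\<^bsub>B\<^esub>"
  then have "(\<lambda>n::nat. nrm A (p \<ominus> \<zero>)) \<longlonglongrightarrow> 0"
    using point_eq_iff[OF Cseq_unit Cseq_zero] by (simp add: B_simps close_def)
  then have "(\<lambda>n::nat. nrm A p) \<longlonglongrightarrow> 0" using p_simps by (simp add: a_minus_def)
  then have "nrm A p = 0" by (rule LIMSEQ_unique[OF tendsto_const])
  then show False using nrm_eq_0_iff p p_simps by simp
qed

lemma embed_finsum:
  assumes "finite I" "\<And>i. i \<in> I \<Longrightarrow> f i \<in> D"
  shows "(\<Oplus>i\<in>I. f i) \<in> D \<and> embed (\<Oplus>i\<in>I. f i) = (\<Oplus>\<^bsub>B\<^esub>i\<in>I. embed (f i))"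
  using assms
proof (induction I)
  case empty
  interpret C: unital_cstar_algebra B by (rule cstar_B)
  show ?case by (simp add: D_zero embed_zero)
next
  case (insert i I)
  interpret C: unital_cstar_algebra B by (rule cstar_B)
  have c: "f j \<in> carrier A" if "j \<in> insert i I" for j using insert.prems[OF that] D_P P_carrier by blast
  have IH: "(\<Oplus>i\<in>I. f i) \<in> D" "embed (\<Oplus>i\<in>I. f i) = (\<Oplus>\<^bsub>B\<^esub>i\<in>I. embed (f i))" using insert by auto
  have "(\<Oplus>i\<in>insert i I. f i) = f i \<oplus> (\<Oplus>i\<in>I. f i)" using insert c by (intro finsum_insert) auto
  moreover have "(\<Oplus>\<^bsub>B\<^esub>i\<in>insert i I. embed (f i)) = embed (f i) \<oplus>\<^bsub>B\<^esub> (\<Oplus>\<^bsub>B\<^esub>i\<in>I. embed (f i))"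
    using insert embed_closed by (intro C.finsum_insert) auto
  ultimately show ?case using IH insert.prems D_add embed_add by simp
qed

end

section \<open>From a rectangle to a quantum isomorphism of induced subgraphs\<close>

context quantum_graph_iso
begin

text \<open>Both sums equal their product: multiply the left one by the full column of
  \<open>j\<close> and the right one by the full row of \<open>i\<close>, and use that nonzero
  products respect edges. So the intertwining relation survives although neighbours outside the
  rectangle are left out.\<close>

lemma rect_sums_agree:
  assumes r: "rect p b b'" and i: "i \<in> b'" and j: "j \<in> b"
  shows "(\<Oplus>k\<in>{k \<in> b. (k, j) \<in> R}. p \<otimes> u i k) = (\<Oplus>y\<in>{y \<in> b'. (i, y) \<in> R'}. p \<otimes> u y j)"
proof -
  note V = rect_subset[OF r]
  let ?S = "{k \<in> b. (k, j) \<in> R}" and ?T = "{y \<in> b'. (i, y) \<in> R'}"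
  define w where "w z k = p \<otimes> u z k" for z k
  have c: "w z k \<in> carrier A" if "k \<in> b" "z \<in> b'" for z k
    using that V rect_proj[OF r] by (simp add: w_def)
  have wp: "w z k \<otimes> p = w z k" "p \<otimes> w z k = w z k" if "k \<in> b" "z \<in> b'" for z k
  proof -
    have cc: "u z k \<in> carrier A" "p \<in> carrier A" using that V rect_proj[OF r] by auto
    show 1: "p \<otimes> w z k = w z k"
      using cc rect_proj(3)[OF r] unfolding w_def by (simp flip: m_assoc)
    have "w z k \<otimes> p = p \<otimes> w z k"
      using cc rect_commute[OF r that] unfolding w_def by (simp add: m_assoc)
    then show "w z k \<otimes> p = w z k" using 1 by simp
  qed
  have orth: "w i k \<otimes> w y j = \<zero>" if "k \<in> b" "y \<in> b'" "((k, j) \<in> R) \<noteq> ((i, y) \<in> R')" for k y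
  proof (rule ccontr)
    assume "w i k \<otimes> w y j \<noteq> \<zero>"
    then have "p \<otimes> u i k \<otimes> u y j \<noteq> \<zero>" using rect_mult[OF r that(1) i j that(2)] by (simp add: w_def)
    then have "linked i k y j" by (rule rect_linked[OF r that(1) i j that(2)])
    then show False using linked_edge V that i j by auto
  qed
  define X where "X = (\<Oplus>k\<in>?S. w i k)"
  define Y where "Y = (\<Oplus>y\<in>?T. w y j)"
  have XY: "X \<in> carrier A" "Y \<in> carrier A"
    unfolding X_def Y_def using c i j by (auto intro!: finsum_closed)
  have pc: "p \<in> carrier A" using rect_proj[OF r] by simp
  have fin: "finite ?S" "finite ?T" using V by auto
  have "X = X \<otimes> p"
    unfolding X_def using c i wp fin pc by (subst finsum_ldistr) (auto intro!: finsum_cong')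
  also have "\<dots> = X \<otimes> (\<Oplus>y\<in>b'. w y j)" using rect_column[OF r j] by (simp add: w_def)
  also have "\<dots> = (\<Oplus>y\<in>b'. X \<otimes> w y j)" using XY c j V by (intro finsum_rdistr) auto
  also have "\<dots> = (\<Oplus>y\<in>?T. X \<otimes> w y j)"
  proof (rule finsum_restrict)
    fix y assume y: "y \<in> b' - ?T"
    have "X \<otimes> w y j = (\<Oplus>k\<in>?S. w i k \<otimes> w y j)"
      unfolding X_def using c i j y fin by (intro finsum_ldistr) auto
    also have "\<dots> = \<zero>"
    proof (rule add.finprod_one_eqI)
      fix k assume "k \<in> ?S"
      then show "w i k \<otimes> w y j = \<zero>" using y by (intro orth) auto
    qed
    finally show "X \<otimes> w y j = \<zero>" .
  qed (use XY c j V in auto)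
  also have "\<dots> = X \<otimes> Y" unfolding Y_def using XY c j fin by (intro finsum_rdistr[symmetric]) auto
  finally have 1: "X = X \<otimes> Y" .
  have "Y = p \<otimes> Y"
    unfolding Y_def using c j wp fin pc by (subst finsum_rdistr) (auto intro!: finsum_cong')
  also have "\<dots> = (\<Oplus>k\<in>b. w i k) \<otimes> Y" using rect_row[OF r i] by (simp add: w_def)
  also have "\<dots> = (\<Oplus>k\<in>b. w i k \<otimes> Y)" using XY c i V by (intro finsum_ldistr) auto
  also have "\<dots> = (\<Oplus>k\<in>?S. w i k \<otimes> Y)"
  proof (rule finsum_restrict)
    fix k assume k: "k \<in> b - ?S"
    have "w i k \<otimes> Y = (\<Oplus>y\<in>?T. w i k \<otimes> w y j)"
      unfolding Y_def using c i j k fin by (intro finsum_rdistr) auto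
    also have "\<dots> = \<zero>"
    proof (rule add.finprod_one_eqI)
      fix y assume "y \<in> ?T"
      then show "w i k \<otimes> w y j = \<zero>" using k by (intro orth) auto
    qed
    finally show "w i k \<otimes> Y = \<zero>" .
  qed (use XY c i V in auto)
  also have "\<dots> = X \<otimes> Y" unfolding X_def using XY c i fin by (intro finsum_ldistr[symmetric]) auto
  finally have 2: "Y = X \<otimes> Y" .
  have "X = Y" using 1 2 by (rule trans[OF _ sym])
  then show ?thesis unfolding X_def Y_def w_def .
qed

lemma rect_quantum_isomorphic:
  assumes r: "rect p b b'"
    and G0: "verts G0 = b" "\<And>k j. \<lbrakk>k \<in> b; j \<in> b\<rbrakk> \<Longrightarrow> k \<rightarrow>\<^bsub>G0\<^esub> j \<longleftrightarrow> (k, j) \<in> R"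
    and H0: "verts H0 = b'" "\<And>y i. \<lbrakk>y \<in> b'; i \<in> b'\<rbrakk> \<Longrightarrow> y \<rightarrow>\<^bsub>H0\<^esub> i \<longleftrightarrow> (y, i) \<in> R'"
  shows "quantum_isomorphic TYPE('x) G0 H0"
proof -
  note V = rect_subset[OF r]
  define w where "w z k = p \<otimes> u z k" for z k
  \<comment> \<open>Including \<open>p\<close> makes the set nonempty, so that
    \<open>from_nat_into\<close> enumerates exactly this set.\<close>
  define W where "W = insert p ((\<lambda>(z, k). w z k) ` (b' \<times> b))"
  define gen where "gen = from_nat_into W"
  have W: "countable W" "W \<noteq> {}" using V by (auto simp: W_def countable_finite)
  have range: "range gen = W" unfolding gen_def using W by (intro range_from_nat_into) auto
  have WP: "x \<in> carrier A \<and> p \<otimes> x = x \<and> x \<otimes> p = x" if "x \<in> W" for x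
  proof -
    have "w z k \<in> carrier A \<and> p \<otimes> w z k = w z k \<and> w z k \<otimes> p = w z k" if kz: "k \<in> b" "z \<in> b'" for z k
    proof -
      have cc: "u z k \<in> carrier A" "p \<in> carrier A" using kz V rect_proj[OF r] by auto
      have 1: "p \<otimes> w z k = w z k"
        using cc rect_proj(3)[OF r] unfolding w_def by (simp flip: m_assoc)
      have "w z k \<otimes> p = p \<otimes> w z k"
        using cc rect_commute[OF r kz] unfolding w_def by (simp add: m_assoc)
      then show ?thesis using 1 cc by (simp add: w_def)
    qed
    then show ?thesis using that rect_proj[OF r] by (auto simp: W_def)
  qed
  have gW: "gen n \<in> W" for n using range by blast
  interpret C: corner_completion A p gen
    by unfold_locales (use rect_proj[OF r] WP[OF gW] in auto)
  interpret B: unital_cstar_algebra C.completion by (rule C.cstar_B)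
  have wD: "w z k \<in> C.D" if "k \<in> b" "z \<in> b'" for z k
  proof -
    have "w z k \<in> range gen" unfolding range using that by (auto simp: W_def)
    then show ?thesis using C.D_gen by auto
  qed
  have wproj: "w z k \<otimes> w z k = w z k" "star A (w z k) = w z k" if "k \<in> b" "z \<in> b'" for z k
    using rect_entry_proj[OF r that] by (auto simp: proj_def w_def)
  define U where "U z k = C.embed (w z k)" for z k
  have Uc: "U z k \<in> carrier C.completion" if "k \<in> b" "z \<in> b'" for z k
    unfolding U_def by (rule C.embed_closed[OF wD[OF that]])
  \<comment> \<open>A matching in the support supplies the equality of cardinalities required of a
    quantum isomorphism.\<close>
  have "\<exists>f. bij_betw f b b' \<and> (\<forall>k\<in>b. w (f k) k \<noteq> \<zero>)"
    by (rule magic_support_matching[where p = p])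
      (use V rect_entry_proj[OF r] rect_column[OF r] rect_row[OF r] rect_proj[OF r] in \<open>auto simp: w_def\<close>)
  then have card: "card b = card b'" using bij_betw_same_card by blast
  have magic: "magic_unitary C.completion b' b U"
    unfolding magic_unitary_def
  proof (intro conjI ballI)
    fix z k assume zk: "z \<in> b'" "k \<in> b"
    show "U z k \<in> carrier C.completion" by (rule Uc[OF zk(2,1)])
    show "U z k \<otimes>\<^bsub>C.completion\<^esub> U z k = U z k"
      using C.embed_mult[OF wD[OF zk(2,1)] wD[OF zk(2,1)]] wproj[OF zk(2,1)] by (simp add: U_def)
    show "star C.completion (U z k) = U z k"
      using C.embed_star[OF wD[OF zk(2,1)]] wproj[OF zk(2,1)] by (simp add: U_def)
  next
    fix k assume k: "k \<in> b"
    have "C.embed (\<Oplus>z\<in>b'. w z k) = (\<Oplus>\<^bsub>C.completion\<^esub>z\<in>b'. U z k)"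
      unfolding U_def using C.embed_finsum[of b' "\<lambda>z. w z k"] V(4) wD[OF k] by blast
    then show "(\<Oplus>\<^bsub>C.completion\<^esub>z\<in>b'. U z k) = \<one>\<^bsub>C.completion\<^esub>"
      using rect_column[OF r k] C.embed_one by (simp add: w_def)
  next
    fix z assume z: "z \<in> b'"
    have "C.embed (\<Oplus>k\<in>b. w z k) = (\<Oplus>\<^bsub>C.completion\<^esub>k\<in>b. U z k)"
      unfolding U_def using C.embed_finsum[of b "\<lambda>k. w z k"] V(3) wD[OF _ z] by blast
    then show "(\<Oplus>\<^bsub>C.completion\<^esub>k\<in>b. U z k) = \<one>\<^bsub>C.completion\<^esub>"
      using rect_row[OF r z] C.embed_one by (simp add: w_def)
  qed (use V in auto)
  have "(\<Oplus>\<^bsub>C.completion\<^esub>k\<in>b. adj G0 k j \<odot>\<^bsub>C.completion\<^esub> U i k) =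
      (\<Oplus>\<^bsub>C.completion\<^esub>y\<in>b'. adj H0 i y \<odot>\<^bsub>C.completion\<^esub> U y j)"
    if i: "i \<in> b'" and j: "j \<in> b" for i j
  proof -
    let ?S = "{k \<in> b. (k, j) \<in> R}" and ?T = "{y \<in> b'. (i, y) \<in> R'}"
    have "(\<Oplus>\<^bsub>C.completion\<^esub>k\<in>b. adj G0 k j \<odot>\<^bsub>C.completion\<^esub> U i k) =
        (\<Oplus>\<^bsub>C.completion\<^esub>k\<in>?S. adj G0 k j \<odot>\<^bsub>C.completion\<^esub> U i k)"
      using V Uc i j G0(2) by (intro B.finsum_restrict) (auto simp: adj_def B.smult_zero_scalar)
    also have "\<dots> = (\<Oplus>\<^bsub>C.completion\<^esub>k\<in>?S. U i k)"
      using Uc i j G0(2) by (intro B.finsum_cong') (auto simp: adj_def B.smult_one)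
    also have "\<dots> = C.embed (\<Oplus>k\<in>?S. w i k)"
      unfolding U_def using C.embed_finsum[of ?S "\<lambda>k. w i k"] V wD i by auto
    also have "(\<Oplus>k\<in>?S. w i k) = (\<Oplus>y\<in>?T. w y j)"
      unfolding w_def by (rule rect_sums_agree[OF r i j])
    also have "C.embed (\<Oplus>y\<in>?T. w y j) = (\<Oplus>\<^bsub>C.completion\<^esub>y\<in>?T. U y j)"
      unfolding U_def using C.embed_finsum[of ?T "\<lambda>y. w y j"] V wD j by auto
    also have "\<dots> = (\<Oplus>\<^bsub>C.completion\<^esub>y\<in>?T. adj H0 i y \<odot>\<^bsub>C.completion\<^esub> U y j)"
      using Uc i j H0(2) by (intro B.finsum_cong') (auto simp: adj_def B.smult_one)
    also have "\<dots> = (\<Oplus>\<^bsub>C.completion\<^esub>y\<in>b'. adj H0 i y \<odot>\<^bsub>C.completion\<^esub> U y j)"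
      using V Uc i j H0(2) by (intro B.finsum_restrict[symmetric]) (auto simp: adj_def B.smult_zero_scalar)
    finally show ?thesis .
  qed
  then have "quantum_isomorphism C.completion G0 H0 U"
    unfolding quantum_isomorphism_def G0(1) H0(1) using card magic by blast
  then show ?thesis
    unfolding quantum_isomorphic_def using C.cstar_B C.B_one_neq_zero by blast
qed

end

section \<open>Blocks and cut vertices of digraphs\<close>

text \<open>The projection argument of \<open>block_path_inside\<close>, with no vertex
  removed.\<close>

lemma (in fin_conn_graph) block_path:
  assumes B: "is_block B" and "k \<in> B" "l \<in> B"
  shows "(k, l) \<in> (R \<inter> B \<times> B)\<^sup>*"
proof -
  have BV: "B \<subseteq> V" by (rule is_block_subset[OF B])
  have "(k, anchor B m) \<in> (R \<inter> B \<times> B)\<^sup>* \<and> m \<in> V" if "(k, m) \<in> R\<^sup>*" for m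
    using that
  proof (induction rule: rtrancl_induct)
    case base
    then show ?case using anchor_self[OF B] BV assms by auto
  next
    case (step m m')
    then have m': "m' \<in> V" "m \<in> V" "(m, m') \<in> R" using edges by auto
    have "anchor B m = anchor B m' \<or> (m = anchor B m \<and> m' = anchor B m')"
      using same_block_across_anchors[OF B] m' same_block_edge by blast
    then show ?case
    proof (elim disjE)
      assume "m = anchor B m \<and> m' = anchor B m'"
      then have "(anchor B m, anchor B m') \<in> R" using m'(3) by simp
      moreover have "anchor B m \<in> B" "anchor B m' \<in> B" using anchor_mem[OF B] m' by blast+
      ultimately have "(anchor B m, anchor B m') \<in> R \<inter> B \<times> B" by blast
      then show ?thesis using step(3) m'(1) by (blast intro: rtrancl.rtrancl_into_rtrancl)
    qed (use step m' in simp)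
  qed
  from this[of l] show ?thesis
    using connected assms BV anchor_self[OF B] by auto
qed

lemma sym_digraph_connected_iff:
  assumes "sym_digraph H"
  shows "Digraph_Component.connected H \<longleftrightarrow>
    verts H \<noteq> {} \<and> (\<forall>u\<in>verts H. \<forall>v\<in>verts H. (u, v) \<in> (arcs_ends H)\<^sup>*)"
proof -
  interpret H: sym_digraph H by fact
  have "symcl (arcs_ends H) = arcs_ends H"
    using H.graph_symmetric by (auto simp: symcl_def)
  then show ?thesis
    unfolding connected_conv using H.reachable_conv by (auto simp: reachable_def)
qed

lemma arcs_ends_induce: "arcs_ends (G \<restriction> S) = arcs_ends G \<inter> S \<times> S"
  by (auto simp: arcs_ends_def arc_to_ends_def)

lemma arcs_ends_del_vert:
  "arcs_ends (pre_digraph.del_vert G v) = arcs_ends G \<inter> (- {v}) \<times> (- {v})"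
  by (auto simp: arcs_ends_def arc_to_ends_def pre_digraph.del_vert_simps)

lemma sym_digraph_del_vert:
  assumes "sym_digraph H"
  shows "sym_digraph (pre_digraph.del_vert H v)"
proof -
  interpret H: sym_digraph H by fact
  have "sym (arcs_ends (pre_digraph.del_vert H v))"
    using H.graph_symmetric unfolding arcs_ends_del_vert sym_def by blast
  then show ?thesis
    using wf_digraph.sym_digraphI[OF H.wf_digraph_del_vert] by (simp add: symmetric_def)
qed

section \<open>Blocks as induced subgraphs and cut vertices through inseparability\<close>

locale connected_graph = graph G for G :: "('a, 'b) pre_digraph" (structure) +
  assumes connected_G: "Digraph_Component.connected G"

sublocale connected_graph \<subseteq> F: fin_conn_graph "verts G" "arcs_ends G"
proof
  show "finite (verts G)" by simp
  show "arcs_ends G \<subseteq> verts G \<times> verts G" by (auto dest: adj_in_verts)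
  show "sym (arcs_ends G)" using graph_symmetric by (auto simp: sym_def)
  show "(a, b) \<in> (arcs_ends G)\<^sup>*" if "a \<in> verts G" "b \<in> verts G" for a b
    using sym_digraph_connected_iff[of G] connected_G that sym_digraph_axioms by blast
qed

context connected_graph
begin

lemma verts_nonempty: "verts G \<noteq> {}"
  using sym_digraph_connected_iff[of G] connected_G sym_digraph_axioms by blast

lemma graph_induce: "S \<subseteq> verts G \<Longrightarrow> graph (G \<restriction> S)"
proof -
  assume S: "S \<subseteq> verts G"
  interpret D: digraph "G \<restriction> S" by (rule digraphI_induced[OF induced_induce[OF S]])
  have "symmetric (G \<restriction> S)" using sym_arcs induced_graph_imp_symmetric induced_induce[OF S] by blast
  then show ?thesis by (rule D.graphI)
qed

lemma two_connected_block:
  assumes B: "F.is_block B"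
  shows "two_connected (G \<restriction> B)"
  unfolding two_connected_def
proof (intro conjI ballI)
  have BV: "B \<subseteq> verts G" by (rule F.is_block_subset[OF B])
  show g: "graph (G \<restriction> B)" by (rule graph_induce[OF BV])
  have s: "sym_digraph (G \<restriction> B)" by (rule induced_graph_imp_graph[OF induced_induce[OF BV]])
  obtain a where a: "a \<in> B" by (rule F.is_block_two[OF B])
  show "Digraph_Component.connected (G \<restriction> B)"
    unfolding sym_digraph_connected_iff[OF s] arcs_ends_induce
    using a F.block_path[OF B] by auto
  fix v assume "v \<in> verts (G \<restriction> B)"
  then have v: "v \<in> B" by simp
  obtain c where c: "c \<in> B" "c \<noteq> v" by (rule F.is_block_other[OF B])
  have e: "arcs_ends G \<inter> B \<times> B \<inter> (- {v}) \<times> (- {v}) = arcs_ends G \<inter> (B - {v}) \<times> (B - {v})" by blast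
  have "(k, l) \<in> (arcs_ends G \<inter> (B - {v}) \<times> (B - {v}))\<^sup>*" if "k \<in> B - {v}" "l \<in> B - {v}" for k l
    using F.block_path_inside[OF B, of k l v] F.block_conn[OF B, of k l v] that v BV by auto
  then show "Digraph_Component.connected (pre_digraph.del_vert (G \<restriction> B) v)"
    unfolding sym_digraph_connected_iff[OF sym_digraph_del_vert[OF s]] arcs_ends_del_vert
      arcs_ends_induce e pre_digraph.verts_del_vert
    using c by auto
qed

text \<open>A separator inside \<open>H\<close> is excluded by 2-connectedness, one outside
  \<open>H\<close> by the connectedness of \<open>H\<close> itself.\<close>

lemma two_connected_same_block:
  assumes s: "subgraph H G" and H: "two_connected H" and kl: "k \<in> verts H" "l \<in> verts H"
  shows "F.same_block k l"
  unfolding F.same_block_def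
proof (intro ballI impI)
  fix v assume v: "v \<in> verts G" "v \<noteq> k \<and> v \<noteq> l"
  interpret H: graph H using H by (simp add: two_connected_def)
  have sH: "sym_digraph H" by unfold_locales
  have R: "arcs_ends H \<subseteq> arcs_ends G" "arcs_ends H \<subseteq> verts H \<times> verts H"
    using arcs_ends_mono[OF s] H.adj_in_verts by auto
  show "F.conn v k l"
  proof (cases "v \<in> verts H")
    case True
    then have "Digraph_Component.connected (pre_digraph.del_vert H v)"
      using H by (simp add: two_connected_def)
    then have "(k, l) \<in> (arcs_ends H \<inter> (- {v}) \<times> (- {v}))\<^sup>*"
      unfolding sym_digraph_connected_iff[OF sym_digraph_del_vert[OF sH]] arcs_ends_del_vert
        pre_digraph.verts_del_vert
      using kl v by blast
    moreover have "arcs_ends H \<inter> (- {v}) \<times> (- {v}) \<subseteq> arcs_ends G \<inter> (- {v}) \<times> (- {v})" using R by blast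
    ultimately show ?thesis unfolding conn_avoiding_def using rtrancl_mono by blast
  next
    case False
    have "(k, l) \<in> (arcs_ends H)\<^sup>*"
      using H kl sym_digraph_connected_iff[OF sH] by (simp add: two_connected_def)
    moreover have "arcs_ends H \<subseteq> arcs_ends G \<inter> (- {v}) \<times> (- {v})" using R False by blast
    ultimately show ?thesis unfolding conn_avoiding_def using rtrancl_mono by blast
  qed
qed

lemma two_connected_two:
  assumes H: "two_connected H"
  obtains k l where "k \<in> verts H" "l \<in> verts H" "k \<noteq> l"
proof -
  interpret H: graph H using H by (simp add: two_connected_def)
  have sH: "sym_digraph H" by unfold_locales
  obtain k where k: "k \<in> verts H"
    using H sym_digraph_connected_iff[OF sH] by (auto simp: two_connected_def)
  then have "Digraph_Component.connected (pre_digraph.del_vert H k)"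
    using H by (simp add: two_connected_def)
  then have "verts H - {k} \<noteq> {}"
    unfolding sym_digraph_connected_iff[OF sym_digraph_del_vert[OF sH]] pre_digraph.verts_del_vert by blast
  then show ?thesis using that k by blast
qed

text \<open>A 2-connected subgraph lies in the induced graph on the block of any two of its
  vertices, so a maximal one is that induced graph. Conversely a 2-connected graph above an induced
  block has pairwise inseparable vertices and cannot exceed it.\<close>

lemma blocks_eq: "blocks G = (\<lambda>B. G \<restriction> B) ` {B. F.is_block B}"
proof (intro equalityI subsetI)
  fix H assume "H \<in> blocks G"
  then have H: "two_connected H" "subgraph H G"
    and max: "\<And>H'. \<lbrakk>H' \<noteq> H; subgraph H H'; subgraph H' G\<rbrakk> \<Longrightarrow> \<not> two_connected H'"
    by (auto simp: blocks_def max_subgraph_def)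
  obtain k l where kl: "k \<in> verts H" "l \<in> verts H" "k \<noteq> l" by (rule two_connected_two[OF H(1)])
  have HV: "verts H \<subseteq> verts G" using H(2) by (simp add: subgraph_def)
  define B where "B = F.block_of k l"
  have B: "F.is_block B"
    unfolding B_def using kl HV two_connected_same_block[OF H(2,1)] by (intro F.is_block_block_of) auto
  have BV: "B \<subseteq> verts G" by (rule F.is_block_subset[OF B])
  have HB: "verts H \<subseteq> B"
    unfolding B_def F.block_of_def using HV kl two_connected_same_block[OF H(2,1)] by auto
  have s: "subgraph (G \<restriction> B) G" by (rule induced_imp_subgraph[OF induced_induce[OF BV]])
  have "subgraph H (G \<restriction> verts H)" by (rule subgraph_induce_subgraphI2[OF H(2)])
  then have "subgraph H (G \<restriction> B)"
    using HB wellformed_induce_subgraph[of B] by (auto simp: subgraph_def compatible_def)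
  then have "G \<restriction> B = H" using max[OF _ _ s] two_connected_block[OF B] by blast
  then show "H \<in> (\<lambda>B. G \<restriction> B) ` {B. F.is_block B}" using B by blast
next
  fix H assume "H \<in> (\<lambda>B. G \<restriction> B) ` {B. F.is_block B}"
  then obtain B where B: "F.is_block B" and H: "H = G \<restriction> B" by blast
  have BV: "B \<subseteq> verts G" by (rule F.is_block_subset[OF B])
  have "max_subgraph two_connected (G \<restriction> B)"
  proof (rule max_subgraphI)
    show "two_connected (G \<restriction> B)" by (rule two_connected_block[OF B])
    show "subgraph (G \<restriction> B) G" by (rule induced_imp_subgraph[OF induced_induce[OF BV]])
    fix K assume K: "G \<restriction> B \<noteq> K" "subgraph (G \<restriction> B) K" "subgraph K G"
    show "\<not> two_connected K"
    proof
      assume tc: "two_connected K"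
      have BK: "B \<subseteq> verts K" using K(2) by (simp add: subgraph_def)
      have "verts K \<subseteq> B"
      proof
        fix k assume k: "k \<in> verts K"
        then have "k \<in> verts G" using K(3) by (auto simp: subgraph_def)
        then show "k \<in> B"
          by (rule F.is_block_maximal[OF B]) (use two_connected_same_block[OF K(3) tc k] BK in blast)
      qed
      then have v: "verts K = B" using BK by blast
      have "subgraph K (G \<restriction> B)" using subgraph_induce_subgraphI2[OF K(3)] v by simp
      then have "K = G \<restriction> B" using K(2) by (auto simp: subgraph_def compatible_def)
      then show False using K(1) by simp
    qed
  qed
  then show "H \<in> blocks G" by (simp add: blocks_def H)
qed

text \<open>Describes separation by \<open>v\<close> through \<open>same_block\<close> alone.
  Neighbours of \<open>v\<close> in different components are inseparable from \<open>v\<close> but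
  not from each other; conversely, only \<open>v\<close> can separate two vertices that are
  inseparable from \<open>v\<close>.\<close>

lemma separating_iff:
  assumes "v \<in> verts G"
  shows "(\<exists>k\<in>verts G - {v}. \<exists>l\<in>verts G - {v}. \<not> F.conn v k l) \<longleftrightarrow>
    (\<exists>k\<in>verts G. \<exists>l\<in>verts G. F.same_block v k \<and> F.same_block v l \<and> \<not> F.same_block k l)"
proof
  assume "\<exists>k\<in>verts G - {v}. \<exists>l\<in>verts G - {v}. \<not> F.conn v k l"
  then obtain k l where kl: "k \<in> verts G" "k \<noteq> v" "l \<in> verts G" "l \<noteq> v" "\<not> F.conn v k l" by blast
  obtain k' where k': "k' \<in> verts G" "k' \<noteq> v" "(v, k') \<in> arcs_ends G" "F.conn v k k'"
    using F.exists_neighbour_towards assms kl(1,2) by blast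
  obtain l' where l': "l' \<in> verts G" "l' \<noteq> v" "(v, l') \<in> arcs_ends G" "F.conn v l l'"
    using F.exists_neighbour_towards assms kl(3,4) by blast
  have "\<not> F.conn v k' l'" using k'(4) l'(4) kl(5) F.conn_trans F.conn_sym by blast
  then have "\<not> F.same_block k' l'" using F.same_block_conn[of k' l' v] assms k'(2) l'(2) by auto
  then show "\<exists>k\<in>verts G. \<exists>l\<in>verts G. F.same_block v k \<and> F.same_block v l \<and> \<not> F.same_block k l"
    using k' l' F.same_block_edge by blast
next
  assume "\<exists>k\<in>verts G. \<exists>l\<in>verts G. F.same_block v k \<and> F.same_block v l \<and> \<not> F.same_block k l"
  then obtain k l where kl: "k \<in> verts G" "l \<in> verts G" "F.same_block v k" "F.same_block v l"
    "\<not> F.same_block k l" by blast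
  then obtain w where w: "w \<in> verts G" "w \<noteq> k" "w \<noteq> l" "\<not> F.conn w k l"
    by (auto simp: F.same_block_def)
  have "w = v"
  proof (rule ccontr)
    assume "w \<noteq> v"
    then have "F.conn w v k" "F.conn w v l" using F.same_block_conn kl(3,4) w by blast+
    then show False using w(4) F.conn_sym F.conn_trans by blast
  qed
  then show "\<exists>k\<in>verts G - {v}. \<exists>l\<in>verts G - {v}. \<not> F.conn v k l" using w kl by blast
qed

text \<open>As \<open>G\<close> has a single component, the count grows exactly when two vertices
  are disconnected by the removal of \<open>v\<close>.\<close>

lemma cut_vertices_eq:
  "cut_vertices G = {v \<in> verts G. card (verts G) = 1 \<or>
     (\<exists>k\<in>verts G. \<exists>l\<in>verts G. F.same_block v k \<and> F.same_block v l \<and> \<not> F.same_block k l)}"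
proof -
  have "card (pre_digraph.sccs (pre_digraph.del_vert G v)) > card sccs \<longleftrightarrow>
      (\<exists>k\<in>verts G - {v}. \<exists>l\<in>verts G - {v}. \<not> F.conn v k l)" if v: "v \<in> verts G" for v
  proof -
    have s: "sym_digraph G" by unfold_locales
    interpret D: sym_digraph "del_vert v" by (rule sym_digraph_del_vert[OF s])
    have "strongly_connected G"
      using symmetric_connected_imp_strongly_connected connected_G sym_arcs by blast
    then have 1: "card sccs = 1" using strongly_connected_eq_iff by simp
    have reach: "k \<rightarrow>\<^sup>*\<^bsub>del_vert v\<^esub> l \<longleftrightarrow> F.conn v k l" if "k \<in> verts G - {v}" "l \<in> verts G - {v}" for k l
      using that by (simp add: D.reachable_conv conn_avoiding_def arcs_ends_del_vert pre_digraph.verts_del_vert)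
    have scc: "D.scc_of k = D.scc_of l \<longleftrightarrow> F.conn v k l" if kl: "k \<in> verts G - {v}" "l \<in> verts G - {v}" for k l
    proof
      assume "D.scc_of k = D.scc_of l"
      then have "l \<in> D.scc_of k" using D.in_scc_of_self[of l] kl by (simp add: pre_digraph.verts_del_vert)
      then show "F.conn v k l" using reach[OF kl] by (simp add: pre_digraph.scc_of_def)
    next
      assume "F.conn v k l"
      then have "k \<in> D.scc_of l" using D.scc_ofI_reachable reach[OF kl] by blast
      then show "D.scc_of k = D.scc_of l" by (rule D.scc_of_eq)
    qed
    have "card D.sccs = card (D.scc_of ` (verts G - {v}))"
      using D.card_sccs_verts D.sccs_verts_conv_scc_of by (simp add: pre_digraph.verts_del_vert)
    moreover have "card (D.scc_of ` (verts G - {v})) \<le> Suc 0 \<longleftrightarrow>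
        (\<forall>k\<in>verts G - {v}. \<forall>l\<in>verts G - {v}. F.conn v k l)"
      using scc by (subst card_le_Suc0_iff_eq) auto
    ultimately show ?thesis using 1 by auto
  qed
  then show ?thesis
    unfolding cut_vertices_def using separating_iff by auto
qed

end

section \<open>The isomorphisms of block trees and block graphs\<close>

lemma graph_isomorphismI:
  assumes bij: "bij_betw f (pverts X) (pverts Y)"
    and X: "parcs X \<subseteq> pverts X \<times> pverts X" and Y: "parcs Y \<subseteq> pverts Y \<times> pverts Y"
    and arcs: "\<And>a b. \<lbrakk>a \<in> pverts X; b \<in> pverts X\<rbrakk> \<Longrightarrow> (a, b) \<in> parcs X \<longleftrightarrow> (f a, f b) \<in> parcs Y"
  shows "graph_morphism f X Y \<and> graph_isomorphism f X Y"
proof -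
  have inj: "inj_on f (pverts X)" and im: "f ` pverts X = pverts Y" using bij by (auto simp: bij_betw_def)
  have m: "graph_morphism f X Y" unfolding graph_morphism_def using im X arcs by blast
  let ?g = "the_inv_into (pverts X) f"
  have g: "?g c \<in> pverts X \<and> f (?g c) = c" if "c \<in> pverts Y" for c
    using that inj im the_inv_into_into[OF inj, of c "pverts X"] f_the_inv_into_f[OF inj, of c] by auto
  have "graph_morphism ?g Y X"
    unfolding graph_morphism_def
  proof (intro conjI allI impI)
    show "?g ` pverts Y \<subseteq> pverts X" using g by blast
    fix c d assume cd: "(c, d) \<in> parcs Y"
    then have "c \<in> pverts Y" "d \<in> pverts Y" using Y by auto
    then show "(?g c, ?g d) \<in> parcs X" using arcs[of "?g c" "?g d"] g cd by simp
  qed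
  then show ?thesis using m bij by (simp add: graph_isomorphism_def)
qed

theorem theoremA:
  fixes G :: "('a, 'b) pre_digraph" and H :: "('c, 'd) pre_digraph"
  assumes "graph G" and "Digraph_Component.connected G"
    and "graph H" and "Digraph_Component.connected H"
    and "quantum_isomorphic TYPE('x) G H"
  shows
    "(\<exists>\<alpha>. graph_morphism \<alpha> (block_tree G) (block_tree H) \<and>
          graph_isomorphism \<alpha> (block_tree G) (block_tree H) \<and>
          (\<forall>c\<in>cut_vertices G. \<exists>c'\<in>cut_vertices H. \<alpha> (Inr c) = Inr c') \<and>
          (\<forall>b\<in>blocks G. \<exists>b'\<in>blocks H. \<alpha> (Inl b) = Inl b' \<and>
             quantum_isomorphic TYPE('x) (G \<restriction> verts b) (H \<restriction> verts b'))) \<and>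
     (\<exists>\<beta>. graph_morphism \<beta> (block_graph G) (block_graph H) \<and>
          graph_isomorphism \<beta> (block_graph G) (block_graph H) \<and>
          (\<forall>b\<in>blocks G. quantum_isomorphic TYPE('x) (G \<restriction> verts b) (H \<restriction> verts (\<beta> b))))"
proof -
  interpret G: connected_graph G using assms(1,2) by (simp add: connected_graph_def connected_graph_axioms_def)
  interpret H: connected_graph H using assms(3,4) by (simp add: connected_graph_def connected_graph_axioms_def)
  obtain A :: "'x cstar" and u where A: "unital_cstar_algebra A" "\<one>\<^bsub>A\<^esub> \<noteq> \<zero>\<^bsub>A\<^esub>"
    and q: "quantum_isomorphism A G H u"
    using assms(5) by (auto simp: quantum_isomorphic_def)
  interpret A: unital_cstar_algebra A by (rule A(1))
  interpret Q: quantum_graph_iso A "verts G" "arcs_ends G" "verts H" "arcs_ends H" u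
    by unfold_locales
      (use A(2) q in \<open>auto simp: quantum_isomorphism_def magic_unitary_def A.proj_def adj_def\<close>)
  obtain \<sigma> where \<sigma>: "Q.block_iso \<sigma> (verts G) (verts H)"
    using Q.exists_block_iso[OF G.verts_nonempty] by blast
  have bij: "bij_betw \<sigma> (verts G) (verts H)"
    and same: "\<And>k l. \<lbrakk>k \<in> verts G; l \<in> verts G\<rbrakk> \<Longrightarrow> G.F.same_block k l \<longleftrightarrow> H.F.same_block (\<sigma> k) (\<sigma> l)"
    and rect: "\<And>k l. \<lbrakk>k \<in> verts G; l \<in> verts G; k \<noteq> l; G.F.same_block k l\<rbrakk> \<Longrightarrow>
      \<exists>p. Q.rect p (G.F.block_of k l) (H.F.block_of (\<sigma> k) (\<sigma> l))"
    using \<sigma> by (auto simp: Q.block_iso_def)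
  have inj: "inj_on \<sigma> (verts G)" and im: "\<sigma> ` verts G = verts H" using bij by (auto simp: bij_betw_def)
  have \<sigma>V: "\<sigma> k \<in> verts H" if "k \<in> verts G" for k using im that by blast
  have block_of: "\<sigma> ` G.F.block_of k l = H.F.block_of (\<sigma> k) (\<sigma> l)" if "k \<in> verts G" "l \<in> verts G" for k l
  proof -
    have "H.F.block_of (\<sigma> k) (\<sigma> l) =
        {y \<in> \<sigma> ` verts G. H.F.same_block y (\<sigma> k) \<and> H.F.same_block y (\<sigma> l)}"
      by (simp add: H.F.block_of_def im)
    then show ?thesis using that same by (auto simp: G.F.block_of_def)
  qed
  have block: "H.F.is_block (\<sigma> ` B) \<and> (\<exists>p. Q.rect p B (\<sigma> ` B))" if B: "G.F.is_block B" for B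
  proof -
    obtain k l where kl: "k \<in> verts G" "l \<in> verts G" "k \<noteq> l" "G.F.same_block k l" "B = G.F.block_of k l"
      using B by (auto simp: G.F.is_block_def)
    have "\<sigma> k \<noteq> \<sigma> l" using inj kl by (auto dest: inj_onD)
    then have "H.F.is_block (H.F.block_of (\<sigma> k) (\<sigma> l))"
      using kl same \<sigma>V by (intro H.F.is_block_block_of) auto
    then show ?thesis using rect[OF kl(1-4)] block_of[OF kl(1,2)] kl(5) by simp
  qed
  \<comment> \<open>The induced subgraph on the image of the vertices, not the image of the
    subgraph: \<open>\<sigma>\<close> need not preserve edges.\<close>
  define \<phi> where "\<phi> b = H \<restriction> (\<sigma> ` verts b)" for b :: "('a, 'b) pre_digraph"
  have bV: "verts b \<subseteq> verts G" if "b \<in> blocks G" for b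
  proof -
    obtain B where "G.F.is_block B" "b = G \<restriction> B" using \<open>b \<in> blocks G\<close> by (auto simp: G.blocks_eq)
    then show ?thesis using G.F.is_block_subset[of B] by simp
  qed
  have \<phi>_inj: "\<phi> b = \<phi> b' \<longleftrightarrow> b = b'" if b: "b \<in> blocks G" "b' \<in> blocks G" for b b'
  proof
    assume "\<phi> b = \<phi> b'"
    then have "verts (\<phi> b) = verts (\<phi> b')" by simp
    then have "\<sigma> ` verts b = \<sigma> ` verts b'" by (simp add: \<phi>_def)
    then have "verts b = verts b'" using inj_on_image_eq_iff[OF inj bV[OF b(1)] bV[OF b(2)]] by simp
    \<comment> \<open>A block is induced, hence determined by its vertices.\<close>
    then show "b = b'" using b by (auto simp: G.blocks_eq)
  qed simp
  have \<phi>_bij: "bij_betw \<phi> (blocks G) (blocks H)"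
    unfolding bij_betw_def
  proof (intro conjI equalityI subsetI)
    show "inj_on \<phi> (blocks G)" using \<phi>_inj by (auto intro: inj_onI)
    fix b' assume "b' \<in> \<phi> ` blocks G"
    then show "b' \<in> blocks H" using block by (auto simp: \<phi>_def G.blocks_eq H.blocks_eq)
  next
    fix b' assume "b' \<in> blocks H"
    then obtain B' where B': "H.F.is_block B'" "b' = H \<restriction> B'" by (auto simp: H.blocks_eq)
    then obtain x y where xy: "x \<in> verts H" "y \<in> verts H" "x \<noteq> y" "H.F.same_block x y" "B' = H.F.block_of x y"
      by (auto simp: H.F.is_block_def)
    obtain k l where kl: "k \<in> verts G" "x = \<sigma> k" "l \<in> verts G" "y = \<sigma> l"
      using xy(1,2) im by blast
    have "G.F.is_block (G.F.block_of k l)"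
      using kl xy same by (intro G.F.is_block_block_of) auto
    then have "G \<restriction> G.F.block_of k l \<in> blocks G" by (auto simp: G.blocks_eq)
    moreover have "\<phi> (G \<restriction> G.F.block_of k l) = b'"
      using block_of[OF kl(1,3)] kl xy(5) B'(2) by (simp add: \<phi>_def)
    ultimately show "b' \<in> \<phi> ` blocks G" by blast
  qed
  have \<phi>_blocks: "\<phi> b \<in> blocks H" if "b \<in> blocks G" for b using \<phi>_bij that by (auto simp: bij_betw_def)
  have \<phi>_quantum: "quantum_isomorphic TYPE('x) (G \<restriction> verts b) (H \<restriction> verts (\<phi> b))" if "b \<in> blocks G" for b
  proof -
    have "G.F.is_block (verts b)" using that by (auto simp: G.blocks_eq)
    then obtain p where "Q.rect p (verts b) (\<sigma> ` verts b)" using block by blast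
    then show ?thesis
      by (rule Q.rect_quantum_isomorphic) (auto simp: \<phi>_def arcs_ends_induce)
  qed
  \<comment> \<open>By \<open>cut_vertices_eq\<close>, being a cut vertex depends only on the number
    of vertices and on \<open>same_block\<close>, both preserved by \<open>\<sigma>\<close>.\<close>
  have cut: "c \<in> cut_vertices G \<longleftrightarrow> \<sigma> c \<in> cut_vertices H" if "c \<in> verts G" for c
  proof -
    have "card (verts G) = card (verts H)" using bij by (rule bij_betw_same_card)
    moreover have "(\<exists>k\<in>verts G. \<exists>l\<in>verts G. G.F.same_block c k \<and> G.F.same_block c l \<and> \<not> G.F.same_block k l) \<longleftrightarrow>
        (\<exists>x\<in>\<sigma> ` verts G. \<exists>y\<in>\<sigma> ` verts G.
          H.F.same_block (\<sigma> c) x \<and> H.F.same_block (\<sigma> c) y \<and> \<not> H.F.same_block x y)"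
      using that same by simp
    ultimately show ?thesis
      using that \<sigma>V by (simp add: G.cut_vertices_eq H.cut_vertices_eq im)
  qed
  have cutV: "cut_vertices G \<subseteq> verts G" "cut_vertices H \<subseteq> verts H" by (auto simp: cut_vertices_def)
  have cut_bij: "bij_betw \<sigma> (cut_vertices G) (cut_vertices H)"
  proof -
    have "\<sigma> ` cut_vertices G = cut_vertices H"
    proof (intro equalityI subsetI)
      fix x assume "x \<in> \<sigma> ` cut_vertices G"
      then obtain c where "c \<in> cut_vertices G" and x: "x = \<sigma> c" by (rule imageE)
      then show "x \<in> cut_vertices H" using cut[of c] subsetD[OF cutV(1), of c] by simp
    next
      fix x assume x: "x \<in> cut_vertices H"
      then have "x \<in> \<sigma> ` verts G" using subsetD[OF cutV(2)] im by simp
      then obtain c where c: "c \<in> verts G" and "x = \<sigma> c" by (rule imageE)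
      then show "x \<in> \<sigma> ` cut_vertices G" using cut[OF c] x by simp
    qed
    then show ?thesis using inj_on_subset[OF inj cutV(1)] by (simp add: bij_betw_def)
  qed
  have mem: "c \<in> verts b \<longleftrightarrow> \<sigma> c \<in> verts (\<phi> b)" if "c \<in> verts G" "b \<in> blocks G" for c b
    using inj_on_image_mem_iff[OF inj that(1) bV[OF that(2)]] by (simp add: \<phi>_def)
  define \<alpha> where "\<alpha> = map_sum \<phi> \<sigma>"
  have tree: "graph_morphism \<alpha> (block_tree G) (block_tree H) \<and> graph_isomorphism \<alpha> (block_tree G) (block_tree H)"
  proof (rule graph_isomorphismI)
    show "bij_betw \<alpha> (pverts (block_tree G)) (pverts (block_tree H))"
      unfolding bij_betw_def
    proof (rule conjI)
      show "inj_on \<alpha> (pverts (block_tree G))"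
      proof (rule inj_onI)
        fix s t assume st: "s \<in> pverts (block_tree G)" "t \<in> pverts (block_tree G)" and eq: "\<alpha> s = \<alpha> t"
        show "s = t"
        proof (cases s)
          case (Inl b)
          with eq obtain b' where t: "t = Inl b'" "\<phi> b = \<phi> b'" by (cases t) (simp_all add: \<alpha>_def)
          have "b \<in> blocks G" "b' \<in> blocks G" using st Inl t(1) by (auto simp: block_tree_def)
          then show ?thesis using \<phi>_inj t Inl by simp
        next
          case (Inr c)
          with eq obtain c' where t: "t = Inr c'" "\<sigma> c = \<sigma> c'" by (cases t) (simp_all add: \<alpha>_def)
          have "c \<in> verts G" "c' \<in> verts G"
            using st Inr t(1) subsetD[OF cutV(1)] by (auto simp: block_tree_def)
          then show ?thesis using inj_onD[OF inj t(2)] t(1) Inr by simp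
        qed
      qed
      have "\<alpha> ` pverts (block_tree G) = Inl ` \<phi> ` blocks G \<union> Inr ` \<sigma> ` cut_vertices G"
        by (simp add: \<alpha>_def block_tree_def image_Un image_image)
      then show "\<alpha> ` pverts (block_tree G) = pverts (block_tree H)"
        using \<phi>_bij cut_bij by (simp add: block_tree_def bij_betw_def)
    qed
    show "parcs (block_tree G) \<subseteq> pverts (block_tree G) \<times> pverts (block_tree G)"
      "parcs (block_tree H) \<subseteq> pverts (block_tree H) \<times> pverts (block_tree H)"
      by (auto simp: block_tree_def)
    have arc: "c \<in> verts b \<longleftrightarrow> \<sigma> c \<in> cut_vertices H \<and> \<phi> b \<in> blocks H \<and> \<sigma> c \<in> verts (\<phi> b)"
      if "c \<in> cut_vertices G" "b \<in> blocks G" for c b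
      using bij_betw_apply[OF cut_bij that(1)] \<phi>_blocks[OF that(2)]
        mem[OF subsetD[OF cutV(1) that(1)] that(2)] by simp
    fix s t assume "s \<in> pverts (block_tree G)" "t \<in> pverts (block_tree G)"
    then show "(s, t) \<in> parcs (block_tree G) \<longleftrightarrow> (\<alpha> s, \<alpha> t) \<in> parcs (block_tree H)"
      by (cases s; cases t) (auto simp: block_tree_def \<alpha>_def arc)
  qed
  have blockg: "graph_morphism \<phi> (block_graph G) (block_graph H) \<and> graph_isomorphism \<phi> (block_graph G) (block_graph H)"
  proof (rule graph_isomorphismI)
    show "bij_betw \<phi> (pverts (block_graph G)) (pverts (block_graph H))"
      using \<phi>_bij by (simp add: block_graph_def)
    show "parcs (block_graph G) \<subseteq> pverts (block_graph G) \<times> pverts (block_graph G)"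
      "parcs (block_graph H) \<subseteq> pverts (block_graph H) \<times> pverts (block_graph H)"
      by (auto simp: block_graph_def)
    fix s t assume "s \<in> pverts (block_graph G)" "t \<in> pverts (block_graph G)"
    then have st: "s \<in> blocks G" "t \<in> blocks G" by (auto simp: block_graph_def)
    have "verts (\<phi> s) \<inter> verts (\<phi> t) = \<sigma> ` (verts s \<inter> verts t)"
      using inj_on_image_Int[OF inj bV[OF st(1)] bV[OF st(2)]] by (simp add: \<phi>_def)
    then show "(s, t) \<in> parcs (block_graph G) \<longleftrightarrow> (\<phi> s, \<phi> t) \<in> parcs (block_graph H)"
      using st \<phi>_inj[OF st] \<phi>_blocks by (simp add: block_graph_def)
  qed
  have "\<forall>c\<in>cut_vertices G. \<exists>c'\<in>cut_vertices H. \<alpha> (Inr c) = Inr c'"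
    using bij_betw_apply[OF cut_bij] by (simp add: \<alpha>_def)
  moreover have "\<forall>b\<in>blocks G. \<exists>b'\<in>blocks H. \<alpha> (Inl b) = Inl b' \<and>
      quantum_isomorphic TYPE('x) (G \<restriction> verts b) (H \<restriction> verts b')"
    using \<phi>_blocks \<phi>_quantum by (simp add: \<alpha>_def)
  ultimately show ?thesis
    using tree blockg \<phi>_quantum by (intro conjI exI[of _ \<alpha>] exI[of _ \<phi>]) simp_all
qed

end
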